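(* Let $\Theta_4$ be the graph with vertex set $\{a_1,a_2,b_1,b_2,b_3,b_4\}$ and with exactly one edge joining $a_i$ to $b_j$ for each $i\in\{1,2\}$, $j\in\{1,2,3,4\}$, and no other edges. Then the discretized configuration space $\mathrm{Conf}^{\square}_3(\Theta_4)$ is homeomorphic to a closed, orientable surface of genus $3$.
   Context: For a finite graph $\Gamma$ (a 1-dimensional CW complex whose cells are its vertices and closed edges), the discretized configuration space $\mathrm{Conf}^{\square}_n(\Gamma)$ is the quotient by the permutation action of the symmetric group $S_n$ of the subcomplex of $\Gamma^n$ consisting of all products $e_1\times\cdots\times e_n$ of closed cells of $\Gamma$ with $e_i\cap e_j=\varnothing$ for all $i\ne j$. It is a cube complex whose $k$-cubes correspond to unordered collections of $k$ closed edges and $n-k$ vertices of $\Gamma$, all pairwise disjoint. The graph in the claim is the suspension of 4 points, with each of the four arcs joining $a_1$ to $a_2$ subdivided by one vertex $b_j$. *)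

theory Defs
  imports "HOL-Analysis.Analysis"
begin

section \<open>Quotient topology\<close>

text \<open>Points of the quotient are the classes \<open>R `` {x}\<close>. The relation \<open>R\<close> is meant to restrict to an
  equivalence relation on \<open>topspace X\<close> under which \<open>topspace X\<close> is saturated.\<close>

definition quotient_topology :: "'a topology \<Rightarrow> ('a \<times> 'a) set \<Rightarrow> 'a set topology" where
  "quotient_topology X R =
     topology (\<lambda>U. U \<subseteq> topspace X // R \<and> openin X {x \<in> topspace X. R `` {x} \<in> U})"

lemma openin_quotient_topology:
  "openin (quotient_topology X R) U \<longleftrightarrow>
     U \<subseteq> topspace X // R \<and> openin X {x \<in> topspace X. R `` {x} \<in> U}"
proof -
  have "istopology (\<lambda>U. U \<subseteq> topspace X // R \<and> openin X {x \<in> topspace X. R `` {x} \<in> U})"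
    unfolding istopology_def
  proof (intro conjI allI impI; (elim conjE)?)
    fix S T
    assume "S \<subseteq> topspace X // R" "T \<subseteq> topspace X // R"
      and S: "openin X {x \<in> topspace X. R `` {x} \<in> S}"
      and T: "openin X {x \<in> topspace X. R `` {x} \<in> T}"
    then show "S \<inter> T \<subseteq> topspace X // R" by blast
    have "{x \<in> topspace X. R `` {x} \<in> S \<inter> T} =
        {x \<in> topspace X. R `` {x} \<in> S} \<inter> {x \<in> topspace X. R `` {x} \<in> T}" by blast
    then show "openin X {x \<in> topspace X. R `` {x} \<in> S \<inter> T}"
      using openin_Int[OF S T] by simp
  next
    fix K
    assume K: "\<forall>S\<in>K. S \<subseteq> topspace X // R \<and> openin X {x \<in> topspace X. R `` {x} \<in> S}"
    then show "\<Union>K \<subseteq> topspace X // R" by blast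
    have "{x \<in> topspace X. R `` {x} \<in> \<Union>K} = (\<Union>S\<in>K. {x \<in> topspace X. R `` {x} \<in> S})" by blast
    moreover have "openin X (\<Union>S\<in>K. {x \<in> topspace X. R `` {x} \<in> S})"
      using K by (intro openin_Union) auto
    ultimately show "openin X {x \<in> topspace X. R `` {x} \<in> \<Union>K}" by simp
  qed
  then show ?thesis
    by (simp add: quotient_topology_def)
qed

lemma topspace_quotient_topology: "topspace (quotient_topology X R) = topspace X // R"
proof -
  have "{x \<in> topspace X. R `` {x} \<in> topspace X // R} = topspace X"
    by (auto simp: quotient_def)
  then have "openin (quotient_topology X R) (topspace X // R)"
    by (simp add: openin_quotient_topology)
  then show ?thesis
    by (metis openin_quotient_topology openin_subset openin_topspace subset_antisym)
qed

lemma quotient_map_quotient_topology: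
  "quotient_map X (quotient_topology X R) (\<lambda>x. R `` {x})"
  unfolding quotient_map_def topspace_quotient_topology openin_quotient_topology
  by (auto simp: quotient_def)


section \<open>Finite graphs as one-dimensional complexes\<close>

text \<open>A finite simple graph with vertex set \<open>V\<close> and edge set \<open>E\<close> (two-element subsets of \<open>V\<close>) is realized
  in barycentric coordinates: a point is a function on the vertices. The ambient topology is the product
  topology on functions, so on a finite graph it induces the CW topology.\<close>

definition closed_cell :: "'v set \<Rightarrow> ('v \<Rightarrow> real) set" where
  "closed_cell s = {x. (\<forall>v. 0 \<le> x v) \<and> (\<forall>v. v \<notin> s \<longrightarrow> x v = 0) \<and> (\<Sum>v\<in>s. x v) = 1}"

definition graph_cells :: "'v set \<Rightarrow> 'v set set \<Rightarrow> ('v \<Rightarrow> real) set set" where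
  "graph_cells V E = closed_cell ` ((\<lambda>v. {v}) ` V \<union> E)"

definition graph_space :: "'v set \<Rightarrow> 'v set set \<Rightarrow> ('v \<Rightarrow> real) topology" where
  "graph_space V E = top_of_set (\<Union>(graph_cells V E))"


section \<open>Discretized configuration spaces\<close>

definition ordered_dconf :: "'p set set \<Rightarrow> nat \<Rightarrow> (nat \<Rightarrow> 'p) set" where
  "ordered_dconf C n =
     \<Union>{(\<Pi>\<^sub>E i\<in>{..<n}. e i) | e.
          (\<forall>i<n. e i \<in> C) \<and> (\<forall>i<n. \<forall>j<n. i \<noteq> j \<longrightarrow> e i \<inter> e j = {})}"

definition perm_rel :: "nat \<Rightarrow> ((nat \<Rightarrow> 'p) \<times> (nat \<Rightarrow> 'p)) set" where
  "perm_rel n = {(x, y). \<exists>\<pi>. \<pi> permutes {..<n} \<and> y = x \<circ> \<pi>}"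

definition dconf :: "'v set \<Rightarrow> 'v set set \<Rightarrow> nat \<Rightarrow> (nat \<Rightarrow> 'v \<Rightarrow> real) set topology" where
  "dconf V E n =
     quotient_topology
       (subtopology (product_topology (\<lambda>_. graph_space V E) {..<n})
          (ordered_dconf (graph_cells V E) n))
       (perm_rel n)"


section \<open>The graph\<close>

datatype theta_vertex = A1 | A2 | B1 | B2 | B3 | B4

definition theta4_edges :: "theta_vertex set set" where
  "theta4_edges = {{a, b} | a b. a \<in> {A1, A2} \<and> b \<in> {B1, B2, B3, B4}}"


section \<open>The closed orientable surface of genus \<open>g\<close>\<close>

text \<open>The standard model for \<open>g \<ge> 1\<close>: a regular \<open>4g\<close>-gon whose sides are identified in pairs according to
  the word \<open>[\<alpha>\<^sub>1, \<beta>\<^sub>1] \<cdots> [\<alpha>\<^sub>g, \<beta>\<^sub>g]\<close>, read counterclockwise. The value at \<open>g = 0\<close> is not meaningful.\<close>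

definition polygon_vertex :: "nat \<Rightarrow> nat \<Rightarrow> complex" where
  "polygon_vertex m k = cis (2 * pi * real k / real m)"

definition polygon :: "nat \<Rightarrow> complex set" where
  "polygon m = convex hull (polygon_vertex m ` {..<m})"

definition polygon_side :: "nat \<Rightarrow> nat \<Rightarrow> real \<Rightarrow> complex" where
  "polygon_side m k t = (1 - t) *\<^sub>R polygon_vertex m k + t *\<^sub>R polygon_vertex m (Suc k)"

definition side_gluing :: "nat \<Rightarrow> complex \<Rightarrow> complex \<Rightarrow> bool" where
  "side_gluing g z w \<longleftrightarrow>
     (\<exists>j<g. \<exists>t\<in>{0..1}.
        z = polygon_side (4*g) (4*j) t \<and> w = polygon_side (4*g) (4*j + 2) (1 - t) \<or>
        z = polygon_side (4*g) (4*j + 1) t \<and> w = polygon_side (4*g) (4*j + 3) (1 - t))"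

definition closed_orientable_surface :: "nat \<Rightarrow> complex set topology" where
  "closed_orientable_surface g =
     quotient_topology (top_of_set (polygon (4*g))) {(z, w). equivclp (side_gluing g) z w}"

end

theory Submission
  imports Defs "HOL-Library.RBT_Impl"
begin

text \<open>The space \<open>dconf\<close> is a surface glued from 24 squares: a square moves one point from
\<open>a\<^sub>1\<close> to some \<open>b\<^sub>i\<close> and another from
\<open>a\<^sub>2\<close> to some \<open>b\<^sub>j\<close> with \<open>j \<noteq> i\<close>, while
the third rests at a remaining \<open>b\<^sub>k\<close>. With 20 vertices and 48 edges its Euler
characteristic is \<open>-4\<close>, which is right for genus 3; the proof exhibits a
homeomorphism with the polygon model instead of appealing to a classification of surfaces.

Cut every square along the diagonal that joins its two vertices \<open>{a\<^sub>2, b\<^sub>i,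
b\<^sub>k}\<close> and \<open>{a\<^sub>1, b\<^sub>j, b\<^sub>k}\<close>. Unlike the other
diagonals these are determined by their endpoints, so the result is a simplicial complex
(\<open>conf_facets\<close>); subdividing 12 of its edges yields the triangulation
\<open>surface\<close> with 72 triangles. The cyclic permutation of \<open>b\<^sub>1, b\<^sub>2,
b\<^sub>3\<close> acts on it with the two fixed vertices \<open>{a\<^sub>1, a\<^sub>2,
b\<^sub>4}\<close> and \<open>{b\<^sub>1, b\<^sub>2, b\<^sub>3}\<close>. In the quotient, a torus,
one chooses two loops at the first fixed vertex that avoid the second one; their preimage consists
of six loops of six edges each that meet only at \<open>{a\<^sub>1, a\<^sub>2, b\<^sub>4}\<close>.
For the chosen loops, cutting \<open>surface\<close> along them leaves a disc with 72 boundary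
edges whose boundary word is exactly \<open>[\<alpha>\<^sub>1, \<beta>\<^sub>1] [\<alpha>\<^sub>2,
\<beta>\<^sub>2] [\<alpha>\<^sub>3, \<beta>\<^sub>3]\<close> and whose only interior vertex is
\<open>{b\<^sub>1, b\<^sub>2, b\<^sub>3}\<close>. The facets \<open>disc\<close> and the names
\<open>labels\<close> of their vertices in \<open>surface\<close> record this. Finally 66 flips of
edges turn the disc into the cone over its boundary, and that cone is the regular 12-gon.

The vehicle is one piecewise linear map, \<open>exchange\<close>, which covers both the
subdivision of an edge and the flip of an edge; \<open>bij_betw_exchange\<close> says that it is a
bijection between the polyhedra. Which moves are made is data, and that they lead from one
triangulation to the next is a finite computation (\<open>wheel12_wheel72\<close>,
\<open>wheel72_disc\<close>, \<open>conf_surface\<close>). Both \<open>dconf\<close> and the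
polygon model then become quotients of compact spaces that have \<open>surface\<close> as a
quotient with the same fibres (\<open>quotient_maps_same_fibres\<close>). For the polygon this is
\<open>wheel_to_surface_glued\<close> with its converse \<open>glued_wheel_to_surface\<close>; for
the configurations it is \<open>square_fibres\<close>.\<close>

section \<open>Polyhedra given by lists of facets\<close>

text \<open>A simplicial complex is given by its facets. The points are barycentric coordinates, as for the
graph itself, so a face shared by two facets is shared by their cells without any gluing.\<close>

definition realization :: "'v list list \<Rightarrow> ('v \<Rightarrow> real) set" where
  "realization K = (\<Union>\<sigma>\<in>set K. closed_cell (set \<sigma>))"

lemma realizationI: "\<sigma> \<in> set K \<Longrightarrow> x \<in> closed_cell (set \<sigma>) \<Longrightarrow> x \<in> realization K"
  by (auto simp: realization_def)

lemma realizationE: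
  assumes "x \<in> realization K"
  obtains \<sigma> where "\<sigma> \<in> set K" "x \<in> closed_cell (set \<sigma>)"
  using assms by (auto simp: realization_def)

lemma closed_cell_iff:
  assumes "finite S" "s \<subseteq> S"
  shows "x \<in> closed_cell s \<longleftrightarrow> (\<forall>v. 0 \<le> x v) \<and> (\<forall>v. v \<notin> s \<longrightarrow> x v = 0) \<and> sum x S = 1"
proof -
  have "sum x s = sum x S" if "\<forall>v. v \<notin> s \<longrightarrow> x v = 0"
    using assms that by (intro sum.mono_neutral_left) auto
  then show ?thesis
    by (auto simp: closed_cell_def)
qed

lemma closed_cell_mono:
  assumes "finite t" "s \<subseteq> t"
  shows "closed_cell s \<subseteq> closed_cell t"
  using assms by (auto simp: closed_cell_iff[OF assms(1)] subset_iff)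

lemma closed_cell_support:
  assumes "x \<in> closed_cell t" "finite t" "{v. x v \<noteq> 0} \<subseteq> s" "s \<subseteq> t"
  shows "x \<in> closed_cell s"
  using assms by (auto simp: closed_cell_iff[of t] subset_iff)

lemma closed_cell_nonneg: "x \<in> closed_cell s \<Longrightarrow> 0 \<le> x v"
  by (simp add: closed_cell_def)

lemma closed_cell_zero: "x \<in> closed_cell s \<Longrightarrow> v \<notin> s \<Longrightarrow> x v = 0"
  by (simp add: closed_cell_def)

lemma closed_cell_coord_le_1:
  assumes "finite s" "x \<in> closed_cell s"
  shows "x v \<le> 1"
proof (cases "v \<in> s")
  case True
  then have "x v \<le> sum x s"
    using assms by (intro member_le_sum) (auto simp: closed_cell_def)
  then show ?thesis
    using assms by (simp add: closed_cell_def)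
qed (use assms in \<open>simp add: closed_cell_def\<close>)

lemma compact_closed_cell:
  assumes "finite s"
  shows "compact (closed_cell s :: ('v \<Rightarrow> real) set)"
proof -
  let ?B = "PiE UNIV (\<lambda>_. {0..1}) :: ('v \<Rightarrow> real) set"
  let ?C = "{x :: 'v \<Rightarrow> real. (\<forall>v. v \<notin> s \<longrightarrow> x v = 0) \<and> sum x s = 1}"
  have "compactin (product_topology (\<lambda>_. euclidean) UNIV) ?B"
    by (subst compactin_PiE) auto
  then have "compact ?B"
    by (simp add: euclidean_product_topology)
  moreover have "closed ?C"
  proof (intro closed_Collect_conj closed_Collect_all closed_Collect_eq)
    fix v
    show "closed {x :: 'v \<Rightarrow> real. v \<notin> s \<longrightarrow> x v = 0}"
      by (cases "v \<in> s") (auto intro!: closed_Collect_eq continuous_intros continuous_on_product_coordinates)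
  qed (auto intro!: continuous_intros continuous_on_product_coordinates)
  ultimately have "compact (?B \<inter> ?C)"
    by (rule compact_Int_closed)
  moreover have "?B \<inter> ?C = closed_cell s"
    using closed_cell_coord_le_1[OF assms] by (auto simp: closed_cell_def PiE_iff)
  ultimately show ?thesis
    by simp
qed

lemma compact_realization: "compact (realization K)"
  unfolding realization_def by (intro compact_UN compact_closed_cell) auto

section \<open>Exchanging two vertices for two others\<close>

type_synonym 'v move = "'v \<times> 'v \<times> 'v \<times> 'v"

text \<open>The amount \<open>t\<close> moves from each of \<open>a, a'\<close> to \<open>b, b'\<close>, as
much as the coordinates allow. On a square with diagonals \<open>{a, a'}\<close> and \<open>{b,
b'}\<close> this expresses a point in the triangles of the second diagonal instead of those of the
first. For \<open>b = b'\<close> it passes to the subdivision of the edge \<open>{a, a'}\<close>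
with midpoint \<open>b\<close>, and for \<open>a = a'\<close> it undoes such a subdivision; the
factor 2 occurs because the vertex then pays twice.\<close>

fun exchange :: "'v move \<Rightarrow> ('v \<Rightarrow> real) \<Rightarrow> 'v \<Rightarrow> real" where
  "exchange (a, a', b, b') x =
     (let t = min (x a) (x a') / (if a = a' then 2 else 1)
      in (\<lambda>v. x v + t * (of_bool (v = b) + of_bool (v = b') - of_bool (v = a) - of_bool (v = a'))))"

declare exchange.simps [simp del]

text \<open>The condition on all facets excludes that the new edge \<open>{b, b'}\<close> is present already;
the last one, for a flip, says that the triangles at \<open>{a, a'}\<close> are those of a square
with the other diagonal \<open>{b, b'}\<close>. In a flip the two triangles at \<open>{a,
a'}\<close> produce the same new triangles, so only the one that contains \<open>b\<close> is
used; otherwise the list would double its entries.\<close>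

fun exchange_facets :: "'v::linorder move \<Rightarrow> 'v list list \<Rightarrow> 'v list list option" where
  "exchange_facets (a, a', b, b') K =
     (let (D, R) = partition (\<lambda>\<sigma>. a \<in> set \<sigma> \<and> a' \<in> set \<sigma>) K in
      if a \<noteq> b \<and> a \<noteq> b' \<and> a' \<noteq> b \<and> a' \<noteq> b' \<and>
        list_all (\<lambda>\<sigma>. \<not> (b \<in> set \<sigma> \<and> b' \<in> set \<sigma>)) K \<and>
        (b = b' \<or> list_all (\<lambda>\<sigma>. list_all (\<lambda>c. list_ex (\<lambda>\<tau>. set (b # b' # \<sigma>) \<subseteq> set (c # \<tau>)) D) [b, b']) D)
      then Some (concat (map (\<lambda>\<sigma>. [insort_insert b (insort_insert b' (removeAll a \<sigma>)),
                                  insort_insert b (insort_insert b' (removeAll a' \<sigma>))])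
                   (filter (\<lambda>\<sigma>. b = b' \<or> b \<in> set \<sigma>) D)) @ R)
      else None)"

lemma exchange_id:
  assumes "x a = 0 \<or> x a' = 0" "0 \<le> x a" "0 \<le> x a'"
  shows "exchange (a, a', b, b') x = x"
proof -
  have "min (x a) (x a') = 0" using assms by auto
  then show ?thesis by (simp add: Let_def exchange.simps)
qed

text \<open>The smaller one of the coordinates at \<open>a\<close> and \<open>a'\<close> vanishes after the
exchange.\<close>

lemma exchange_mem:
  assumes fin: "finite s" and x: "x \<in> closed_cell s" and a: "a \<in> s" "a' \<in> s"
    and ne: "a \<noteq> b" "a \<noteq> b'" "a' \<noteq> b" "a' \<noteq> b'"
  shows "\<exists>c\<in>{a, a'}. exchange (a, a', b, b') x \<in> closed_cell (insert b (insert b' (s - {c})))"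
proof -
  define t where "t = min (x a) (x a') / (if a = a' then 2 else 1)"
  define y where "y = exchange (a, a', b, b') x"
  have y: "y v = x v + t * (of_bool (v = b) + of_bool (v = b') - of_bool (v = a) - of_bool (v = a'))" for v
    by (simp add: y_def t_def Let_def exchange.simps)
  have pos: "0 \<le> x v" for v using x by (rule closed_cell_nonneg)
  have t0: "0 \<le> t" using pos[of a] pos[of a'] by (simp add: t_def)
  obtain c where c: "c \<in> {a, a'}" "y c = 0"
  proof (cases "x a \<le> x a'")
    case True
    have "y a = 0" using True ne by (auto simp: y t_def)
    then show ?thesis using that by blast
  next
    case False
    have "y a' = 0" using False ne by (auto simp: y t_def)
    then show ?thesis using that by blast
  qed
  have nonneg: "0 \<le> y v" for v
    using t0 pos[of v] ne by (auto simp: y t_def min_def split: if_splits)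
  let ?S = "insert b (insert b' s)"
  have S: "finite ?S" using fin by simp
  have sum0: "sum (\<lambda>v. of_bool (v = w) :: real) ?S = 1" if "w \<in> ?S" for w
    using S that by (simp add: of_bool_def)
  have "sum y ?S = sum x ?S + t * (sum (\<lambda>v. of_bool (v = b)) ?S + sum (\<lambda>v. of_bool (v = b')) ?S
      - sum (\<lambda>v. of_bool (v = a)) ?S - sum (\<lambda>v. of_bool (v = a')) ?S)"
    unfolding y sum.distrib sum_distrib_left[symmetric] sum_subtractf ..
  also have "\<dots> = sum x ?S"
    using a by (subst (1 2 3 4) sum0) auto
  also have "\<dots> = 1"
    using x closed_cell_iff[OF S, of s x] by auto
  finally have sum: "sum y ?S = 1" .
  have "y \<in> closed_cell (insert b (insert b' (s - {c})))"
  proof (subst closed_cell_iff[OF S])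
    show "insert b (insert b' (s - {c})) \<subseteq> ?S" by auto
    have "y v = 0" if "v \<notin> insert b (insert b' (s - {c}))" for v
      using that c a closed_cell_zero[OF x, of v] by (cases "v = c") (auto simp: y)
    then show "(\<forall>v. 0 \<le> y v) \<and> (\<forall>v. v \<notin> insert b (insert b' (s - {c})) \<longrightarrow> y v = 0) \<and> sum y ?S = 1"
      using nonneg sum by blast
  qed
  with c show ?thesis unfolding y_def by blast
qed

text \<open>The vertices \<open>b, b'\<close> receive the same amount, and the smaller of their coordinates
was 0 before; so the amount is what the exchange in the opposite direction takes back.\<close>

lemma exchange_inverse:
  assumes pos: "\<And>v. 0 \<le> x v" and b: "x b = 0 \<or> x b' = 0"
    and ne: "a \<noteq> b" "a \<noteq> b'" "a' \<noteq> b" "a' \<noteq> b'"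
  shows "exchange (b, b', a, a') (exchange (a, a', b, b') x) = x"
proof -
  define t where "t = min (x a) (x a') / (if a = a' then 2 else 1)"
  define y where "y = exchange (a, a', b, b') x"
  have y: "y v = x v + t * (of_bool (v = b) + of_bool (v = b') - of_bool (v = a) - of_bool (v = a'))" for v
    by (simp add: y_def t_def Let_def exchange.simps)
  have t: "min (y b) (y b') / (if b = b' then 2 else 1) = t"
  proof (cases "b = b'")
    case True
    then show ?thesis using ne b by (simp add: y)
  next
    case False
    then have "y b = x b + t" "y b' = x b' + t" using ne by (simp_all add: y)
    with False show ?thesis using b pos[of b] pos[of b'] by (auto simp: min_def)
  qed
  have "exchange (b, b', a, a') y = (\<lambda>v. y v + t * (of_bool (v = a) + of_bool (v = a') - of_bool (v = b) - of_bool (v = b')))"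
    by (simp only: exchange.simps t Let_def)
  also have "\<dots> = x"
    by (rule ext) (simp add: y algebra_simps)
  finally show ?thesis
    by (simp add: y_def)
qed

text \<open>The combinatorial condition that makes an exchange map one polyhedron into the other. It is stated
for one direction because the inverse exchange swaps the pairs \<open>a, a'\<close> and \<open>b,
b'\<close>.\<close>

definition exchange_into :: "'v move \<Rightarrow> 'v list list \<Rightarrow> 'v list list \<Rightarrow> bool" where
  "exchange_into = (\<lambda>(a, a', b, b') K K'. \<forall>\<sigma>\<in>set K. \<not> (b \<in> set \<sigma> \<and> b' \<in> set \<sigma>) \<and>
     (if a \<in> set \<sigma> \<and> a' \<in> set \<sigma>
      then \<forall>c\<in>{a, a'}. \<exists>\<tau>\<in>set K'. insert b (insert b' (set \<sigma> - {c})) \<subseteq> set \<tau>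
      else \<exists>\<tau>\<in>set K'. set \<sigma> \<subseteq> set \<tau>))"

lemma exchange_into_realization:
  assumes into: "exchange_into (a, a', b, b') K K'" and x: "x \<in> realization K"
    and ne: "a \<noteq> b" "a \<noteq> b'" "a' \<noteq> b" "a' \<noteq> b'"
  shows "exchange (a, a', b, b') x \<in> realization K'" (is ?A)
    and "exchange (b, b', a, a') (exchange (a, a', b, b') x) = x" (is ?B)
proof -
  obtain \<sigma> where \<sigma>: "\<sigma> \<in> set K" "x \<in> closed_cell (set \<sigma>)" using x by (rule realizationE)
  note pos = closed_cell_nonneg[OF \<sigma>(2)]
  show ?A
  proof (cases "a \<in> set \<sigma> \<and> a' \<in> set \<sigma>")
    case True
    then obtain c where c: "c \<in> {a, a'}"
      "exchange (a, a', b, b') x \<in> closed_cell (insert b (insert b' (set \<sigma> - {c})))"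
      using exchange_mem[OF _ \<sigma>(2) _ _ ne] by auto
    have "\<forall>c\<in>{a, a'}. \<exists>\<tau>\<in>set K'. insert b (insert b' (set \<sigma> - {c})) \<subseteq> set \<tau>"
      using into \<sigma>(1) True unfolding exchange_into_def by auto
    then obtain \<tau> where \<tau>: "\<tau> \<in> set K'" "insert b (insert b' (set \<sigma> - {c})) \<subseteq> set \<tau>"
      using c(1) by blast
    have "exchange (a, a', b, b') x \<in> closed_cell (set \<tau>)"
      using closed_cell_mono[OF _ \<tau>(2)] c(2) by auto
    then show ?thesis by (rule realizationI[OF \<tau>(1)])
  next
    case False
    then have "exchange (a, a', b, b') x = x"
      using closed_cell_zero[OF \<sigma>(2)] pos by (intro exchange_id) auto
    moreover have "\<exists>\<tau>\<in>set K'. set \<sigma> \<subseteq> set \<tau>"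
      using into \<sigma>(1) False unfolding exchange_into_def by auto
    then obtain \<tau> where \<tau>: "\<tau> \<in> set K'" "set \<sigma> \<subseteq> set \<tau>"
      by blast
    moreover have "x \<in> closed_cell (set \<tau>)"
      using closed_cell_mono[OF _ \<tau>(2)] \<sigma>(2) by auto
    ultimately show ?thesis by (simp add: realizationI)
  qed
  have "\<not> (b \<in> set \<sigma> \<and> b' \<in> set \<sigma>)"
    using into \<sigma>(1) unfolding exchange_into_def by auto
  then show ?B
    using closed_cell_zero[OF \<sigma>(2)] by (intro exchange_inverse pos ne) auto
qed

lemma exchange_facets_into:
  assumes "exchange_facets (a, a', b, b') K = Some K'"
  shows "a \<noteq> b" "a \<noteq> b'" "a' \<noteq> b" "a' \<noteq> b'"
    and "exchange_into (a, a', b, b') K K'" (is ?A)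
    and "exchange_into (b, b', a, a') K' K" (is ?B)
proof -
  define D where "D = filter (\<lambda>\<sigma>. a \<in> set \<sigma> \<and> a' \<in> set \<sigma>) K"
  define R where "R = filter (\<lambda>\<sigma>. \<not> (a \<in> set \<sigma> \<and> a' \<in> set \<sigma>)) K"
  define N where "N = concat (map (\<lambda>\<sigma>. [insort_insert b (insort_insert b' (removeAll a \<sigma>)),
                                  insort_insert b (insort_insert b' (removeAll a' \<sigma>))])
                   (filter (\<lambda>\<sigma>. b = b' \<or> b \<in> set \<sigma>) D))"
  have part: "partition (\<lambda>\<sigma>. a \<in> set \<sigma> \<and> a' \<in> set \<sigma>) K = (D, R)"
    by (simp add: D_def R_def o_def)
  note eq = assms[unfolded exchange_facets.simps part Let_def prod.case, folded N_def]
  have ne: "a \<noteq> b" "a \<noteq> b'" "a' \<noteq> b" "a' \<noteq> b'" and K': "K' = N @ R"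
    and nob: "\<And>\<sigma>. \<sigma> \<in> set K \<Longrightarrow> \<not> (b \<in> set \<sigma> \<and> b' \<in> set \<sigma>)"
    and link: "\<And>\<sigma> c. \<sigma> \<in> set D \<Longrightarrow> b \<noteq> b' \<Longrightarrow> c \<in> {b, b'} \<Longrightarrow>
      \<exists>\<tau>\<in>set D. insert b (insert b' (set \<sigma>)) \<subseteq> insert c (set \<tau>)"
    using eq by (auto simp: list_all_iff list_ex_iff split: if_splits)
  show "a \<noteq> b" "a \<noteq> b'" "a' \<noteq> b" "a' \<noteq> b'" by (fact ne)+
  have D: "\<sigma> \<in> set D \<longleftrightarrow> \<sigma> \<in> set K \<and> a \<in> set \<sigma> \<and> a' \<in> set \<sigma>" for \<sigma>
    by (simp add: D_def)
  have R: "\<sigma> \<in> set R \<longleftrightarrow> \<sigma> \<in> set K \<and> \<not> (a \<in> set \<sigma> \<and> a' \<in> set \<sigma>)" for \<sigma>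
    by (simp add: R_def)
  have N1: "\<exists>\<tau>\<in>set N. set \<tau> = insert b (insert b' (set \<sigma> - {c}))"
    if "\<sigma> \<in> set D" "b = b' \<or> b \<in> set \<sigma>" "c \<in> {a, a'}" for \<sigma> c
    using that by (auto simp: N_def set_insort_insert intro!: bexI[of _ \<sigma>])
  have N2: "\<exists>\<sigma>\<in>set D. \<exists>c\<in>{a, a'}. set \<tau> = insert b (insert b' (set \<sigma> - {c}))" if "\<tau> \<in> set N" for \<tau>
    using that by (auto simp: N_def set_insort_insert)
  show ?A
    unfolding exchange_into_def prod.case
  proof (intro ballI conjI)
    fix \<sigma> assume \<sigma>: "\<sigma> \<in> set K"
    show "\<not> (b \<in> set \<sigma> \<and> b' \<in> set \<sigma>)" by (rule nob[OF \<sigma>])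
    show "if a \<in> set \<sigma> \<and> a' \<in> set \<sigma>
      then \<forall>c\<in>{a, a'}. \<exists>\<tau>\<in>set K'. insert b (insert b' (set \<sigma> - {c})) \<subseteq> set \<tau>
      else \<exists>\<tau>\<in>set K'. set \<sigma> \<subseteq> set \<tau>"
    proof (cases "a \<in> set \<sigma> \<and> a' \<in> set \<sigma>")
      case True
      then have \<sigma>D: "\<sigma> \<in> set D" using \<sigma> by (simp add: D)
      have "\<exists>\<tau>\<in>set K'. insert b (insert b' (set \<sigma> - {c})) \<subseteq> set \<tau>" if c: "c \<in> {a, a'}" for c
      proof -
        obtain \<rho> where \<rho>: "\<rho> \<in> set D" "b = b' \<or> b \<in> set \<rho>" "set \<sigma> \<subseteq> insert b' (set \<rho>)"
        proof (cases "b = b'")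
          case True
          then show ?thesis using that[of \<sigma>] \<sigma>D by auto
        next
          case False
          then obtain \<tau> where "\<tau> \<in> set D" "insert b (insert b' (set \<sigma>)) \<subseteq> insert b' (set \<tau>)"
            using link[OF \<sigma>D, of b'] by auto
          then show ?thesis using that[of \<tau>] False by auto
        qed
        obtain \<tau> where "\<tau> \<in> set N" "set \<tau> = insert b (insert b' (set \<rho> - {c}))"
          using N1[OF \<rho>(1,2) c] by blast
        then show ?thesis using \<rho>(3) by (intro bexI[of _ \<tau>]) (auto simp: K')
      qed
      with True show ?thesis by simp
    next
      case False
      then have "\<sigma> \<in> set K'" using \<sigma> by (simp add: K' R)
      then have "\<exists>\<tau>\<in>set K'. set \<sigma> \<subseteq> set \<tau>" by blast
      then show ?thesis by (simp only: False if_False)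
    qed
  qed
  show ?B
    unfolding exchange_into_def prod.case
  proof (intro ballI conjI)
    fix \<tau> assume \<tau>: "\<tau> \<in> set K'"
    show "\<not> (a \<in> set \<tau> \<and> a' \<in> set \<tau>)"
      using \<tau> N2[of \<tau>] ne by (auto simp: K' R)
    show "if b \<in> set \<tau> \<and> b' \<in> set \<tau>
      then \<forall>c\<in>{b, b'}. \<exists>\<sigma>\<in>set K. insert a (insert a' (set \<tau> - {c})) \<subseteq> set \<sigma>
      else \<exists>\<sigma>\<in>set K. set \<tau> \<subseteq> set \<sigma>"
    proof (cases "b \<in> set \<tau> \<and> b' \<in> set \<tau>")
      case True
      then have "\<tau> \<in> set N" using \<tau> nob by (auto simp: K' R)
      then obtain \<sigma> e where \<sigma>: "\<sigma> \<in> set D" "e \<in> {a, a'}" "set \<tau> = insert b (insert b' (set \<sigma> - {e}))"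
        using N2 by blast
      have "\<exists>\<sigma>\<in>set K. insert a (insert a' (set \<tau> - {c})) \<subseteq> set \<sigma>" if c: "c \<in> {b, b'}" for c
      proof -
        have "\<exists>\<rho>\<in>set D. insert b (insert b' (set \<sigma>)) \<subseteq> insert c (set \<rho>)"
          using link[OF \<sigma>(1) _ c] \<sigma>(1) c by (cases "b = b'") auto
        then show ?thesis using \<sigma> c ne by (auto simp: D)
      qed
      with True show ?thesis by simp
    next
      case False
      then have "\<tau> \<in> set K" using \<tau> N2[of \<tau>] by (auto simp: K' R)
      then have "\<exists>\<sigma>\<in>set K. set \<tau> \<subseteq> set \<sigma>" by blast
      then show ?thesis by (simp only: False if_False)
    qed
  qed
qed

lemma bij_betw_exchange:
  assumes "exchange_facets m K = Some K'"
  shows "bij_betw (exchange m) (realization K) (realization K')"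
proof -
  obtain a a' b b' where m: "m = (a, a', b, b')" by (cases m)
  note F = exchange_facets_into[OF assms[unfolded m]]
  show ?thesis
    unfolding m
  proof (rule bij_betw_byWitness[where f' = "exchange (b, b', a, a')"])
    show "\<forall>x\<in>realization K. exchange (b, b', a, a') (exchange (a, a', b, b') x) = x"
      using exchange_into_realization(2)[OF F(5) _ F(1-4)] by blast
    show "\<forall>y\<in>realization K'. exchange (a, a', b, b') (exchange (b, b', a, a') y) = y"
      using exchange_into_realization(2)[OF F(6)] F(1-4) by metis
    show "exchange (a, a', b, b') ` realization K \<subseteq> realization K'"
      using exchange_into_realization(1)[OF F(5) _ F(1-4)] by blast
    show "exchange (b, b', a, a') ` realization K' \<subseteq> realization K"
      using exchange_into_realization(1)[OF F(6)] F(1-4) by (metis image_subsetI)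
  qed
qed

lemma continuous_on_exchange: "continuous_on X (exchange m)"
proof -
  obtain a a' b b' where m: "m = (a, a', b, b')" by (cases m)
  have "continuous_on X (\<lambda>x. exchange m x v)" for v
    unfolding m exchange.simps Let_def
    by (intro continuous_intros continuous_on_product_coordinates continuous_on_subset[OF continuous_on_product_coordinates subset_UNIV]) (auto)
  then show ?thesis
    by (rule continuous_on_coordinatewise_then_product)
qed

fun apply_moves :: "'v::linorder move list \<Rightarrow> 'v list list \<Rightarrow> 'v list list option" where
  "apply_moves [] K = Some K"
| "apply_moves (m # ms) K = (case exchange_facets m K of None \<Rightarrow> None | Some L \<Rightarrow> apply_moves ms L)"

definition leads_to :: "'v::linorder move list \<Rightarrow> 'v list list \<Rightarrow> 'v list list \<Rightarrow> bool" where
  "leads_to ms K K' = (case apply_moves ms K of None \<Rightarrow> False | Some L \<Rightarrow> set L = set K')"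

definition exchanges :: "'v move list \<Rightarrow> ('v \<Rightarrow> real) \<Rightarrow> 'v \<Rightarrow> real" where
  "exchanges = fold exchange"

lemma bij_betw_exchanges:
  assumes "leads_to ms K K'"
  shows "bij_betw (exchanges ms) (realization K) (realization K')"
  using assms
proof (induction ms arbitrary: K)
  case Nil
  then have "realization K = realization K'" by (simp add: leads_to_def realization_def)
  then show ?case by (simp add: exchanges_def bij_betw_def)
next
  case (Cons m ms)
  then obtain L where L: "exchange_facets m K = Some L" "leads_to ms L K'"
    by (auto simp: leads_to_def split: option.splits)
  have "bij_betw (exchanges ms \<circ> exchange m) (realization K) (realization K')"
    using bij_betw_exchange[OF L(1)] Cons.IH[OF L(2)] by (rule bij_betw_trans)
  then show ?case by (simp add: exchanges_def o_def)
qed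

lemma continuous_on_exchanges: "continuous_on X (exchanges ms)"
proof (induction ms arbitrary: X)
  case Nil
  then show ?case by (simp add: exchanges_def id_def)
next
  case (Cons m ms)
  have "continuous_on X (exchanges ms \<circ> exchange m)"
    using continuous_on_exchange Cons by (rule continuous_on_compose)
  then show ?case by (simp add: exchanges_def o_def)
qed

text \<open>A point stays fixed if the face that supports it contains no edge that is exchanged; this keeps
control of the boundary of the disc.\<close>

lemma exchanges_id:
  assumes "\<And>v. 0 \<le> x v" "\<And>a a' b b'. (a, a', b, b') \<in> set ms \<Longrightarrow> x a = 0 \<or> x a' = 0"
  shows "exchanges ms x = x"
  using assms
proof (induction ms)
  case (Cons m ms)
  obtain a a' b b' where m: "m = (a, a', b, b')" by (cases m)
  have "exchange m x = x"
    unfolding m by (intro exchange_id Cons.prems) (auto simp: m intro: Cons.prems)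
  then show ?case
    using Cons.IH[OF Cons.prems(1)] Cons.prems(2) by (fastforce simp: exchanges_def)
qed (simp add: exchanges_def)

text \<open>If \<open>b\<close> is placed at the midpoint of \<open>a\<close> and \<open>a'\<close>, the
subdivision does not change the point of space that is described by the coordinates.\<close>

lemma barycentre_exchanges:
  fixes p :: "'v \<Rightarrow> 'a::real_vector"
  assumes "finite V"
    and "\<And>a a' b b'. (a, a', b, b') \<in> set ms \<Longrightarrow> {a, a', b, b'} \<subseteq> V \<and> p a + p a' = p b + p b'"
  shows "(\<Sum>v\<in>V. exchanges ms x v *\<^sub>R p v) = (\<Sum>v\<in>V. x v *\<^sub>R p v)"
  using assms(2)
proof (induction ms arbitrary: x)
  case (Cons m ms)
  obtain a a' b b' where m: "m = (a, a', b, b')" by (cases m)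
  have V: "a \<in> V" "a' \<in> V" "b \<in> V" "b' \<in> V" and p: "p a + p a' = p b + p b'"
    using Cons.prems[of a a' b b'] by (auto simp: m)
  define t where "t = min (x a) (x a') / (if a = a' then 2 else 1)"
  have one: "(\<Sum>v\<in>V. of_bool (v = w) *\<^sub>R p v) = p w" if "w \<in> V" for w
    using \<open>finite V\<close> that by (simp add: of_bool_def if_distrib[of "\<lambda>c. c *\<^sub>R _"] cong: if_cong)
  have "(\<Sum>v\<in>V. exchange m x v *\<^sub>R p v) = (\<Sum>v\<in>V. x v *\<^sub>R p v)
      + t *\<^sub>R ((\<Sum>v\<in>V. of_bool (v = b) *\<^sub>R p v) + (\<Sum>v\<in>V. of_bool (v = b') *\<^sub>R p v)
      - (\<Sum>v\<in>V. of_bool (v = a) *\<^sub>R p v) - (\<Sum>v\<in>V. of_bool (v = a') *\<^sub>R p v))"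
    unfolding scaleR_sum_right scaleR_add_right scaleR_diff_right scaleR_scaleR
      sum.distrib[symmetric] sum_subtractf[symmetric]
    by (simp add: m Let_def exchange.simps t_def[symmetric] algebra_simps)
  also have "\<dots> = (\<Sum>v\<in>V. x v *\<^sub>R p v)"
    using p by (simp add: one V algebra_simps)
  finally show ?case
    using Cons.IH[of "exchange m x"] Cons.prems by (fastforce simp: exchanges_def)
qed (simp add: exchanges_def)

section \<open>Quotient maps with the same fibres\<close>

lemma quotient_map_compact_Hausdorff:
  assumes "compact_space X" "Hausdorff_space Y" "continuous_map X Y f" "f ` topspace X = topspace Y"
  shows "quotient_map X Y f"
  using assms by (intro continuous_closed_imp_quotient_map continuous_imp_closed_map_gen Hausdorff_imp_kc_space)

lemma quotient_maps_same_fibres: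
  assumes f: "quotient_map X Y f" and g: "quotient_map X Z g"
    and fib: "\<And>x y. x \<in> topspace X \<Longrightarrow> y \<in> topspace X \<Longrightarrow> f x = f y \<longleftrightarrow> g x = g y"
  shows "Y homeomorphic_space Z"
proof -
  obtain h where h: "continuous_map Y Z h" "\<And>x. x \<in> topspace X \<Longrightarrow> h (f x) = g x"
    using quotient_map_lift_exists[OF f quotient_imp_continuous_map[OF g]] fib by metis
  obtain k where k: "continuous_map Z Y k" "\<And>x. x \<in> topspace X \<Longrightarrow> k (g x) = f x"
    using quotient_map_lift_exists[OF g quotient_imp_continuous_map[OF f]] fib by metis
  have "k (h y) = y" if y: "y \<in> topspace Y" for y
  proof -
    obtain x where "x \<in> topspace X" "y = f x" using y quotient_imp_surjective_map[OF f] by blast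
    then show ?thesis by (simp add: h(2) k(2))
  qed
  moreover have "h (k z) = z" if z: "z \<in> topspace Z" for z
  proof -
    obtain x where "x \<in> topspace X" "z = g x" using z quotient_imp_surjective_map[OF g] by blast
    then show ?thesis by (simp add: h(2) k(2))
  qed
  ultimately show ?thesis
    unfolding homeomorphic_space_def homeomorphic_maps_def using h(1) k(1) by blast
qed

lemma Hausdorff_space_functions: "Hausdorff_space (top_of_set (S :: ('v \<Rightarrow> real) set))"
  by (intro Hausdorff_space_subtopology)
     (simp add: euclidean_product_topology[symmetric] Hausdorff_space_product_topology)

section \<open>Finite disjoint sums of spaces\<close>

lemma compact_space_sum_topology:
  assumes "finite I" "\<And>i. i \<in> I \<Longrightarrow> compact_space (X i)"
  shows "compact_space (sum_topology X I)"
proof -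
  have "compactin (sum_topology X I) (Pair i ` topspace (X i))" if "i \<in> I" for i
    using image_compactin[OF _ continuous_map_component_injection[OF that]] assms(2)[OF that]
    by (simp add: compact_space_def)
  then have "compactin (sum_topology X I) (\<Union>i\<in>I. Pair i ` topspace (X i))"
    using assms(1) by (intro compactin_Union) auto
  moreover have "(\<Union>i\<in>I. Pair i ` topspace (X i)) = topspace (sum_topology X I)"
    by auto
  ultimately show ?thesis by (simp add: compact_space_def)
qed

lemma continuous_map_from_sum_topology:
  assumes "\<And>i. i \<in> I \<Longrightarrow> continuous_map (X i) Y (f i)"
  shows "continuous_map (sum_topology X I) Y (\<lambda>(i, x). f i x)"
  unfolding continuous_map_def
proof (intro conjI allI impI)
  show "(\<lambda>(i, x). f i x) \<in> topspace (sum_topology X I) \<rightarrow> topspace Y"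
    using continuous_map_funspace[OF assms] by (auto simp: Pi_iff)
  fix U assume U: "openin Y U"
  have "openin (X i) {x. (i, x) \<in> {p \<in> topspace (sum_topology X I). (\<lambda>(i, x). f i x) p \<in> U}}" if "i \<in> I" for i
    using assms[OF that] U that by (simp add: continuous_map_def)
  then show "openin (sum_topology X I) {p \<in> topspace (sum_topology X I). (\<lambda>(i, x). f i x) p \<in> U}"
    by (auto simp: openin_sum_topology)
qed

section \<open>The triangulations\<close>

text \<open>The normal form of a facet: equal vertex sets give equal lists, so that complexes are compared as
sets of lists.\<close>

definition ordered :: "int list \<Rightarrow> int list" where
  "ordered xs = foldr insort_insert xs []"

lemma set_ordered [simp]: "set (ordered xs) = set xs"
  by (induction xs) (auto simp: ordered_def set_insort_insert)

lemma sorted_distinct_ordered: "sorted (ordered xs) \<and> distinct (ordered xs)"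
  by (induction xs) (auto simp: ordered_def sorted_insort_insert distinct_insort_insert)

lemma ordered_cong: "set xs = set ys \<Longrightarrow> ordered xs = ordered ys"
  by (intro sorted_distinct_set_unique) (simp_all add: sorted_distinct_ordered)

definition triangle :: "int \<Rightarrow> int \<Rightarrow> int \<Rightarrow> int list" where
  "triangle a b c = ordered [a, b, c]"

text \<open>The cone over the boundary of the 12-gon. The vertex 72 is the centre, and the corners are the
multiples of 6 below 72, which leaves five names for subdividing each side.\<close>

definition wheel12 :: "int list list" where
  "wheel12 = map (\<lambda>k. triangle (6 * k) (6 * (k + 1) mod 72) 72) [0..11]"

definition wheel72 :: "int list list" where
  "wheel72 = map (\<lambda>i. triangle i ((i + 1) mod 72) 72) [0..71]"

text \<open>The sides are divided symmetrically at 1/8, 1/4, 1/2, 3/4 and 7/8, so that the divisions of two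
sides that are glued with opposite directions match.\<close>

definition rim_moves :: "int move list" where
  "rim_moves = concat (map (\<lambda>k. map (\<lambda>(a, b, c). (6 * k + a, (6 * k + b) mod 72, 6 * k + c, 6 * k + c))
     [(0, 6, 3), (0, 3, 2), (0, 2, 1), (3, 6, 4), (4, 6, 5)]) [0..11])"

text \<open>Flipping the spoke from the centre to \<open>z\<close> into the edge \<open>{x, y}\<close> between
the neighbours of \<open>z\<close> in the current wheel cuts off the triangle \<open>z, x,
y\<close>. The 22 triangles of one third of the disc are rotated.\<close>

definition ears :: "(int \<times> int \<times> int) list" where
  "ears = concat (map (\<lambda>s. map (\<lambda>(z, x, y). ((z + s) mod 72, (x + s) mod 72, (y + s) mod 72))
     [(30, 29, 31), (24, 23, 25), (25, 23, 26), (23, 22, 26), (26, 22, 27), (27, 22, 28), (22, 21, 28),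
      (28, 21, 29), (18, 17, 19), (17, 16, 19), (19, 16, 20), (20, 16, 21), (21, 16, 29), (29, 16, 31),
      (16, 15, 31), (15, 14, 31), (31, 14, 32), (12, 11, 13), (11, 10, 13), (10, 9, 13), (13, 9, 14),
      (14, 9, 32)]) [0, 24, 48])"

definition ear_moves :: "int move list" where
  "ear_moves = map (\<lambda>(z, x, y). (72, z, x, y)) ears"

text \<open>After all flips the triangles that were cut off remain together with the six triangles at the
centre.\<close>

definition disc :: "int list list" where
  "disc = map (\<lambda>(z, x, y). triangle z x y) ears @
     [[8, 9, 72], [9, 32, 72], [32, 33, 72], [33, 56, 72], [56, 57, 72], [8, 57, 72]]"

text \<open>The numbers 1, 2 stand for \<open>a\<^sub>1, a\<^sub>2\<close> and 4, 8, 16, 32 for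
\<open>b\<^sub>1, \<dots>, b\<^sub>4\<close>; a vertex of the configuration space, a set of three
vertices of the graph, is named by the sum of its numbers.\<close>

definition conf_index :: "(int \<times> int \<times> int) list" where
  "conf_index = filter (\<lambda>(i, j, k). i \<noteq> j \<and> i \<noteq> k \<and> j \<noteq> k)
     (List.product [4, 8, 16, 32] (List.product [4, 8, 16, 32] [4, 8, 16, 32]))"

definition conf_facets :: "int list list" where
  "conf_facets = concat (map (\<lambda>(i, j, k). [triangle (3 + k) (2 + i + k) (1 + j + k),
                                            triangle (i + j + k) (2 + i + k) (1 + j + k)]) conf_index)"

text \<open>The numbers from 64 on name the midpoints. The moves come in four orbits of the cyclic permutation
of \<open>b\<^sub>1, b\<^sub>2, b\<^sub>3\<close>. The six loops run through the new vertices.\<close>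

definition conf_moves :: "int move list" where
  "conf_moves = map (\<lambda>(a, b, c). (a, b, c, c))
     [(49, 42, 64), (37, 50, 65), (41, 38, 66), (50, 65, 67), (38, 66, 68), (42, 64, 69),
      (41, 44, 70), (49, 56, 71), (37, 52, 72), (38, 21, 73), (42, 13, 74), (50, 25, 75)]"

text \<open>The vertex of \<open>surface\<close> that each vertex of the disc becomes, one side after the
other with the centre last. Every corner is \<open>35 = 1 + 2 + 32\<close>, and the third and
fourth side of each row of 24 repeat the first and second side backwards.\<close>

definition labels :: "int list" where
  "labels =
    [35, 68, 44, 74, 11, 41,  35, 50, 21, 14, 70, 66,  35, 41, 11, 74, 44, 68,  35, 66, 70, 14, 21, 50,
     35, 67, 52, 73,  7, 37,  35, 42, 25, 22, 72, 65,  35, 37,  7, 73, 52, 67,  35, 65, 72, 22, 25, 42,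
     35, 69, 56, 75, 19, 49,  35, 38, 13, 26, 71, 64,  35, 49, 19, 75, 56, 69,  35, 64, 71, 26, 13, 38,
     28]"

definition label :: "int \<Rightarrow> int" where
  "label v = labels ! nat v"

definition surface :: "int list list" where
  "surface = map (\<lambda>\<sigma>. ordered (map label \<sigma>)) disc"

text \<open>The segments \<open>{i, i + 1}\<close> and \<open>{partner i, partner i + 1}\<close> of the
boundary are glued with opposite directions.\<close>

definition partner :: "int \<Rightarrow> int" where
  "partner i = (if i div 6 mod 4 < 2 then 6 * (i div 6 + 2) else 6 * (i div 6 - 2)) + 5 - i mod 6"

lemma wheel12_wheel72: "leads_to rim_moves wheel12 wheel72"
  by code_simp

lemma wheel72_disc: "leads_to ear_moves wheel72 disc"
  by code_simp

lemma conf_surface: "leads_to conf_moves conf_facets surface"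
  by code_simp

definition rim_face :: "int list \<Rightarrow> bool" where
  "rim_face f = (f = [] \<or> list_ex (\<lambda>i. i \<noteq> 72 \<and> set f \<subseteq> {i, (i + 1) mod 72}) f)"

text \<open>Faces with the same labels have the same key; numbers keep the comparisons below cheap.\<close>

definition label_key :: "int list \<Rightarrow> int" where
  "label_key f = foldl (\<lambda>n v. 128 * n + v) 0 (ordered (map label f))"

text \<open>Two faces of the disc with the same labels are equal unless both lie on the boundary. The search
tree only proposes one face for each key; since the relation is transitive, comparing every face
with the proposed one settles all pairs.\<close>

lemma disc_faces:
  "let F = map (\<lambda>f. (f, label_key f)) (concat (map subseqs disc));
       t = fold (\<lambda>(f, k). rbt_insert k f) F RBT_Impl.Empty
   in list_all (\<lambda>(f, k). case rbt_lookup t k of None \<Rightarrow> False | Some g \<Rightarrow> if f = g then True else rim_face f \<and> rim_face g) F"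
  by code_simp

lemma disc_labels: "list_all (\<lambda>\<sigma>. distinct (map label \<sigma>) \<and> list_all (\<lambda>v. 0 \<le> v \<and> v \<le> 72) \<sigma>) disc"
  by code_simp

lemma rim_labels:
  "let F = map (\<lambda>i. (i, label i, label ((i + 1) mod 72))) [0..71]
   in list_all (\<lambda>(i, l, m). l \<noteq> m \<and> label (partner i) = m \<and> label ((partner i + 1) mod 72) = l \<and>
        list_all (\<lambda>(i', l', m'). (i = i' \<or> i' = (partner i + 1) mod 72 \<or> 6 dvd i \<and> 6 dvd i') \<and>
            (m = m' \<longrightarrow> i = i')) (filter (\<lambda>(i', l', m'). l = l') F) \<and>
        list_all (\<lambda>(i', l', m'). m = l' \<longrightarrow> i' = partner i) (filter (\<lambda>(i', l', m'). l = m') F)) F"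
  by code_simp

section \<open>The wheel with twelve spokes is the polygon\<close>

definition corner :: "int \<Rightarrow> complex" where
  "corner k = cis (real_of_int k * pi / 6)"

definition rim_param :: "int \<Rightarrow> real" where
  "rim_param j = (if j = 0 then 0 else if j = 1 then 1/8 else if j = 2 then 1/4 else if j = 3 then 1/2
     else if j = 4 then 3/4 else if j = 5 then 7/8 else 1)"

definition position :: "int \<Rightarrow> complex" where
  "position v = (if v = 72 then 0 else polygon_side 12 (nat (v div 6)) (rim_param (v mod 6)))"

definition barycentre :: "(int \<Rightarrow> real) \<Rightarrow> complex" where
  "barycentre x = (\<Sum>v\<in>{0..72}. x v *\<^sub>R position v)"

lemma polygon_vertex_corner: "polygon_vertex 12 n = corner (int n)"
  by (simp add: polygon_vertex_def corner_def mult.commute)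

lemma corner_12: "corner 12 = corner 0"
  by (simp add: corner_def complex_eq_iff)

lemma polygon_side_corner:
  "polygon_side 12 k t = (1 - t) *\<^sub>R corner (int k) + t *\<^sub>R corner (int k + 1)"
  by (simp add: polygon_side_def polygon_vertex_corner add.commute)

lemma position_rim:
  assumes "0 \<le> k" "k < 12" "0 \<le> j" "j \<le> 6"
  shows "position ((6 * k + j) mod 72) = polygon_side 12 (nat k) (rim_param j)"
proof (cases "j = 6")
  case True
  show ?thesis
  proof (cases "k = 11")
    case True
    with \<open>j = 6\<close> show ?thesis
      using corner_12 by (simp add: position_def polygon_side_corner rim_param_def)
  next
    case False
    then have "(6 * k + j) mod 72 = 6 * (k + 1)"
      using assms \<open>j = 6\<close> by (subst mod_pos_pos_trivial) auto
    moreover have "6 * (k + 1) \<noteq> 72" using False by simp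
    moreover have "nat (k + 1) = Suc (nat k)" using assms by simp
    ultimately show ?thesis
      using assms \<open>j = 6\<close> by (simp add: position_def polygon_side_corner rim_param_def add.commute)
  qed
next
  case False
  then have "(6 * k + j) mod 72 = 6 * k + j"
    using assms by (intro mod_pos_pos_trivial) auto
  moreover have "(6 * k + j) div 6 = k" "(6 * k + j) mod 6 = j" "6 * k + j \<noteq> 72"
    using assms False by auto
  ultimately show ?thesis by (simp add: position_def)
qed

lemma position_corner:
  assumes "0 \<le> k" "k < 12"
  shows "position (6 * k) = corner k" "position (6 * (k + 1) mod 72) = corner (k + 1)"
  using position_rim[OF assms, of 0] position_rim[OF assms, of 6] assms
  by (simp_all add: rim_param_def polygon_side_corner distrib_left)

lemma position_72 [simp]: "position 72 = 0"
  by (simp add: position_def)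

lemma barycentre_facet:
  assumes "x \<in> closed_cell s" "s \<subseteq> {0..72}"
  shows "barycentre x = (\<Sum>v\<in>s. x v *\<^sub>R position v)"
  unfolding barycentre_def
  using assms closed_cell_zero[OF assms(1)] by (intro sum.mono_neutral_right) auto

definition cross :: "complex \<Rightarrow> complex \<Rightarrow> real" where
  "cross z w = Re z * Im w - Im z * Re w"

lemma cross_simps:
  "cross (z + z') w = cross z w + cross z' w" "cross w (z + z') = cross w z + cross w z'"
  "cross (c *\<^sub>R z) w = c * cross z w" "cross w (c *\<^sub>R z) = c * cross w z"
  by (simp_all add: cross_def algebra_simps)

abbreviation s12 :: "int \<Rightarrow> real" where
  "s12 n \<equiv> sin (real_of_int n * pi / 6)"

lemma cross_corner: "cross (corner a) (corner b) = s12 (b - a)"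
proof -
  have "real_of_int (b - a) * pi / 6 = real_of_int b * pi / 6 - real_of_int a * pi / 6"
    by (simp add: field_simps)
  then show ?thesis
    by (simp only: sin_diff) (simp add: cross_def corner_def)
qed

lemma s12_values: "s12 0 = 0" "s12 1 = 1/2" "s12 12 = 0" "s12 13 = 1/2" "s12 (-11) = 1/2"
proof -
  have "13 * pi / 6 = pi / 6 + 2 * pi" "-11 * pi / 6 = pi / 6 - 2 * pi" by simp_all
  then have "sin (13 * pi / 6) = 1/2" "sin (-11 * pi / 6) = 1/2"
    by (simp_all only: sin_periodic sin_30 sin_diff) (simp_all add: sin_30)
  then show "s12 13 = 1/2" "s12 (-11) = 1/2" by simp_all
qed (simp_all add: sin_30)

lemma s12_nonneg: "0 \<le> n \<Longrightarrow> n \<le> 6 \<Longrightarrow> 0 \<le> s12 n"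
  by (rule sin_ge_zero) (auto simp: field_simps)

lemma s12_nonpos: "-6 \<le> n \<Longrightarrow> n \<le> 0 \<Longrightarrow> s12 n \<le> 0"
  using s12_nonneg[of "-n"] by simp

lemma s12_nonpos': "6 \<le> n \<Longrightarrow> n \<le> 12 \<Longrightarrow> s12 n \<le> 0"
proof -
  assume "6 \<le> n" "n \<le> 12"
  then have "s12 (n - 12) \<le> 0" by (intro s12_nonpos) auto
  moreover have "real_of_int (n - 12) * pi / 6 = real_of_int n * pi / 6 - 2 * pi" by (simp add: field_simps)
  then have "s12 (n - 12) = s12 n" by (simp only: sin_diff) simp
  ultimately show ?thesis by simp
qed

lemma s12_nonneg': "-12 \<le> n \<Longrightarrow> n \<le> -6 \<Longrightarrow> 0 \<le> s12 n"
  using s12_nonpos'[of "-n"] by simp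

text \<open>The piecewise linear function that is 1 at the corner \<open>j\<close> and 0 at the centre and the
other corners. Near that corner the two linear forms are the barycentric coordinates in the
adjacent sectors, and elsewhere one of them is at most 0. The factor 2 is the inverse of the sine
of 30 degrees.\<close>

definition hat :: "int \<Rightarrow> complex \<Rightarrow> real" where
  "hat j z = max 0 (min (2 * cross z (corner (j + 1))) (2 * cross (corner (j - 1)) z))"

text \<open>With \<open>d = j - k\<close> the forms have the coefficients \<open>sin (d * 30)\<close> etc. (in
degrees), whose signs decide which of the two is the minimum and whether it is positive.\<close>

lemma hat_sector:
  assumes k: "0 \<le> k" "k < 12" and j: "0 \<le> j" "j < 12" and "0 \<le> \<alpha>" "0 \<le> \<beta>"
  shows "hat j (\<alpha> *\<^sub>R corner k + \<beta> *\<^sub>R corner (k + 1)) =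
    (if j = k then \<alpha> else if j = (k + 1) mod 12 then \<beta> else 0)"
proof -
  define d where "d = j - k"
  have km: "(k + 1) mod 12 = (if k = 11 then 0 else k + 1)" using k by auto
  have eq: "hat j (\<alpha> *\<^sub>R corner k + \<beta> *\<^sub>R corner (k + 1)) =
      max 0 (min (2 * (\<alpha> * s12 (d + 1) + \<beta> * s12 d)) (2 * (\<alpha> * s12 (1 - d) + \<beta> * s12 (2 - d))))"
    unfolding hat_def cross_simps cross_corner d_def by (simp only: algebra_simps) (simp add: algebra_simps)
  have d: "-11 \<le> d" "d \<le> 11" using k j by (auto simp: d_def)
  consider "d = 0" | "d = 1" | "d = -11" | "2 \<le> d" "d \<le> 7" | "6 \<le> d" | "-6 \<le> d" "d \<le> -1" | "-10 \<le> d" "d \<le> -6"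
    using d by linarith
  then show ?thesis
  proof cases
    case 1
    have "0 \<le> \<beta> * s12 2" using assms s12_nonneg[of 2] by (intro mult_nonneg_nonneg) auto
    then show ?thesis unfolding eq 1 using 1 assms by (simp add: d_def sin_30 min_def max_def)
  next
    case 2
    have "0 \<le> \<alpha> * s12 2" using assms s12_nonneg[of 2] by (intro mult_nonneg_nonneg) auto
    moreover have "j \<noteq> k" "j = (k + 1) mod 12" using 2 j by (auto simp: d_def)
    ultimately show ?thesis unfolding eq 2 using assms by (simp add: sin_30 min_def max_def)
  next
    case 3
    have "0 \<le> \<alpha> * s12 (-10)" using assms s12_nonneg'[of "-10"] by (intro mult_nonneg_nonneg) auto
    moreover have "k = 11" "j = 0" using 3 j k by (auto simp: d_def)
    then have "j \<noteq> k" "j = (k + 1) mod 12" by auto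
    moreover have e: "d + 1 = -10" "1 - d = 12" "2 - d = 13" using 3 by auto
    ultimately show ?thesis unfolding eq e unfolding 3 s12_values using assms by (simp add: min_def max_def)
  next
    case 4
    then have "\<alpha> * s12 (1 - d) \<le> 0" "\<beta> * s12 (2 - d) \<le> 0"
      using assms by (auto intro!: mult_nonneg_nonpos s12_nonpos simp del: of_int_diff)
    moreover have "j \<noteq> k" "j \<noteq> (k + 1) mod 12" using 4 j k by (auto simp: d_def km split: if_splits)
    ultimately show ?thesis unfolding eq by simp
  next
    case 5
    then have "\<alpha> * s12 (d + 1) \<le> 0" "\<beta> * s12 d \<le> 0"
      using assms d by (auto intro!: mult_nonneg_nonpos s12_nonpos' simp del: of_int_add)
    moreover have "j \<noteq> k" "j \<noteq> (k + 1) mod 12" using 5 j k by (auto simp: d_def km split: if_splits)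
    ultimately show ?thesis unfolding eq by simp
  next
    case 6
    then have "\<alpha> * s12 (d + 1) \<le> 0" "\<beta> * s12 d \<le> 0"
      using assms d by (auto intro!: mult_nonneg_nonpos s12_nonpos simp del: of_int_add)
    moreover have "j \<noteq> k" "j \<noteq> (k + 1) mod 12" using 6 j k by (auto simp: d_def km split: if_splits)
    ultimately show ?thesis unfolding eq by simp
  next
    case 7
    then have "\<alpha> * s12 (1 - d) \<le> 0" "\<beta> * s12 (2 - d) \<le> 0"
      using assms by (auto intro!: mult_nonneg_nonpos s12_nonpos' simp del: of_int_diff)
    moreover have "j \<noteq> k" "j \<noteq> (k + 1) mod 12" using 7 j k by (auto simp: d_def km split: if_splits)
    ultimately show ?thesis unfolding eq by simp
  qed
qed

lemma wheel12E:
  assumes "x \<in> realization wheel12"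
  obtains k where "0 \<le> k" "k < 12" "x \<in> closed_cell {6 * k, 6 * (k + 1) mod 72, 72}"
  using assms
proof (rule realizationE)
  fix \<sigma> assume \<sigma>: "\<sigma> \<in> set wheel12" "x \<in> closed_cell (set \<sigma>)"
  then obtain k where "0 \<le> k" "k \<le> 11" "set \<sigma> = {6 * k, 6 * (k + 1) mod 72, 72}"
    by (auto simp: wheel12_def triangle_def)
  then show ?thesis using that[of k] \<sigma> by auto
qed

lemma wheel12I:
  assumes "0 \<le> k" "k < 12" "x \<in> closed_cell {6 * k, 6 * (k + 1) mod 72, 72}"
  shows "x \<in> realization wheel12"
  by (rule realizationI[of "triangle (6 * k) (6 * (k + 1) mod 72) 72"])
     (use assms in \<open>auto simp: wheel12_def triangle_def\<close>)

lemma mod_72_neq: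
  assumes "0 \<le> k" "k < (12::int)"
  shows "6 * (k + 1) mod 72 \<noteq> 6 * k" "6 * (k + 1) mod 72 = 6 * ((k + 1) mod 12)"
    "6 * (k + 1) mod 72 \<in> {0..<72}"
proof -
  show eq: "6 * (k + 1) mod 72 = 6 * ((k + 1) mod 12)"
    using mult_mod_right[of 6 "k + 1" 12] by simp
  show "6 * (k + 1) mod 72 \<noteq> 6 * k" unfolding eq using assms by (cases "k = 11") auto
qed auto

lemma barycentre_sector:
  assumes k: "0 \<le> k" "k < 12" and x: "x \<in> closed_cell {6 * k, 6 * (k + 1) mod 72, 72}"
  shows "barycentre x = x (6 * k) *\<^sub>R corner k + x (6 * (k + 1) mod 72) *\<^sub>R corner (k + 1)"
proof -
  note m = mod_72_neq[OF k]
  have "barycentre x = (\<Sum>v\<in>{6 * k, 6 * (k + 1) mod 72, 72}. x v *\<^sub>R position v)"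
    using k m(3) by (intro barycentre_facet x) auto
  moreover have "6 * (k + 1) mod 72 \<noteq> 72" "6 * k \<noteq> 72" using m(3) k by auto
  ultimately show ?thesis
    using m(1) position_corner[OF k] by auto
qed

lemma hat_barycentre:
  assumes x: "x \<in> realization wheel12" and j: "0 \<le> j" "j < 12"
  shows "hat j (barycentre x) = x (6 * j)"
proof -
  obtain k where k: "0 \<le> k" "k < 12" and c: "x \<in> closed_cell {6 * k, 6 * (k + 1) mod 72, 72}"
    using x by (rule wheel12E)
  note m = mod_72_neq[OF k]
  have "x (6 * j) = 0" if "j \<noteq> k" "j \<noteq> (k + 1) mod 12"
    using that m(2) j by (intro closed_cell_zero[OF c]) auto
  then show ?thesis
    unfolding barycentre_sector[OF k c] hat_sector[OF k j closed_cell_nonneg[OF c] closed_cell_nonneg[OF c]]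
    using m(2) by auto
qed

lemma convex_polygon: "convex (polygon m)"
  by (simp add: polygon_def)

lemma corner_in_polygon: "0 \<le> k \<Longrightarrow> k < 12 \<Longrightarrow> corner k \<in> polygon 12"
proof -
  assume "0 \<le> k" "k < 12"
  then have "corner k = polygon_vertex 12 (nat k)" "nat k < 12" by (auto simp: polygon_vertex_corner)
  then show ?thesis unfolding polygon_def by (auto intro: hull_inc)
qed

lemma zero_in_polygon: "0 \<in> polygon 12"
proof -
  have "corner 6 = - corner 0" by (simp add: corner_def complex_eq_iff)
  then have "0 = (1/2) *\<^sub>R corner 0 + (1/2) *\<^sub>R corner 6" by simp
  also have "\<dots> \<in> polygon 12"
    by (intro convexD[OF convex_polygon] corner_in_polygon) auto
  finally show ?thesis .
qed

lemma corner_in_polygon': "0 \<le> k \<Longrightarrow> k \<le> 12 \<Longrightarrow> corner k \<in> polygon 12"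
  using corner_in_polygon[of k] corner_in_polygon[of 0] corner_12 by (cases "k = 12") auto

lemma barycentre_in_polygon:
  assumes x: "x \<in> realization wheel12"
  shows "barycentre x \<in> polygon 12"
proof -
  obtain k where k: "0 \<le> k" "k < 12" and c: "x \<in> closed_cell {6 * k, 6 * (k + 1) mod 72, 72}"
    using x by (rule wheel12E)
  note m = mod_72_neq[OF k]
  have "barycentre x = (\<Sum>v\<in>{6 * k, 6 * (k + 1) mod 72, 72}. x v *\<^sub>R position v)"
    using k m(3) by (intro barycentre_facet c) auto
  also have "\<dots> \<in> polygon 12"
  proof (rule convex_sum[OF _ convex_polygon])
    show "sum x {6 * k, 6 * (k + 1) mod 72, 72} = 1" using c by (simp only: closed_cell_def) auto
    show "position v \<in> polygon 12" if "v \<in> {6 * k, 6 * (k + 1) mod 72, 72}" for v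
      using that position_corner[OF k] corner_in_polygon'[of k] corner_in_polygon'[of "k + 1"] k zero_in_polygon
      by auto
  qed (use closed_cell_nonneg[OF c] in auto)
  finally show ?thesis .
qed

text \<open>The linear form is \<open>\<alpha> + \<beta>\<close> in the sector coordinates; it is 1 at the two
corners of the side and smaller at all others, because the cosine of an odd multiple of 15 degrees
is largest for 15 degrees itself.\<close>

lemma polygon_halfplane:
  assumes z: "z \<in> polygon 12" and k: "0 \<le> k" "k < 12"
  shows "2 * cross z (corner (k + 1)) + 2 * cross (corner k) z \<le> 1"
proof -
  let ?H = "{z. 2 * cross z (corner (k + 1)) + 2 * cross (corner k) z \<le> 1}"
  have "convex ?H"
    unfolding convex_alt
  proof safe
    fix z w and u :: real assume le: "2 * cross z (corner (k + 1)) + 2 * cross (corner k) z \<le> 1"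
      "2 * cross w (corner (k + 1)) + 2 * cross (corner k) w \<le> 1" and u: "0 \<le> u" "u \<le> 1"
    have "(1 - u) * (2 * cross z (corner (k + 1)) + 2 * cross (corner k) z)
        + u * (2 * cross w (corner (k + 1)) + 2 * cross (corner k) w) \<le> (1 - u) * 1 + u * 1"
      using le u by (intro add_mono mult_left_mono) auto
    moreover have "(1 - u) * (2 * cross z (corner (k + 1)) + 2 * cross (corner k) z)
        + u * (2 * cross w (corner (k + 1)) + 2 * cross (corner k) w)
      = 2 * cross ((1 - u) *\<^sub>R z + u *\<^sub>R w) (corner (k + 1))
        + 2 * cross (corner k) ((1 - u) *\<^sub>R z + u *\<^sub>R w)"
      unfolding cross_simps by algebra
    ultimately show "2 * cross ((1 - u) *\<^sub>R z + u *\<^sub>R w) (corner (k + 1))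
        + 2 * cross (corner k) ((1 - u) *\<^sub>R z + u *\<^sub>R w) \<le> 1"
      by simp
  qed
  moreover have "polygon_vertex 12 ` {..<12} \<subseteq> ?H"
  proof safe
    fix n :: nat assume n: "n < 12"
    define d where "d = int n - k"
    have d: "-11 \<le> d" "d \<le> 11" using n k by (auto simp: d_def)
    let ?m = "\<bar>2 * real_of_int d - 1\<bar> * pi / 12"
    have "2 * s12 (1 - d) + 2 * s12 d = 4 * (sin (pi / 12) * cos ((2 * real_of_int d - 1) * pi / 12))"
    proof -
      have "real_of_int (1 - d) * pi / 6 = pi / 12 - (2 * real_of_int d - 1) * pi / 12"
        "real_of_int d * pi / 6 = pi / 12 + (2 * real_of_int d - 1) * pi / 12"
        by (simp_all add: field_simps)
      then show ?thesis by (simp only: sin_add sin_diff) (simp add: algebra_simps)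
    qed
    also have "cos ((2 * real_of_int d - 1) * pi / 12) = cos ?m"
    proof -
      have "?m = \<bar>(2 * real_of_int d - 1) * pi / 12\<bar>" by (simp add: abs_mult)
      then show ?thesis by (simp only: cos_abs_real)
    qed
    also have "cos ?m \<le> cos (pi / 12)"
    proof (cases "?m \<le> pi")
      case True
      have "1 \<le> 2 * d - 1 \<or> 2 * d - 1 \<le> - 1" by presburger
      then have "1 \<le> \<bar>2 * real_of_int d - 1\<bar>" by linarith
      then show ?thesis using True by (intro cos_monotone_0_pi_le) (auto simp: field_simps)
    next
      case False
      have "\<bar>2 * d - 1\<bar> \<le> 23" using d by linarith
      then have "\<bar>2 * real_of_int d - 1\<bar> \<le> 23" by linarith
      then have "?m \<le> 23 * pi / 12" by (intro divide_right_mono mult_right_mono) auto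
      then have "cos (2 * pi - ?m) \<le> cos (pi / 12)"
        using False by (intro cos_monotone_0_pi_le) auto
      then show ?thesis by (simp add: cos_diff)
    qed
    also have "4 * (sin (pi / 12) * cos (pi / 12)) = 2 * sin (2 * (pi / 12))"
      unfolding sin_double by simp
    also have "\<dots> = 1" by (simp add: sin_30)
    finally have "2 * s12 (1 - d) + 2 * s12 d \<le> 1"
      by (simp add: mult_left_mono sin_ge_zero)
    moreover have "k + 1 - int n = 1 - d" "int n - k = d" by (auto simp: d_def)
    ultimately show "2 * cross (polygon_vertex 12 n) (corner (k + 1)) + 2 * cross (corner k) (polygon_vertex 12 n) \<le> 1"
      by (simp only: polygon_vertex_corner cross_corner)
  qed
  ultimately show ?thesis
    using z hull_minimal[of "polygon_vertex 12 ` {..<12}" ?H convex] unfolding polygon_def by blast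
qed

lemma complex_sector:
  obtains k \<alpha> \<beta> where "0 \<le> k" "k < 12" "0 \<le> \<alpha>" "0 \<le> \<beta>" "z = \<alpha> *\<^sub>R corner k + \<beta> *\<^sub>R corner (k + 1)"
proof -
  define \<theta> where "\<theta> = Arg2pi z"
  define r where "r = norm z"
  have \<theta>: "0 \<le> \<theta>" "\<theta> < 2 * pi" and z: "z = of_real r * exp (\<i> * of_real \<theta>)"
    using Arg2pi[of z] by (auto simp: \<theta>_def r_def is_Arg_def)
  define k where "k = \<lfloor>6 * \<theta> / pi\<rfloor>"
  have "of_int k \<le> 6 * \<theta> / pi" "6 * \<theta> / pi < of_int k + 1" by (simp_all add: k_def)
  then have lo: "of_int k * pi / 6 \<le> \<theta>" and hi: "\<theta> \<le> (of_int k + 1) * pi / 6"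
    by (simp_all add: field_simps)
  have "0 \<le> 6 * \<theta> / pi" "6 * \<theta> / pi < 12" using \<theta> by (simp_all add: field_simps)
  then have k: "0 \<le> k" "k < 12" by (auto simp: k_def floor_less_iff)
  define a where "a = of_int k * pi / 6"
  have b: "of_int (k + 1) * pi / 6 = a + pi / 6" by (simp add: a_def field_simps)
  have \<theta>a: "0 \<le> \<theta> - a" "0 \<le> a + pi / 6 - \<theta>" "\<theta> - a \<le> pi" "a + pi / 6 - \<theta> \<le> pi"
    using lo hi pi_gt_zero by (auto simp: a_def field_simps)
  have e: "exp (\<i> * of_real \<theta>) = cis \<theta>" by (simp add: cis_conv_exp)
  have trig: "sin (b - \<theta>) * cos a + sin (\<theta> - a) * cos b = sin (b - a) * cos \<theta>"
    "sin (b - \<theta>) * sin a + sin (\<theta> - a) * sin b = sin (b - a) * sin \<theta>" for b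
    by (simp_all add: sin_diff algebra_simps)
  have "cis \<theta> = (2 * sin (a + pi / 6 - \<theta>)) *\<^sub>R corner k + (2 * sin (\<theta> - a)) *\<^sub>R corner (k + 1)"
  proof -
    have "sin (a + pi / 6 - \<theta>) * cos a + sin (\<theta> - a) * cos (a + pi / 6) = sin (a + pi / 6 - a) * cos \<theta>"
      "sin (a + pi / 6 - \<theta>) * sin a + sin (\<theta> - a) * sin (a + pi / 6) = sin (a + pi / 6 - a) * sin \<theta>"
      using trig[of "a + pi / 6"] by blast+
    then show ?thesis
      unfolding corner_def b unfolding a_def[symmetric] by (simp add: complex_eq_iff sin_30)
  qed
  then have "z = (r * (2 * sin (a + pi / 6 - \<theta>))) *\<^sub>R corner k + (r * (2 * sin (\<theta> - a))) *\<^sub>R corner (k + 1)"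
    unfolding z e by (simp add: scaleR_conv_of_real algebra_simps)
  moreover have "0 \<le> r * (2 * sin (a + pi / 6 - \<theta>))" "0 \<le> r * (2 * sin (\<theta> - a))"
    using \<theta>a sin_ge_zero by (auto simp: r_def intro!: mult_nonneg_nonneg)
  ultimately show ?thesis using that k by blast
qed

text \<open>The hat functions recover the coordinates, which gives injectivity; surjectivity holds since every
point lies in some sector and the half-plane of its side.\<close>

lemma bij_betw_barycentre_wheel12: "bij_betw barycentre (realization wheel12) (polygon 12)"
  unfolding bij_betw_def
proof
  show "inj_on barycentre (realization wheel12)"
  proof (rule inj_onI, rule ext)
    fix x y v assume x: "x \<in> realization wheel12" and y: "y \<in> realization wheel12"
      and eq: "barycentre x = barycentre y"
    let ?S = "insert 72 ((\<lambda>j. 6 * j) ` {0..11}) :: int set"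
    have eqj: "x (6 * j) = y (6 * j)" if "j \<in> {0..11}" for j
      using hat_barycentre[OF x, of j] hat_barycentre[OF y, of j] eq that by auto
    have total: "sum z ?S = 1 \<and> (\<forall>v. v \<notin> ?S \<longrightarrow> z v = 0)" if z: "z \<in> realization wheel12" for z
    proof -
      obtain k where k: "0 \<le> k" "k < 12" and c: "z \<in> closed_cell {6 * k, 6 * (k + 1) mod 72, 72}"
        using z by (rule wheel12E)
      have sub: "{6 * k, 6 * (k + 1) mod 72, 72} \<subseteq> ?S"
        using k mod_72_neq(2)[OF k] by auto
      show ?thesis
        using c closed_cell_iff[OF _ sub, of z] sub by blast
    qed
    have S: "sum z ?S = z 72 + sum z ((\<lambda>j. 6 * j) ` {0..11})" for z :: "int \<Rightarrow> real"
      by (subst sum.insert) auto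
    have "sum x ((\<lambda>j. 6 * j) ` {0..11}) = sum y ((\<lambda>j. 6 * j) ` {0..11})"
      using eqj by (intro sum.cong) auto
    then have "x 72 = y 72"
      using total[OF x] total[OF y] S[of x] S[of y] by linarith
    then show "x v = y v"
      using total[OF x] total[OF y] eqj by (cases "v \<in> ?S") auto
  qed
  show "barycentre ` realization wheel12 = polygon 12"
  proof (intro equalityI subsetI)
    fix z assume z: "z \<in> polygon 12"
    obtain k \<alpha> \<beta> where k: "0 \<le> k" "k < 12" and ab: "0 \<le> \<alpha>" "0 \<le> \<beta>"
      and eq: "z = \<alpha> *\<^sub>R corner k + \<beta> *\<^sub>R corner (k + 1)" by (rule complex_sector)
    note m = mod_72_neq[OF k]
    have ne: "6 * (k + 1) mod 72 \<noteq> 72" "6 * k \<noteq> 72" using m(3) k by auto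
    have "\<alpha> + \<beta> \<le> 1"
      using polygon_halfplane[OF z k] unfolding eq cross_simps cross_corner by (simp add: sin_30)
    define x where "x = (\<lambda>_. 0)(6 * k := \<alpha>, 6 * (k + 1) mod 72 := \<beta>, 72 := 1 - \<alpha> - \<beta>)"
    have xv: "x (6 * k) = \<alpha>" "x (6 * (k + 1) mod 72) = \<beta>" "x 72 = 1 - \<alpha> - \<beta>"
      using m(1) ne by (simp_all add: x_def)
    have c: "x \<in> closed_cell {6 * k, 6 * (k + 1) mod 72, 72}"
      unfolding closed_cell_def mem_Collect_eq
    proof (intro conjI allI impI)
      show "0 \<le> x v" for v using ab \<open>\<alpha> + \<beta> \<le> 1\<close> by (simp add: x_def)
      show "x v = 0" if "v \<notin> {6 * k, 6 * (k + 1) mod 72, 72}" for v using that by (simp add: x_def)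
      have "sum x {6 * k, 6 * (k + 1) mod 72, 72} = x (6 * k) + (x (6 * (k + 1) mod 72) + x 72)"
        using m(1)[symmetric] ne by (subst sum.insert; simp)+
      then show "sum x {6 * k, 6 * (k + 1) mod 72, 72} = 1" unfolding xv by simp
    qed
    have "barycentre x = z"
      unfolding barycentre_sector[OF k c] xv eq ..
    then show "z \<in> barycentre ` realization wheel12"
      using wheel12I[OF k c] by blast
  qed (auto intro: barycentre_in_polygon)
qed

lemma continuous_on_barycentre: "continuous_on X barycentre"
  unfolding barycentre_def
  by (intro continuous_intros continuous_on_subset[OF continuous_on_product_coordinates subset_UNIV])

lemma rim_moves_balanced:
  assumes "(a, a', b, b') \<in> set rim_moves"
  shows "{a, a', b, b'} \<subseteq> {0..72} \<and> position a + position a' = position b + position b'"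
proof -
  obtain k p q r where k: "0 \<le> k" "k < 12" and
    pqr: "(p, q, r) \<in> {(0, 6, 3), (0, 3, 2), (0, 2, 1), (3, 6, 4), (4, 6, 5)}"
    and eq: "a = 6 * k + p" "a' = (6 * k + q) mod 72" "b = 6 * k + r" "b' = 6 * k + r"
  proof -
    obtain k t where "k \<in> set [0..11]" "t \<in> set [(0, 6, 3), (0, 3, 2), (0, 2, 1), (3, 6, 4), (4, 6, 5)]"
      "(a, a', b, b') = (\<lambda>(a, b, c). (6 * k + a, (6 * k + b) mod 72, 6 * k + c, 6 * k + c)) t"
      using assms unfolding rim_moves_def set_concat set_map image_image by blast
    then show ?thesis using that[of k "fst t" "fst (snd t)" "snd (snd t)"] by (auto simp: case_prod_beta)
  qed
  have "a = (6 * k + p) mod 72" "b = (6 * k + r) mod 72" using k pqr eq by auto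
  then have pos: "position a = polygon_side 12 (nat k) (rim_param p)"
    "position a' = polygon_side 12 (nat k) (rim_param q)"
    "position b = polygon_side 12 (nat k) (rim_param r)"
    using position_rim[OF k, of p] position_rim[OF k, of q] position_rim[OF k, of r] pqr eq by auto
  have "rim_param p + rim_param q = 2 * rim_param r" using pqr by (auto simp: rim_param_def)
  then have q: "rim_param q = 2 * rim_param r - rim_param p" by simp
  have "position a + position a' = position b + position b'"
    unfolding eq(4) eq(3)[symmetric] pos q polygon_side_def by (simp add: complex_eq_iff algebra_simps)
  moreover have "{a, a', b, b'} \<subseteq> {0..72}"
    using k pqr eq by auto
  ultimately show ?thesis by blast
qed

lemma bij_betw_barycentre_wheel72: "bij_betw barycentre (realization wheel72) (polygon 12)"
proof -
  note e = bij_betw_exchanges[OF wheel12_wheel72]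
  have "barycentre (exchanges rim_moves x) = barycentre x" for x
    unfolding barycentre_def by (rule barycentre_exchanges) (simp, erule rim_moves_balanced)
  then have "bij_betw (barycentre \<circ> exchanges rim_moves) (realization wheel12) (polygon 12)"
    using bij_betw_barycentre_wheel12 by (simp add: o_def)
  then show ?thesis
    by (simp only: bij_betw_comp_iff[OF e])
qed

section \<open>Points on the rim\<close>

definition rim_point :: "int \<Rightarrow> real \<Rightarrow> int \<Rightarrow> real" where
  "rim_point i u v = (1 - u) * of_bool (v = i) + u * of_bool (v = (i + 1) mod 72)"

lemma next_rim:
  assumes "0 \<le> i" "i < (72::int)"
  shows "(i + 1) mod 72 \<noteq> i" "0 \<le> (i + 1) mod 72" "(i + 1) mod 72 < 72" "(i + 1) mod 72 \<noteq> 72"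
  using assms by (cases "i = 71"; simp)+

lemma wheel72_facets: "set ` set wheel72 = (\<lambda>i. {i, (i + 1) mod 72, 72}) ` {0..71}"
  by (simp add: wheel72_def triangle_def image_image)

lemma realization_wheel72:
  "x \<in> realization wheel72 \<longleftrightarrow> (\<exists>i. 0 \<le> i \<and> i < 72 \<and> x \<in> closed_cell {i, (i + 1) mod 72, 72})"
proof -
  have "realization wheel72 = \<Union> (closed_cell ` (set ` set wheel72))"
    by (simp add: realization_def)
  then show ?thesis
    unfolding wheel72_facets by auto
qed

lemma rim_point_72 [simp]: "0 \<le> i \<Longrightarrow> i < 72 \<Longrightarrow> rim_point i u 72 = 0"
  using next_rim[of i] by (auto simp: rim_point_def)

lemma rim_point_cell:
  assumes i: "0 \<le> i" "i < 72" and u: "0 \<le> u" "u \<le> 1"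
  shows "rim_point i u \<in> closed_cell {i, (i + 1) mod 72}"
  unfolding closed_cell_def using u next_rim[OF i] by (auto simp: rim_point_def)

lemma rim_point_wheel72:
  assumes i: "0 \<le> i" "i < 72" and u: "0 \<le> u" "u \<le> 1"
  shows "rim_point i u \<in> realization wheel72"
  unfolding realization_wheel72
  using i closed_cell_mono[of "{i, (i + 1) mod 72, 72}" "{i, (i + 1) mod 72}"] rim_point_cell[OF assms] by blast

lemma rim_point_1:
  assumes "0 \<le> i" "i < 72"
  shows "rim_point i 1 = rim_point ((i + 1) mod 72) 0"
  by (rule ext) (simp add: rim_point_def)

lemma rim_pointE:
  assumes x: "x \<in> closed_cell {i, (i + 1) mod 72}" and i: "0 \<le> i" "i < 72"
  obtains j u where "0 \<le> j" "j < 72" "0 \<le> u" "u < 1" "x = rim_point j u"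
proof -
  define u where "u = x ((i + 1) mod 72)"
  have sum: "x i + u = 1"
    using x next_rim(1)[OF i] by (simp add: closed_cell_def u_def)
  have pos: "0 \<le> x i" "0 \<le> u" using x by (auto simp: closed_cell_def u_def)
  have eq: "x = rim_point i u"
  proof (rule ext)
    fix v
    have "v \<notin> {i, (i + 1) mod 72} \<Longrightarrow> x v = 0" using x by (rule closed_cell_zero)
    then show "x v = rim_point i u v"
      using next_rim(1)[OF i] sum by (cases "v = i"; cases "v = (i + 1) mod 72") (auto simp: rim_point_def u_def)
  qed
  show ?thesis
  proof (cases "u = 1")
    case True
    then show ?thesis using that[of "(i + 1) mod 72" 0] next_rim[OF i] eq rim_point_1[OF i] by simp
  next
    case False
    then show ?thesis using that[of i u] i pos sum eq by simp
  qed
qed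

lemma barycentre_rim_point:
  assumes k: "0 \<le> k" "k < 12" and j: "0 \<le> j" "j < 6" and u: "0 \<le> u" "u \<le> 1"
  shows "barycentre (rim_point (6 * k + j) u) =
    polygon_side 12 (nat k) ((1 - u) * rim_param j + u * rim_param (j + 1))"
proof -
  let ?i = "6 * k + j"
  have i: "0 \<le> ?i" "?i < 72" using k j by auto
  note n = next_rim[OF i]
  have m: "?i mod 72 = ?i" "(?i + 1) mod 72 = (6 * k + (j + 1)) mod 72" using i by (simp_all add: add.assoc)
  have "barycentre (rim_point ?i u) = (\<Sum>v\<in>{?i, (?i + 1) mod 72}. rim_point ?i u v *\<^sub>R position v)"
    using n i by (intro barycentre_facet rim_point_cell u) auto
  also have "\<dots> = (1 - u) *\<^sub>R position ?i + u *\<^sub>R position ((?i + 1) mod 72)"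
    using n(1) by (simp add: rim_point_def)
  also have "position ?i = polygon_side 12 (nat k) (rim_param j)"
    using position_rim[OF k, of j] j m(1) by simp
  also have "position ((?i + 1) mod 72) = polygon_side 12 (nat k) (rim_param (j + 1))"
    using position_rim[OF k, of "j + 1"] j m(2) by simp
  finally show ?thesis
    by (simp add: polygon_side_def complex_eq_iff algebra_simps)
qed

lemma rim_param_reverse:
  assumes "0 \<le> j" "j \<le> 6"
  shows "rim_param (6 - j) = 1 - rim_param j"
proof -
  consider "j = 0" | "j = 1" | "j = 2" | "j = 3" | "j = 4" | "j = 5" | "j = 6" using assms by linarith
  then show ?thesis by cases (simp_all add: rim_param_def)
qed

lemma rim_param_segment:
  assumes "0 \<le> t" "t \<le> 1"
  obtains j u where "0 \<le> j" "j < 6" "0 \<le> u" "u \<le> 1" "t = (1 - u) * rim_param j + u * rim_param (j + 1)"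
proof -
  note seg = that
  have *: thesis if "0 \<le> j" "j < 6" "rim_param j \<le> t" "t \<le> rim_param (j + 1)" "rim_param j < rim_param (j + 1)" for j
  proof -
    define d where "d = rim_param (j + 1) - rim_param j"
    have d: "0 < d" using that by (simp add: d_def)
    define u where "u = (t - rim_param j) / d"
    have "u * d = t - rim_param j" using d by (simp add: u_def)
    then have "t = (1 - u) * rim_param j + u * rim_param (j + 1)" by (simp add: d_def algebra_simps)
    moreover have "0 \<le> u" "u \<le> 1" using that d by (auto simp: u_def d_def)
    ultimately show thesis using seg that(1,2) by blast
  qed
  consider "t \<le> 1/8" | "1/8 \<le> t" "t \<le> 1/4" | "1/4 \<le> t" "t \<le> 1/2" | "1/2 \<le> t" "t \<le> 3/4"
    | "3/4 \<le> t" "t \<le> 7/8" | "7/8 \<le> t"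
    by linarith
  then show thesis
    using assms *[of 0] *[of 1] *[of 2] *[of 3] *[of 4] *[of 5] by cases (auto simp: rim_param_def)
qed

lemma partner_eq:
  assumes "0 \<le> k" "k < 12" "0 \<le> j" "j < 6"
  shows "partner (6 * k + j) = 6 * (if k mod 4 < 2 then k + 2 else k - 2) + (5 - j)"
proof -
  have "(6 * k + j) div 6 = k" "(6 * k + j) mod 6 = j" using assms by auto
  then show ?thesis by (simp add: partner_def)
qed

lemma partner_point:
  assumes k: "0 \<le> k" "k < 12" "k mod 4 < 2" and j: "0 \<le> j" "j < 6" and u: "0 \<le> u" "u \<le> 1"
    and t: "t = (1 - u) * rim_param j + u * rim_param (j + 1)"
  shows "barycentre (rim_point (6 * k + j) u) = polygon_side 12 (nat k) t"
    and "barycentre (rim_point (partner (6 * k + j)) (1 - u)) = polygon_side 12 (nat k + 2) (1 - t)"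
proof -
  show "barycentre (rim_point (6 * k + j) u) = polygon_side 12 (nat k) t"
    unfolding t by (rule barycentre_rim_point[OF k(1,2) j u])
  have k2: "0 \<le> k + 2" "k + 2 < 12" using k by presburger+
  have "barycentre (rim_point (partner (6 * k + j)) (1 - u)) = polygon_side 12 (nat (k + 2))
     ((1 - (1 - u)) * rim_param (5 - j) + (1 - u) * rim_param (5 - j + 1))"
    using barycentre_rim_point[OF k2, of "5 - j" "1 - u"] partner_eq[OF k(1,2) j] k(3) j u by simp
  also have "(1 - (1 - u)) * rim_param (5 - j) + (1 - u) * rim_param (5 - j + 1) = 1 - t"
  proof -
    have "rim_param (5 - j) = 1 - rim_param (j + 1)" "rim_param (5 - j + 1) = 1 - rim_param j"
      using rim_param_reverse[of j] rim_param_reverse[of "j + 1"] j by (simp_all add: algebra_simps)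
    then show ?thesis unfolding t by algebra
  qed
  also have "nat (k + 2) = nat k + 2" using k by simp
  finally show "barycentre (rim_point (partner (6 * k + j)) (1 - u)) = polygon_side 12 (nat k + 2) (1 - t)" .
qed

lemma side_gluing_iff:
  "side_gluing 3 z w \<longleftrightarrow> (\<exists>k t. k < 12 \<and> k mod 4 < 2 \<and> t \<in> {0..1} \<and>
     z = polygon_side 12 k t \<and> w = polygon_side 12 (k + 2) (1 - t))" (is "?L = ?R")
proof
  assume ?L
  then obtain j t where j: "j < 3" "t \<in> {0..1}" and
    or: "z = polygon_side 12 (4 * j) t \<and> w = polygon_side 12 (4 * j + 2) (1 - t) \<or>
         z = polygon_side 12 (4 * j + 1) t \<and> w = polygon_side 12 (4 * j + 3) (1 - t)"
    by (auto simp: side_gluing_def)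
  from or show ?R
  proof
    assume "z = polygon_side 12 (4 * j) t \<and> w = polygon_side 12 (4 * j + 2) (1 - t)"
    then show ?R using j by (intro exI[of _ "4 * j"] exI[of _ t]) auto
  next
    assume zw: "z = polygon_side 12 (4 * j + 1) t \<and> w = polygon_side 12 (4 * j + 3) (1 - t)"
    show ?R
    proof (intro exI conjI)
      show "4 * j + 1 < 12" using j by simp
      show "(4 * j + 1) mod 4 < 2" by presburger
      have "4 * j + 1 + 2 = 4 * j + 3" by simp
      then show "w = polygon_side 12 (4 * j + 1 + 2) (1 - t)" using zw by (simp only:)
    qed (use zw j in blast)+
  qed
next
  assume ?R
  then obtain k t where k: "k < 12" "k mod 4 < 2" and t: "t \<in> {0..1}"
    and z: "z = polygon_side 12 k t" and w: "w = polygon_side 12 (k + 2) (1 - t)" by blast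
  define j where "j = k div 4"
  have j: "j < 3" using k by (auto simp: j_def)
  have "k = 4 * j \<or> k = 4 * j + 1" using k unfolding j_def by presburger
  then have "k = 4 * j \<and> k + 2 = 4 * j + 2 \<or> k = 4 * j + 1 \<and> k + 2 = 4 * j + 3" by auto
  then have "z = polygon_side 12 (4 * j) t \<and> w = polygon_side 12 (4 * j + 2) (1 - t) \<or>
             z = polygon_side 12 (4 * j + 1) t \<and> w = polygon_side 12 (4 * j + 3) (1 - t)"
    unfolding z w by metis
  moreover have "4 * 3 = (12 :: nat)" by simp
  ultimately show ?L
    unfolding side_gluing_def using j t by (intro exI[of _ j] conjI bexI[of _ t]) (simp_all only:)
qed

abbreviation glued :: "complex \<Rightarrow> complex \<Rightarrow> bool" where
  "glued \<equiv> equivclp (side_gluing 3)"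

lemma side_gluing_partner:
  assumes "side_gluing 3 z w"
  obtains i u where "0 \<le> i" "i < 72" "0 \<le> u" "u \<le> 1"
    "z = barycentre (rim_point i u)" "w = barycentre (rim_point (partner i) (1 - u))"
proof -
  obtain k t where k: "k < 12" "k mod 4 < 2" and t: "0 \<le> t" "t \<le> 1"
    and z: "z = polygon_side 12 k t" and w: "w = polygon_side 12 (k + 2) (1 - t)"
    using assms unfolding side_gluing_iff by auto
  obtain j u where j: "0 \<le> j" "j < 6" and u: "0 \<le> u" "u \<le> 1"
    and tj: "t = (1 - u) * rim_param j + u * rim_param (j + 1)"
    using t by (rule rim_param_segment)
  have k': "0 \<le> int k" "int k < 12" "int k mod 4 < 2"
    using k by presburger+
  show ?thesis
  proof (rule that[of "6 * int k + j" u])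
    show "0 \<le> 6 * int k + j" "6 * int k + j < 72" using k' j by auto
    show "z = barycentre (rim_point (6 * int k + j) u)"
      unfolding z partner_point(1)[OF k' j u tj] by simp
    show "w = barycentre (rim_point (partner (6 * int k + j)) (1 - u))"
      unfolding w partner_point(2)[OF k' j u tj] by simp
  qed (use u in auto)
qed

lemma glued_partner_aux:
  assumes k: "0 \<le> k" "k < 12" "k mod 4 < 2" and j: "0 \<le> j" "j < 6" and u: "0 \<le> u" "u \<le> 1"
  shows "side_gluing 3 (barycentre (rim_point (6 * k + j) u)) (barycentre (rim_point (partner (6 * k + j)) (1 - u)))"
proof -
  define t where "t = (1 - u) * rim_param j + u * rim_param (j + 1)"
  have rj: "rim_param j \<in> {0..1}" "rim_param (j + 1) \<in> {0..1}" by (auto simp: rim_param_def)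
  have "t \<in> {0..1}"
    using convexD[OF convex_real_interval(5), of "rim_param j" 0 1 "rim_param (j + 1)" "1 - u" u] rj u
    unfolding t_def by simp
  moreover have "int (nat k mod 4) = k mod 4" using k by (simp add: zmod_int)
  then have "nat k < 12" "nat k mod 4 < 2" using k by linarith+
  ultimately show ?thesis
    unfolding side_gluing_iff partner_point[OF k j u t_def] by (intro exI[of _ "nat k"] exI[of _ t]) simp
qed

lemma glued_partner:
  assumes i: "0 \<le> i" "i < 72" and u: "0 \<le> u" "u \<le> 1"
  shows "glued (barycentre (rim_point i u)) (barycentre (rim_point (partner i) (1 - u)))"
proof -
  define k j where "k = i div 6" and "j = i mod 6"
  have i_eq: "i = 6 * k + j" by (simp add: k_def j_def)
  have k: "0 \<le> k" "k < 12" and j: "0 \<le> j" "j < 6" using i by (auto simp: k_def j_def)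
  show ?thesis
  proof (cases "k mod 4 < 2")
    case True
    then show ?thesis unfolding i_eq using glued_partner_aux[OF k True j u] by blast
  next
    case False
    have k': "0 \<le> k - 2" "k - 2 < 12" "(k - 2) mod 4 < 2" using k False by presburger+
    have p: "partner i = 6 * (k - 2) + (5 - j)" unfolding i_eq partner_eq[OF k j] using False by simp
    have j': "0 \<le> 5 - j" "5 - j < 6" using j by auto
    have "partner (6 * (k - 2) + (5 - j)) = 6 * (k - 2 + 2) + (5 - (5 - j))"
      using partner_eq[OF k'(1,2) j'] k'(3) by simp
    then have pp: "partner (partner i) = i" by (simp only: p) (simp add: i_eq)
    have "side_gluing 3 (barycentre (rim_point (partner i) (1 - u))) (barycentre (rim_point (partner (partner i)) (1 - (1 - u))))"
      using glued_partner_aux[OF k' j', of "1 - u"] u unfolding p by simp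
    then show ?thesis unfolding pp by auto
  qed
qed

text \<open>In a word of commutators all corners are one point: for the sides \<open>4m, \<dots>, 4m +
3\<close> the gluing identifies the corners in the order \<open>4m, 4m + 3, 4m + 2, 4m + 1, 4m +
4\<close>.\<close>

lemma glued_corners:
  assumes "0 \<le> i" "i < 72" "6 dvd i" "0 \<le> i'" "i' < 72" "6 dvd i'"
  shows "glued (barycentre (rim_point i 0)) (barycentre (rim_point i' 0))"
proof -
  let ?v = "polygon_vertex 12"
  have side: "polygon_side 12 k 0 = ?v k" "polygon_side 12 k 1 = ?v (Suc k)" for k
    by (simp_all add: polygon_side_def)
  have g: "glued (?v k) (?v (k + 3))" "glued (?v (Suc k)) (?v (k + 2))" if "k < 12" "k mod 4 < 2" for k
  proof -
    have "side_gluing 3 (polygon_side 12 k 0) (polygon_side 12 (k + 2) 1)"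
      unfolding side_gluing_iff using that by (intro exI[of _ k] exI[of _ "0::real"]) auto
    then show "glued (?v k) (?v (k + 3))" by (auto simp: side numeral_3_eq_3)
    have "side_gluing 3 (polygon_side 12 k 1) (polygon_side 12 (k + 2) 0)"
      unfolding side_gluing_iff using that by (intro exI[of _ k] exI[of _ "1::real"]) auto
    then show "glued (?v (Suc k)) (?v (k + 2))" by (auto simp: side)
  qed
  have step: "glued (?v (4 * m)) (?v (4 * m + r))" if "m < 3" "r \<le> 4" for m r
  proof -
    have m: "4 * m < 12" "4 * m mod 4 < 2" "4 * m + 1 < 12" "(4 * m + 1) mod 4 < 2"
      using that by presburger+
    have 3: "glued (?v (4 * m)) (?v (4 * m + 3))" using g(1)[OF m(1,2)] .
    have "glued (?v (4 * m + 2)) (?v (4 * m + 3))" using g(2)[OF m(3,4)] by (simp add: eval_nat_numeral)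
    then have 2: "glued (?v (4 * m)) (?v (4 * m + 2))" using 3 by (meson equivclp_sym equivclp_trans)
    have "glued (?v (4 * m + 1)) (?v (4 * m + 2))" using g(2)[OF m(1,2)] by (simp add: eval_nat_numeral)
    then have 1: "glued (?v (4 * m)) (?v (4 * m + 1))" using 2 by (meson equivclp_sym equivclp_trans)
    have "glued (?v (4 * m + 1)) (?v (4 * m + 4))" using g(1)[OF m(3,4)] by (simp add: eval_nat_numeral)
    then have 4: "glued (?v (4 * m)) (?v (4 * m + 4))" using 1 by (meson equivclp_trans)
    have "r = 0 \<or> r = 1 \<or> r = 2 \<or> r = 3 \<or> r = 4" using that by linarith
    then show ?thesis using 1 2 3 4 by auto
  qed
  have base: "glued (?v 0) (?v (4 * m))" if "m < 3" for m
    using that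
  proof (induction m)
    case (Suc m)
    then have "glued (?v 0) (?v (4 * m))" "glued (?v (4 * m)) (?v (4 * m + 4))" using step[of m 4] by auto
    from equivclp_trans[OF this] show ?case by (simp add: add.commute)
  qed simp
  have "glued (?v 0) (?v n)" if "n < 12" for n
  proof -
    have "n div 4 < 3" "n mod 4 \<le> 4" using that by auto
    from equivclp_trans[OF base[OF this(1)] step[OF this]] show ?thesis by simp
  qed
  then have *: "glued (?v m) (?v n)" if "m < 12" "n < 12" for m n
    using that by (meson equivclp_sym equivclp_trans)
  have v: "barycentre (rim_point l 0) = ?v (nat (l div 6)) \<and> nat (l div 6) < 12"
    if "0 \<le> l" "l < 72" "6 dvd l" for l
  proof -
    have l: "l = 6 * (l div 6) + 0" "0 \<le> l div 6" "l div 6 < 12" using that by auto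
    have "barycentre (rim_point (6 * (l div 6) + 0) 0) = ?v (nat (l div 6))"
      using barycentre_rim_point[of "l div 6" 0 0] l(2,3) by (simp add: rim_param_def side)
    then show ?thesis using l by simp
  qed
  show ?thesis using v[OF assms(1-3)] v[OF assms(4-6)] *[of "nat (i div 6)" "nat (i' div 6)"] by simp
qed

section \<open>Gluing the rim of the disc\<close>

text \<open>The simplicial map that identifies vertices of the disc with the same label.\<close>

definition glue_labels :: "(int \<Rightarrow> real) \<Rightarrow> int \<Rightarrow> real" where
  "glue_labels x w = (\<Sum>v | v \<in> {0..72} \<and> label v = w. x v)"

lemma disc_facet:
  assumes "\<sigma> \<in> set disc"
  shows "inj_on label (set \<sigma>)" "set \<sigma> \<subseteq> {0..72}"
proof -
  have "distinct (map label \<sigma>)" "\<forall>v\<in>set \<sigma>. 0 \<le> v \<and> v \<le> 72"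
    using disc_labels assms unfolding list_all_iff by blast+
  then show "inj_on label (set \<sigma>)" "set \<sigma> \<subseteq> {0..72}" by (auto simp: distinct_map)
qed

lemma glue_labels_cell:
  assumes x: "x \<in> closed_cell s" and s: "s \<subseteq> {0..72}" and inj: "inj_on label s"
  shows "v \<in> s \<Longrightarrow> glue_labels x (label v) = x v"
    and "w \<notin> label ` s \<Longrightarrow> glue_labels x w = 0"
    and "glue_labels x \<in> closed_cell (label ` s)"
proof -
  have eq: "glue_labels x w = (\<Sum>v | v \<in> s \<and> label v = w. x v)" for w
    unfolding glue_labels_def using s closed_cell_zero[OF x]
    by (intro sum.mono_neutral_right) (auto intro: finite_subset[of _ "{0..72}"])
  show on: "glue_labels x (label v) = x v" if "v \<in> s" for v
  proof -
    have "{v'. v' \<in> s \<and> label v' = label v} = {v}" using that inj by (auto dest: inj_onD)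
    then show ?thesis unfolding eq by simp
  qed
  show off: "glue_labels x w = 0" if "w \<notin> label ` s" for w
    unfolding eq using that by (intro sum.neutral) auto
  show "glue_labels x \<in> closed_cell (label ` s)"
    unfolding closed_cell_def mem_Collect_eq
  proof (intro conjI allI impI)
    show "0 \<le> glue_labels x w" for w
      using on off closed_cell_nonneg[OF x] by (cases "w \<in> label ` s") auto
    have "sum (glue_labels x) (label ` s) = sum x s"
      using inj on by (simp add: sum.reindex)
    then show "sum (glue_labels x) (label ` s) = 1" using x by (simp add: closed_cell_def)
  qed (rule off)
qed

lemma realization_surface:
  "realization surface = (\<Union>\<sigma>\<in>set disc. closed_cell (label ` set \<sigma>))"
  by (simp add: realization_def surface_def)

lemma glue_labels_image: "glue_labels ` realization disc = realization surface"
proof (intro equalityI subsetI)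
  fix y assume "y \<in> glue_labels ` realization disc"
  then show "y \<in> realization surface"
    unfolding realization_surface
    using glue_labels_cell(3)[OF _ disc_facet(2,1)] by (auto elim!: realizationE)
next
  fix y assume "y \<in> realization surface"
  then obtain \<sigma> where \<sigma>: "\<sigma> \<in> set disc" and y: "y \<in> closed_cell (label ` set \<sigma>)"
    unfolding realization_surface by blast
  note d = disc_facet[OF \<sigma>]
  define x where "x v = (if v \<in> set \<sigma> then y (label v) else 0)" for v
  have x: "x \<in> closed_cell (set \<sigma>)"
    using y d(1) by (auto simp: closed_cell_def x_def sum.reindex)
  have "glue_labels x w = y w" for w
  proof (cases "w \<in> label ` set \<sigma>")
    case True
    then show ?thesis using glue_labels_cell(1)[OF x d(2,1)] by (auto simp: x_def)
  next
    case False
    then show ?thesis using glue_labels_cell(2)[OF x d(2,1)] closed_cell_zero[OF y] by simp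
  qed
  then have "y = glue_labels x" by auto
  then show "y \<in> glue_labels ` realization disc" using realizationI[OF \<sigma> x] by blast
qed

lemma continuous_on_glue_labels: "continuous_on X glue_labels"
proof (rule continuous_on_coordinatewise_then_product)
  show "continuous_on X (\<lambda>x. glue_labels x w)" for w
    unfolding glue_labels_def
    by (intro continuous_intros continuous_on_subset[OF continuous_on_product_coordinates subset_UNIV])
qed

lemma glue_labels_rim_point:
  assumes "0 \<le> i" "i < 72"
  shows "glue_labels (rim_point i u) =
    (\<lambda>w. (1 - u) * of_bool (w = label i) + u * of_bool (w = label ((i + 1) mod 72)))"
proof
  fix w
  have one: "(\<Sum>v | v \<in> {0..72} \<and> label v = w. of_bool (v = a)) = (of_bool (w = label a) :: real)"
    if a: "a \<in> {0..72}" for a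
  proof -
    have "finite {v. v \<in> {0..72} \<and> label v = w}" by (rule finite_subset[of _ "{0..72}"]) auto
    then show ?thesis using a by (auto simp: of_bool_def)
  qed
  show "glue_labels (rim_point i u) w = (1 - u) * of_bool (w = label i) + u * of_bool (w = label ((i + 1) mod 72))"
    unfolding glue_labels_def rim_point_def sum.distrib sum_distrib_left[symmetric]
    using one[of i] one[of "(i + 1) mod 72"] assms next_rim[OF assms] by simp
qed

lemma rim_label:
  assumes i: "0 \<le> i" "i < 72"
  shows "label i \<noteq> label ((i + 1) mod 72)"
    and "label (partner i) = label ((i + 1) mod 72)"
    and "label ((partner i + 1) mod 72) = label i"
    and "0 \<le> i' \<Longrightarrow> i' < 72 \<Longrightarrow> label i = label i' \<Longrightarrow>
      i = i' \<or> i' = (partner i + 1) mod 72 \<or> 6 dvd i \<and> 6 dvd i'"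
    and "0 \<le> i' \<Longrightarrow> i' < 72 \<Longrightarrow> label i = label i' \<Longrightarrow>
      label ((i + 1) mod 72) = label ((i' + 1) mod 72) \<Longrightarrow> i = i'"
    and "0 \<le> i' \<Longrightarrow> i' < 72 \<Longrightarrow> label i = label ((i' + 1) mod 72) \<Longrightarrow>
      label ((i + 1) mod 72) = label i' \<Longrightarrow> i' = partner i"
proof -
  define F where "F = map (\<lambda>i. (i, label i, label ((i + 1) mod 72))) [0..71]"
  have F: "(i, label i, label ((i + 1) mod 72)) \<in> set F" if "0 \<le> i" "i < 72" for i
    unfolding F_def set_map by (rule imageI) (use that in \<open>simp only: set_upto; simp\<close>)
  note R = bspec[OF rim_labels[unfolded Let_def list_all_iff, folded F_def] F[OF i], unfolded prod.case]
  show "label i \<noteq> label ((i + 1) mod 72)" "label (partner i) = label ((i + 1) mod 72)"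
    "label ((partner i + 1) mod 72) = label i"
    using R by blast+
  assume i': "0 \<le> i'" "i' < 72"
  note F' = F[OF i']
  have R1: "(i = i' \<or> i' = (partner i + 1) mod 72 \<or> 6 dvd i \<and> 6 dvd i') \<and>
      (label ((i + 1) mod 72) = label ((i' + 1) mod 72) \<longrightarrow> i = i')" if "label i = label i'"
  proof -
    have "(i', label i', label ((i' + 1) mod 72)) \<in> set (filter (\<lambda>(i', l', m'). label i = l') F)"
      using F' that by simp
    from bspec[OF R[THEN conjunct2, THEN conjunct2, THEN conjunct2, THEN conjunct1] this] show ?thesis
      unfolding prod.case .
  qed
  then show "label i = label i' \<Longrightarrow> i = i' \<or> i' = (partner i + 1) mod 72 \<or> 6 dvd i \<and> 6 dvd i'"
    "label i = label i' \<Longrightarrow> label ((i + 1) mod 72) = label ((i' + 1) mod 72) \<Longrightarrow> i = i'"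
    by blast+
  assume l: "label i = label ((i' + 1) mod 72)" "label ((i + 1) mod 72) = label i'"
  have "(i', label i', label ((i' + 1) mod 72)) \<in> set (filter (\<lambda>(i', l', m'). label i = m') F)"
    using F' l by simp
  from bspec[OF R[THEN conjunct2, THEN conjunct2, THEN conjunct2, THEN conjunct2] this] show "i' = partner i"
    using l(2) unfolding prod.case by blast
qed

lemma partner_range:
  assumes "0 \<le> i" "i < 72"
  shows "0 \<le> partner i" "partner i < 72"
proof -
  define k j where "k = i div 6" and "j = i mod 6"
  have i_eq: "i = 6 * k + j" by (simp add: k_def j_def)
  have k: "0 \<le> k" "k < 12" and j: "0 \<le> j" "j < 6" using assms by (auto simp: k_def j_def)
  have "k mod 4 < 2 \<Longrightarrow> k + 2 < 12" "\<not> k mod 4 < 2 \<Longrightarrow> 0 \<le> k - 2" using k by presburger+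
  then show "0 \<le> partner i" "partner i < 72"
    unfolding i_eq partner_eq[OF k j] using k j by (auto split: if_splits)
qed

lemma disc_faces_label:
  assumes "\<sigma> \<in> set disc" "\<tau> \<in> set disc" "s \<subseteq> set \<sigma>" "t \<subseteq> set \<tau>" "label ` s = label ` t"
  shows "s = t \<or> (\<exists>i. 0 \<le> i \<and> i < 72 \<and> s \<subseteq> {i, (i + 1) mod 72}) \<and> (\<exists>i. 0 \<le> i \<and> i < 72 \<and> t \<subseteq> {i, (i + 1) mod 72})"
proof -
  let ?fs = "concat (map subseqs disc)"
  have face: "\<exists>f\<in>set ?fs. set f = s" if "\<sigma> \<in> set disc" "s \<subseteq> set \<sigma>" for \<sigma> s
  proof -
    have "s \<in> set ` set (subseqs \<sigma>)" unfolding subseqs_powset using that by simp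
    then show ?thesis using that by auto
  qed
  obtain f g where f: "f \<in> set ?fs" "set f = s" and g: "g \<in> set ?fs" "set g = t"
    using face assms by metis
  define tr where "tr = fold (\<lambda>(f, k). rbt_insert k f) (map (\<lambda>f. (f, label_key f)) ?fs) RBT_Impl.Empty"
  have look: "\<exists>h. rbt_lookup tr (label_key f) = Some h \<and> (f = h \<or> rim_face f \<and> rim_face h)" if "f \<in> set ?fs" for f
  proof -
    have "(f, label_key f) \<in> set (map (\<lambda>f. (f, label_key f)) ?fs)" using that by simp
    then have "case rbt_lookup tr (label_key f) of None \<Rightarrow> False | Some h \<Rightarrow> if f = h then True else rim_face f \<and> rim_face h"
      using disc_faces unfolding Let_def list_all_iff tr_def[symmetric] by blast
    then show ?thesis by (auto split: option.splits if_splits)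
  qed
  have "label_key f = label_key g"
    using ordered_cong[of "map label f" "map label g"] f g assms(5) by (simp add: label_key_def)
  then have fg: "f = g \<or> rim_face f \<and> rim_face g"
    using look[OF f(1)] look[OF g(1)] by auto
  have rim: "\<exists>i. 0 \<le> i \<and> i < 72 \<and> set f \<subseteq> {i, (i + 1) mod 72}"
    if "rim_face f" and sub: "set f \<subseteq> {0..72}" for f
  proof (cases "f = []")
    case True
    then show ?thesis by (intro exI[of _ 0]) simp
  next
    case False
    then obtain i where "i \<in> set f" "i \<noteq> 72" "set f \<subseteq> {i, (i + 1) mod 72}"
      using \<open>rim_face f\<close> by (auto simp: rim_face_def list_ex_iff)
    then show ?thesis using sub by (intro exI[of _ i]) fastforce
  qed
  have "set f \<subseteq> {0..72}" "set g \<subseteq> {0..72}"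
    using disc_facet(2)[OF assms(1)] disc_facet(2)[OF assms(2)] f g assms by auto
  then show ?thesis using fg rim[of f] rim[of g] f g by auto
qed

definition wheel_to_surface :: "(int \<Rightarrow> real) \<Rightarrow> int \<Rightarrow> real" where
  "wheel_to_surface = glue_labels \<circ> exchanges ear_moves"

lemma bij_betw_ears: "bij_betw (exchanges ear_moves) (realization wheel72) (realization disc)"
  by (rule bij_betw_exchanges[OF wheel72_disc])

lemma exchanges_ears_rim:
  assumes "\<And>v. 0 \<le> x v" "x 72 = 0"
  shows "exchanges ear_moves x = x"
  using assms by (intro exchanges_id) (auto simp: ear_moves_def)

lemma wheel_to_surface_rim_point:
  assumes i: "0 \<le> i" "i < 72" and u: "0 \<le> u" "u \<le> 1"
  shows "wheel_to_surface (rim_point i u) =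
    (\<lambda>w. (1 - u) * of_bool (w = label i) + u * of_bool (w = label ((i + 1) mod 72)))"
proof -
  have "exchanges ear_moves (rim_point i u) = rim_point i u"
    using i u by (intro exchanges_ears_rim) (auto simp: rim_point_def)
  then show ?thesis by (simp add: wheel_to_surface_def glue_labels_rim_point[OF i])
qed

text \<open>It suffices to consider one pair of glued points. The exchanges fix the rim, where the map is
therefore determined by the labels.\<close>

lemma wheel_to_surface_glued:
  assumes x: "x \<in> realization wheel72" and y: "y \<in> realization wheel72"
    and g: "glued (barycentre x) (barycentre y)"
  shows "wheel_to_surface x = wheel_to_surface y"
proof -
  define inv where "inv = inv_into (realization wheel72) barycentre"
  have inv: "inv (barycentre x) = x" if "x \<in> realization wheel72" for x
    unfolding inv_def using that bij_betw_barycentre_wheel72 by (intro inv_into_f_f) (auto simp: bij_betw_def)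
  have side: "wheel_to_surface (inv z) = wheel_to_surface (inv w)" if "side_gluing 3 z w" for z w
    using that
  proof (rule side_gluing_partner)
    fix i u assume i: "0 \<le> i" "i < 72" and u: "0 \<le> u" "u \<le> 1"
      and z: "z = barycentre (rim_point i u)" and w: "w = barycentre (rim_point (partner i) (1 - u))"
    note p = partner_range[OF i]
    have u': "0 \<le> 1 - u" "1 - u \<le> 1" using u by auto
    show ?thesis
      unfolding z w inv[OF rim_point_wheel72[OF i u]] inv[OF rim_point_wheel72[OF p u']]
        wheel_to_surface_rim_point[OF i u] wheel_to_surface_rim_point[OF p u'] rim_label(2,3)[OF i]
      by (rule ext) simp
  qed
  have "wheel_to_surface (inv (barycentre x)) = wheel_to_surface (inv z)" if "glued (barycentre x) z" for z
    using that
  proof (induction rule: equivclp_induct)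
    case (step y z)
    then show ?case using side[of y z] side[of z y] by auto
  qed simp
  from this[OF g] show ?thesis by (simp add: inv x y)
qed

text \<open>Points inside segments can only coincide if the segments are equal or partners; a common vertex is
either inside a side, and then it occurs on the partner side only, or it is a corner.\<close>

lemma glued_rim_points:
  assumes i: "0 \<le> i" "i < 72" and u: "0 \<le> u" "u < 1" and i': "0 \<le> i'" "i' < 72" and u': "0 \<le> u'" "u' < 1"
    and eq: "wheel_to_surface (rim_point i u) = wheel_to_surface (rim_point i' u')"
  shows "glued (barycentre (rim_point i u)) (barycentre (rim_point i' u'))"
proof -
  let ?l = "label i" and ?m = "label ((i + 1) mod 72)" and ?l' = "label i'" and ?m' = "label ((i' + 1) mod 72)"
  have at: "(1 - u) * of_bool (w = ?l) + u * of_bool (w = ?m)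
      = (1 - u') * of_bool (w = ?l') + u' * of_bool (w = ?m')" for w
    using fun_cong[OF eq, of w] wheel_to_surface_rim_point i i' u u' by simp
  have ne: "?l \<noteq> ?m" "?l' \<noteq> ?m'" using rim_label(1) i i' by auto
  note p = glued_partner[OF i]
  show ?thesis
  proof (cases "?l = ?l'")
    case True
    then have uu: "u' = u" using at[of ?l] ne by auto
    show ?thesis
    proof (cases "u = 0")
      case True
      consider "i = i'" | "i' = (partner i + 1) mod 72" | "6 dvd i" "6 dvd i'"
        using rim_label(4)[OF i i' \<open>?l = ?l'\<close>] by blast
      then show ?thesis
      proof cases
        case 2
        have "rim_point (partner i) (1 - 0) = rim_point i' 0"
          using rim_point_1[OF partner_range[OF i]] 2 by simp
        then show ?thesis using p[of 0] by (simp only: uu True)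
      next
        case 3
        then show ?thesis using glued_corners[OF i _ i'] uu True by simp
      qed (simp add: uu)
    next
      case False
      have "?m = ?m'"
        using at[of ?m] ne \<open>?l = ?l'\<close> False by (auto split: if_splits simp: of_bool_def)
      then have "i = i'" using rim_label(5)[OF i i' \<open>?l = ?l'\<close>] by blast
      then show ?thesis by (simp add: uu)
    qed
  next
    case False
    then have lm: "?l = ?m'" "u' = 1 - u"
      using at[of ?l] ne u by (auto simp: of_bool_def split: if_splits)
    have "?m = ?l'"
      using at[of ?l'] ne False u' by (auto simp: of_bool_def split: if_splits)
    then have "i' = partner i" using rim_label(6)[OF i i' lm(1)] by blast
    then show ?thesis using p[of u] u lm(2) by simp
  qed
qed

text \<open>The supports of the two points in the disc have the same labels. Either they are the same face, on
which the labels are injective, or both lie on the rim.\<close>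

lemma glued_wheel_to_surface:
  assumes x: "x \<in> realization wheel72" and y: "y \<in> realization wheel72"
    and eq: "wheel_to_surface x = wheel_to_surface y"
  shows "glued (barycentre x) (barycentre y)"
proof -
  note inj = bij_betw_imp_inj_on[OF bij_betw_ears]
  define X Y where "X = exchanges ear_moves x" and "Y = exchanges ear_moves y"
  have "X \<in> realization disc" "Y \<in> realization disc"
    unfolding X_def Y_def using bij_betwE[OF bij_betw_ears] x y by blast+
  then obtain \<sigma> \<tau> where \<sigma>: "\<sigma> \<in> set disc" "X \<in> closed_cell (set \<sigma>)" and \<tau>: "\<tau> \<in> set disc" "Y \<in> closed_cell (set \<tau>)"
    by (meson realizationE)
  define s t where "s = {v. X v \<noteq> 0}" and "t = {v. Y v \<noteq> 0}"
  have sub: "s \<subseteq> set \<sigma>" "t \<subseteq> set \<tau>"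
    using closed_cell_zero[OF \<sigma>(2)] closed_cell_zero[OF \<tau>(2)] by (auto simp: s_def t_def)
  have s: "X \<in> closed_cell s" and t: "Y \<in> closed_cell t"
    using closed_cell_support[OF \<sigma>(2)] closed_cell_support[OF \<tau>(2)] sub by (auto simp: s_def t_def)
  have XY: "glue_labels X = glue_labels Y"
    using eq by (simp add: wheel_to_surface_def X_def Y_def)
  have s72: "s \<subseteq> {0..72}" "inj_on label s" and t72: "t \<subseteq> {0..72}" "inj_on label t"
    using sub disc_facet[OF \<sigma>(1)] disc_facet[OF \<tau>(1)] by (auto intro: inj_on_subset)
  note S = glue_labels_cell[OF s s72] and T = glue_labels_cell[OF t t72]
  have supp: "label ` s = {w. glue_labels X w \<noteq> 0}"
    using S(1,2) unfolding s_def by fastforce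
  also have "\<dots> = label ` t"
    unfolding XY using T(1,2) unfolding t_def by fastforce
  finally have lab: "label ` s = label ` t" .
  show ?thesis
  proof (cases "s = t")
    case True
    have "X v = Y v" for v
    proof (cases "v \<in> s")
      case True
      then show ?thesis using S(1)[of v] T(1)[of v] XY \<open>s = t\<close> by simp
    next
      case False
      then show ?thesis using \<open>s = t\<close> by (auto simp: s_def t_def)
    qed
    then have "x = y" using inj x y unfolding X_def Y_def by (auto dest: inj_onD)
    then show ?thesis by simp
  next
    case False
    then obtain i i' where i: "0 \<le> i" "i < 72" "s \<subseteq> {i, (i + 1) mod 72}" and i': "0 \<le> i'" "i' < 72" "t \<subseteq> {i', (i' + 1) mod 72}"
      using disc_faces_label[OF \<sigma>(1) \<tau>(1) sub lab] by blast
    have rim: "\<exists>j u. 0 \<le> j \<and> j < 72 \<and> 0 \<le> u \<and> u < 1 \<and> x = rim_point j u"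
      if in_disc: "x \<in> realization wheel72" "exchanges ear_moves x \<in> closed_cell s" "s \<subseteq> {i, (i + 1) mod 72}"
        and range: "0 \<le> i" "i < 72"
      for x s i
    proof -
      define X where "X = exchanges ear_moves x"
      have "X \<in> closed_cell {i, (i + 1) mod 72}"
        using in_disc(2) closed_cell_mono[OF _ in_disc(3)] by (auto simp: X_def)
      then obtain j u where ju: "0 \<le> j" "j < 72" "0 \<le> u" "u < 1" "X = rim_point j u"
        using range by (rule rim_pointE)
      have "exchanges ear_moves X = X"
        using ju by (intro exchanges_ears_rim) (auto simp: rim_point_def)
      moreover have "X \<in> realization wheel72" unfolding ju(5) using ju by (intro rim_point_wheel72) auto
      ultimately have "x = X" using inj in_disc(1) unfolding X_def by (metis inj_onD)
      then show ?thesis using ju by blast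
    qed
    obtain j u where ju: "0 \<le> j" "j < 72" "0 \<le> u" "u < 1" "x = rim_point j u"
      using rim[OF x] s i unfolding X_def by blast
    obtain j' u' where ju': "0 \<le> j'" "j' < 72" "0 \<le> u'" "u' < 1" "y = rim_point j' u'"
      using rim[OF y] t i' unfolding Y_def by blast
    show ?thesis
      using glued_rim_points[OF ju(1-4) ju'(1-4)] eq unfolding ju(5) ju'(5) by blast
  qed
qed

lemma surface_homeomorphic_polygon:
  "top_of_set (realization surface) homeomorphic_space closed_orientable_surface 3"
proof -
  let ?W = "top_of_set (realization wheel72)"
  let ?R = "{(z, w). glued z w}"
  have compact: "compact_space ?W"
    by (intro compact_space_subtopology) (simp add: compact_realization)
  have "quotient_map ?W (top_of_set (realization surface)) wheel_to_surface"
  proof (rule quotient_map_compact_Hausdorff[OF compact Hausdorff_space_functions])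
    have img: "wheel_to_surface ` realization wheel72 = realization surface"
      unfolding wheel_to_surface_def image_comp[symmetric] bij_betw_imp_surj_on[OF bij_betw_ears] glue_labels_image ..
    then show "wheel_to_surface ` topspace ?W = topspace (top_of_set (realization surface))" by simp
    have "continuous_on (realization wheel72) wheel_to_surface"
      unfolding wheel_to_surface_def by (intro continuous_on_compose continuous_on_exchanges continuous_on_glue_labels)
    then show "continuous_map ?W (top_of_set (realization surface)) wheel_to_surface"
      using img by (auto simp: continuous_map_in_subtopology)
  qed
  moreover have "quotient_map ?W (closed_orientable_surface 3) ((\<lambda>z. ?R `` {z}) \<circ> barycentre)"
  proof (rule quotient_map_compose)
    show "quotient_map ?W (top_of_set (polygon 12)) barycentre"
    proof (rule quotient_map_compact_Hausdorff[OF compact])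
      show "barycentre ` topspace ?W = topspace (top_of_set (polygon 12))"
        using bij_betw_imp_surj_on[OF bij_betw_barycentre_wheel72] by simp
      then show "continuous_map ?W (top_of_set (polygon 12)) barycentre"
        using continuous_on_barycentre by (auto simp: continuous_map_in_subtopology)
    qed (simp add: Hausdorff_space_subtopology)
    show "quotient_map (top_of_set (polygon 12)) (closed_orientable_surface 3) (\<lambda>z. ?R `` {z})"
    proof -
      have "closed_orientable_surface 3 = quotient_topology (top_of_set (polygon 12)) ?R"
        by (simp add: closed_orientable_surface_def)
      then show ?thesis by (simp only: quotient_map_quotient_topology)
    qed
  qed
  moreover have "wheel_to_surface x = wheel_to_surface y \<longleftrightarrow>
      ((\<lambda>z. ?R `` {z}) \<circ> barycentre) x = ((\<lambda>z. ?R `` {z}) \<circ> barycentre) y"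
    if "x \<in> realization wheel72" "y \<in> realization wheel72" for x y
  proof -
    have "?R `` {z} = ?R `` {w} \<longleftrightarrow> glued z w" for z w
      by (auto intro: equivclp_trans equivclp_sym)
    then show ?thesis
      using wheel_to_surface_glued[OF that] glued_wheel_to_surface[OF that] by auto
  qed
  ultimately show ?thesis
    by (intro quotient_maps_same_fibres) auto
qed

section \<open>The squares of the configuration space\<close>

definition b_codes :: "int set" where
  "b_codes = {4, 8, 16, 32}"

definition b_vertex :: "int \<Rightarrow> theta_vertex" where
  "b_vertex i = (if i = 4 then B1 else if i = 8 then B2 else if i = 16 then B3 else B4)"

definition edge_point :: "theta_vertex \<Rightarrow> theta_vertex \<Rightarrow> real \<Rightarrow> theta_vertex \<Rightarrow> real" where
  "edge_point a b s v = (1 - s) * of_bool (v = a) + s * of_bool (v = b)"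

definition square_conf :: "int \<times> int \<times> int \<Rightarrow> real \<times> real \<Rightarrow> nat \<Rightarrow> theta_vertex \<Rightarrow> real" where
  "square_conf = (\<lambda>(i, j, k) (s, t). \<lambda>n\<in>{..<3}.
     if n = 0 then edge_point A1 (b_vertex i) s
     else if n = 1 then edge_point A2 (b_vertex j) t
     else edge_point (b_vertex k) (b_vertex k) 0)"

text \<open>Barycentric coordinates of the point \<open>(s, t)\<close> of a square in its two triangles. The
maxima and minima combine both cases: the diagonal is the line \<open>s + t = 1\<close>.\<close>

definition square_weights :: "int \<times> int \<times> int \<Rightarrow> real \<times> real \<Rightarrow> int \<Rightarrow> real" where
  "square_weights = (\<lambda>(i, j, k) (s, t) v.
     max 0 (1 - s - t) * of_bool (v = 3 + k) + max 0 (s + t - 1) * of_bool (v = i + j + k) +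
     min s (1 - t) * of_bool (v = 2 + i + k) + min t (1 - s) * of_bool (v = 1 + j + k))"

lemma conf_index:
  "(i, j, k) \<in> set conf_index \<longleftrightarrow> i \<in> b_codes \<and> j \<in> b_codes \<and> k \<in> b_codes \<and> i \<noteq> j \<and> i \<noteq> k \<and> j \<noteq> k"
  unfolding conf_index_def b_codes_def set_filter set_product list.set mem_Collect_eq mem_Times_iff
    fst_conv snd_conv prod.case conj_assoc ..

lemma b_vertex_eq_iff:
  "i \<in> b_codes \<Longrightarrow> j \<in> b_codes \<Longrightarrow> b_vertex i = b_vertex j \<longleftrightarrow> i = j"
  by (auto simp: b_vertex_def b_codes_def)

lemma b_vertex_neq [simp]: "b_vertex i \<noteq> A1" "b_vertex i \<noteq> A2" "A1 \<noteq> b_vertex i" "A2 \<noteq> b_vertex i"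
  by (auto simp: b_vertex_def)

lemma realization_conf:
  "x \<in> realization conf_facets \<longleftrightarrow> (\<exists>(i, j, k)\<in>set conf_index.
     x \<in> closed_cell {3 + k, 2 + i + k, 1 + j + k} \<or> x \<in> closed_cell {i + j + k, 2 + i + k, 1 + j + k})"
proof -
  have "x \<in> realization conf_facets \<longleftrightarrow> (\<exists>c\<in>set conf_index. \<exists>\<sigma>\<in>set (case c of (i, j, k) \<Rightarrow>
      [triangle (3 + k) (2 + i + k) (1 + j + k), triangle (i + j + k) (2 + i + k) (1 + j + k)]).
      x \<in> closed_cell (set \<sigma>))"
    unfolding realization_def conf_facets_def set_concat set_map by blast
  also have "\<dots> \<longleftrightarrow> (\<exists>(i, j, k)\<in>set conf_index.
      x \<in> closed_cell {3 + k, 2 + i + k, 1 + j + k} \<or> x \<in> closed_cell {i + j + k, 2 + i + k, 1 + j + k})"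
    by (intro bex_cong refl) (auto simp: triangle_def split: prod.splits)
  finally show ?thesis .
qed

lemma closed_cell_triangleI:
  assumes "a \<noteq> b" "a \<noteq> c" "b \<noteq> c" and "0 \<le> \<alpha>" "0 \<le> \<beta>" "0 \<le> \<gamma>" "\<alpha> + \<beta> + \<gamma> = 1"
    and x: "x = (\<lambda>v. \<alpha> * of_bool (v = a) + \<beta> * of_bool (v = b) + \<gamma> * of_bool (v = c))"
  shows "x \<in> closed_cell {a, b, c}"
  unfolding closed_cell_def mem_Collect_eq
proof (intro conjI allI impI)
  show "0 \<le> x v" for v using assms(4-6) by (simp add: x)
  show "x v = 0" if "v \<notin> {a, b, c}" for v using that by (simp add: x)
  have "sum x {a, b, c} = x a + (x b + x c)" using assms(1-3) by simp
  then show "sum x {a, b, c} = 1"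
    using assms(1-3) assms(1-3)[symmetric] assms(7) by (simp add: x)
qed

lemma closed_cell_triangleE:
  assumes "a \<noteq> b" "a \<noteq> c" "b \<noteq> c" and x: "x \<in> closed_cell {a, b, c}"
  obtains \<alpha> \<beta> \<gamma> where "0 \<le> \<alpha>" "0 \<le> \<beta>" "0 \<le> \<gamma>" "\<alpha> + \<beta> + \<gamma> = 1"
    "x = (\<lambda>v. \<alpha> * of_bool (v = a) + \<beta> * of_bool (v = b) + \<gamma> * of_bool (v = c))"
proof (rule that)
  show "0 \<le> x a" "0 \<le> x b" "0 \<le> x c" by (rule closed_cell_nonneg[OF x])+
  have "sum x {a, b, c} = x a + (x b + x c)" using assms(1-3) by simp
  then show "x a + x b + x c = 1" using x by (simp add: closed_cell_def)
  show "x = (\<lambda>v. x a * of_bool (v = a) + x b * of_bool (v = b) + x c * of_bool (v = c))"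
  proof
    show "x v = x a * of_bool (v = a) + x b * of_bool (v = b) + x c * of_bool (v = c)" for v
      using closed_cell_zero[OF x, of v] assms(1-3) by (cases "v \<in> {a, b, c}") auto
  qed
qed

lemma mod_4:
  assumes "(i, j, k) \<in> set conf_index"
  shows "i mod 4 = 0" "j mod 4 = 0" "k mod 4 = 0"
proof -
  have *: "n mod 4 = 0" if "n \<in> b_codes" for n
    using that by (auto simp: b_codes_def)
  show "i mod 4 = 0" "j mod 4 = 0" "k mod 4 = 0"
    using assms * unfolding conf_index by blast+
qed

lemma conf_codes_neq:
  assumes "(i, j, k) \<in> set conf_index"
  shows "3 + k \<noteq> 2 + i + k" "3 + k \<noteq> 1 + j + k" "2 + i + k \<noteq> 1 + j + k"
    "i + j + k \<noteq> 2 + i + k" "i + j + k \<noteq> 1 + j + k"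
  using mod_4[OF assms] by presburger+

lemma square_weights_low:
  assumes "s + t \<le> 1" "0 \<le> s" "0 \<le> t"
  shows "square_weights (i, j, k) (s, t) = (\<lambda>v. (1 - s - t) * of_bool (v = 3 + k) +
    s * of_bool (v = 2 + i + k) + t * of_bool (v = 1 + j + k))"
proof -
  have "max 0 (1 - s - t) = 1 - s - t" "max 0 (s + t - 1) = 0" "min s (1 - t) = s" "min t (1 - s) = t"
    using assms by auto
  then show ?thesis by (simp add: square_weights_def)
qed

lemma square_weights_high:
  assumes "1 \<le> s + t" "s \<le> 1" "t \<le> 1"
  shows "square_weights (i, j, k) (s, t) = (\<lambda>v. (s + t - 1) * of_bool (v = i + j + k) +
    (1 - t) * of_bool (v = 2 + i + k) + (1 - s) * of_bool (v = 1 + j + k))"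
proof -
  have "max 0 (1 - s - t) = 0" "max 0 (s + t - 1) = s + t - 1" "min s (1 - t) = 1 - t" "min t (1 - s) = 1 - s"
    using assms by auto
  then show ?thesis by (simp add: square_weights_def)
qed

lemma square_weights_image:
  "(\<Union>c\<in>set conf_index. square_weights c ` ({0..1} \<times> {0..1})) = realization conf_facets"
proof (intro equalityI subsetI)
  fix x assume "x \<in> (\<Union>c\<in>set conf_index. square_weights c ` ({0..1} \<times> {0..1}))"
  then obtain i j k s t where c: "(i, j, k) \<in> set conf_index" and st: "0 \<le> s" "s \<le> 1" "0 \<le> t" "t \<le> 1"
    and x: "x = square_weights (i, j, k) (s, t)" by auto
  note n = conf_codes_neq[OF c]
  show "x \<in> realization conf_facets"
  proof (cases "s + t \<le> 1")
    case True
    have "x \<in> closed_cell {3 + k, 2 + i + k, 1 + j + k}"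
      using closed_cell_triangleI[OF n(1,2,3) _ st(1,3) _ x[unfolded square_weights_low[OF True st(1,3)]]] True
      by simp
    then show ?thesis using c unfolding realization_conf by blast
  next
    case False
    then have le: "1 \<le> s + t" by simp
    have "x \<in> closed_cell {i + j + k, 2 + i + k, 1 + j + k}"
      using closed_cell_triangleI[OF n(4,5,3) _ _ _ _ x[unfolded square_weights_high[OF le st(2,4)]]] le st
      by simp
    then show ?thesis using c unfolding realization_conf by blast
  qed
next
  fix x assume "x \<in> realization conf_facets"
  then obtain i j k where c: "(i, j, k) \<in> set conf_index" and
    or: "x \<in> closed_cell {3 + k, 2 + i + k, 1 + j + k} \<or> x \<in> closed_cell {i + j + k, 2 + i + k, 1 + j + k}"
    unfolding realization_conf by blast
  note n = conf_codes_neq[OF c]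
  have "\<exists>s t. s \<in> {0..1} \<and> t \<in> {0..1} \<and> x = square_weights (i, j, k) (s, t)"
    using or
  proof
    assume "x \<in> closed_cell {3 + k, 2 + i + k, 1 + j + k}"
    then obtain \<alpha> \<beta> \<gamma> where w: "0 \<le> \<alpha>" "0 \<le> \<beta>" "0 \<le> \<gamma>" "\<alpha> + \<beta> + \<gamma> = 1"
      and x: "x = (\<lambda>v. \<alpha> * of_bool (v = 3 + k) + \<beta> * of_bool (v = 2 + i + k) + \<gamma> * of_bool (v = 1 + j + k))"
      by (rule closed_cell_triangleE[OF n(1,2,3)])
    have "\<alpha> = 1 - \<beta> - \<gamma>" using w by simp
    then have "x = square_weights (i, j, k) (\<beta>, \<gamma>)"
      unfolding x using w by (subst square_weights_low) auto
    then show ?thesis using w by (intro exI[of _ \<beta>] exI[of _ \<gamma>]) auto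
  next
    assume "x \<in> closed_cell {i + j + k, 2 + i + k, 1 + j + k}"
    then obtain \<alpha> \<beta> \<gamma> where w: "0 \<le> \<alpha>" "0 \<le> \<beta>" "0 \<le> \<gamma>" "\<alpha> + \<beta> + \<gamma> = 1"
      and x: "x = (\<lambda>v. \<alpha> * of_bool (v = i + j + k) + \<beta> * of_bool (v = 2 + i + k) + \<gamma> * of_bool (v = 1 + j + k))"
      by (rule closed_cell_triangleE[OF n(4,5,3)])
    have "\<alpha> = (1 - \<gamma>) + (1 - \<beta>) - 1" using w by simp
    then have "x = square_weights (i, j, k) (1 - \<gamma>, 1 - \<beta>)"
      unfolding x using w by (subst square_weights_high) auto
    then show ?thesis using w by (intro exI[of _ "1 - \<gamma>"] exI[of _ "1 - \<beta>"]) auto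
  qed
  then show "x \<in> (\<Union>c\<in>set conf_index. square_weights c ` ({0..1} \<times> {0..1}))"
    using c by blast
qed

lemma continuous_on_square_weights: "continuous_on X (square_weights c)"
proof -
  obtain i j k where c: "c = (i, j, k)" by (cases c)
  show ?thesis
    unfolding c square_weights_def split_beta prod.case
    by (intro continuous_on_coordinatewise_then_product continuous_intros)
qed

section \<open>Squares with the same weights\<close>

text \<open>Binary digits recover a set of the numbers 4, 8, 16, 32 from its sum.\<close>

lemma code_sets:
  assumes "i \<in> b_codes" "k \<in> b_codes" "i \<noteq> k"
  shows "{i, k} = {x \<in> b_codes. odd ((i + k) div x)}"
    and "j \<in> b_codes \<Longrightarrow> i \<noteq> j \<Longrightarrow> j \<noteq> k \<Longrightarrow> {i, j, k} = {x \<in> b_codes. odd ((i + j + k) div x)}"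
  using assms by (auto simp: b_codes_def)

lemma code_pair_eq:
  assumes "i \<in> b_codes" "k \<in> b_codes" "i \<noteq> k" "i' \<in> b_codes" "k' \<in> b_codes" "i' \<noteq> k'"
  shows "i + k = i' + k' \<longleftrightarrow> {i, k} = {i', k'}"
proof
  show "i + k = i' + k' \<Longrightarrow> {i, k} = {i', k'}"
    using code_sets(1)[OF assms(1-3)] code_sets(1)[OF assms(4-6)] by simp
  assume "{i, k} = {i', k'}"
  then have "\<Sum>{i, k} = \<Sum>{i', k'}" by simp
  then show "i + k = i' + k'" using assms(3,6) by simp
qed

lemma code_triple_eq:
  assumes "(i, j, k) \<in> set conf_index" "(i', j', k') \<in> set conf_index"
  shows "i + j + k = i' + j' + k' \<longleftrightarrow> {i, j, k} = {i', j', k'}"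
proof
  have *: "{i, j, k} = {x \<in> b_codes. odd ((i + j + k) div x)}" if "(i, j, k) \<in> set conf_index" for i j k
    using that code_sets(2)[of i k j] unfolding conf_index by blast
  show "i + j + k = i' + j' + k' \<Longrightarrow> {i, j, k} = {i', j', k'}"
    using *[OF assms(1)] *[OF assms(2)] by simp
  assume "{i, j, k} = {i', j', k'}"
  then have "\<Sum>{i, j, k} = \<Sum>{i', j', k'}" by simp
  then show "i + j + k = i' + j' + k'" using assms unfolding conf_index by simp
qed

text \<open>The four kinds of vertices, by the number of points at \<open>a\<^sub>1\<close> and
\<open>a\<^sub>2\<close>, are distinguished modulo 4.\<close>

lemma square_weights_at:
  assumes "(i, j, k) \<in> set conf_index" "(i', j', k') \<in> set conf_index"
  shows "square_weights (i, j, k) (s, t) (3 + k') = max 0 (1 - s - t) * of_bool (k = k')"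
    and "square_weights (i, j, k) (s, t) (i' + j' + k') = max 0 (s + t - 1) * of_bool ({i, j, k} = {i', j', k'})"
    and "square_weights (i, j, k) (s, t) (2 + i' + k') = min s (1 - t) * of_bool ({i, k} = {i', k'})"
    and "square_weights (i, j, k) (s, t) (1 + j' + k') = min t (1 - s) * of_bool ({j, k} = {j', k'})"
proof -
  note m = mod_4[OF assms(1)] mod_4[OF assms(2)]
  have "3 + k' \<noteq> i + j + k" "3 + k' \<noteq> 2 + i + k" "3 + k' \<noteq> 1 + j + k" using m by presburger+
  then show "square_weights (i, j, k) (s, t) (3 + k') = max 0 (1 - s - t) * of_bool (k = k')"
    by (auto simp: square_weights_def)
  have "i' + j' + k' \<noteq> 3 + k" "i' + j' + k' \<noteq> 2 + i + k" "i' + j' + k' \<noteq> 1 + j + k" using m by presburger+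
  then show "square_weights (i, j, k) (s, t) (i' + j' + k') = max 0 (s + t - 1) * of_bool ({i, j, k} = {i', j', k'})"
    unfolding code_triple_eq[OF assms, symmetric] by (auto simp: square_weights_def)
  have "2 + i' + k' \<noteq> 3 + k" "2 + i' + k' \<noteq> i + j + k" "2 + i' + k' \<noteq> 1 + j + k" using m by presburger+
  moreover have "{i, k} = {i', k'} \<longleftrightarrow> i + k = i' + k'"
    using code_pair_eq[of i k i' k'] assms unfolding conf_index by blast
  ultimately show "square_weights (i, j, k) (s, t) (2 + i' + k') = min s (1 - t) * of_bool ({i, k} = {i', k'})"
    by (auto simp: square_weights_def)
  have "1 + j' + k' \<noteq> 3 + k" "1 + j' + k' \<noteq> i + j + k" "1 + j' + k' \<noteq> 2 + i + k" using m by presburger+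
  moreover have "{j, k} = {j', k'} \<longleftrightarrow> j + k = j' + k'"
    using code_pair_eq[of j k j' k'] assms unfolding conf_index by blast
  ultimately show "square_weights (i, j, k) (s, t) (1 + j' + k') = min t (1 - s) * of_bool ({j, k} = {j', k'})"
    by (auto simp: square_weights_def)
qed

text \<open>The coordinates are compared separately for each of the four kinds of vertices, and \<open>s,
t\<close> are sums of two of them.\<close>

lemma square_weights_eq_iff:
  assumes c: "(i, j, k) \<in> set conf_index" and c': "(i', j', k') \<in> set conf_index"
    and st: "0 \<le> s" "s \<le> 1" "0 \<le> t" "t \<le> 1" and st': "0 \<le> s'" "s' \<le> 1" "0 \<le> t'" "t' \<le> 1"
  shows "square_weights (i, j, k) (s, t) = square_weights (i', j', k') (s', t') \<longleftrightarrow>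
    s = s' \<and> t = t' \<and> (s + t < 1 \<longrightarrow> k = k') \<and> (0 < s \<and> t < 1 \<longrightarrow> {i, k} = {i', k'}) \<and>
    (0 < t \<and> s < 1 \<longrightarrow> {j, k} = {j', k'}) \<and> (1 < s + t \<longrightarrow> {i, j, k} = {i', j', k'})" (is "?L \<longleftrightarrow> ?R")
proof
  assume ?L
  note eq = fun_cong[OF this]
  have ob: "x = y \<and> (x = 0 \<or> P)" if "x = y * of_bool P" "x * of_bool P = y" for x y :: real and P
    using that by (cases P) auto
  have 1: "max 0 (1 - s - t) = max 0 (1 - s' - t') \<and> (max 0 (1 - s - t) = 0 \<or> k = k')"
    using eq[of "3 + k"] eq[of "3 + k'"] square_weights_at(1)[OF c c'] square_weights_at(1)[OF c' c]
      square_weights_at(1)[OF c c] square_weights_at(1)[OF c' c'] by (intro ob) (auto simp: eq_commute[of k])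
  have 2: "max 0 (s + t - 1) = max 0 (s' + t' - 1) \<and> (max 0 (s + t - 1) = 0 \<or> {i, j, k} = {i', j', k'})"
    using eq[of "i + j + k"] eq[of "i' + j' + k'"] square_weights_at(2)[OF c c'] square_weights_at(2)[OF c' c]
      square_weights_at(2)[OF c c] square_weights_at(2)[OF c' c'] by (intro ob) (simp_all add: eq_commute[of "{i, j, k}"])
  have 3: "min s (1 - t) = min s' (1 - t') \<and> (min s (1 - t) = 0 \<or> {i, k} = {i', k'})"
    using eq[of "2 + i + k"] eq[of "2 + i' + k'"] square_weights_at(3)[OF c c'] square_weights_at(3)[OF c' c]
      square_weights_at(3)[OF c c] square_weights_at(3)[OF c' c'] by (intro ob) (simp_all add: eq_commute[of "{i, k}"])
  have 4: "min t (1 - s) = min t' (1 - s') \<and> (min t (1 - s) = 0 \<or> {j, k} = {j', k'})"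
    using eq[of "1 + j + k"] eq[of "1 + j' + k'"] square_weights_at(4)[OF c c'] square_weights_at(4)[OF c' c]
      square_weights_at(4)[OF c c] square_weights_at(4)[OF c' c'] by (intro ob) (simp_all add: eq_commute[of "{j, k}"])
  have "s = min s (1 - t) + max 0 (s + t - 1)" "s' = min s' (1 - t') + max 0 (s' + t' - 1)"
    "t = min t (1 - s) + max 0 (s + t - 1)" "t' = min t' (1 - s') + max 0 (s' + t' - 1)"
    by (auto simp: min_def max_def)
  then have "s = s'" "t = t'" using 2 3 4 by metis+
  moreover have "s + t < 1 \<longrightarrow> k = k'" using 1 by (auto simp: max_def)
  moreover have "1 < s + t \<longrightarrow> {i, j, k} = {i', j', k'}" using 2 by (auto simp: max_def)
  moreover have "0 < s \<and> t < 1 \<longrightarrow> {i, k} = {i', k'}" using 3 by (auto simp: min_def split: if_splits)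
  moreover have "0 < t \<and> s < 1 \<longrightarrow> {j, k} = {j', k'}" using 4 by (auto simp: min_def split: if_splits)
  ultimately show ?R by blast
next
  assume R: ?R
  have p: "{i, k} = {i', k'} \<Longrightarrow> i + k = i' + k'" "{j, k} = {j', k'} \<Longrightarrow> j + k = j' + k'"
    using code_pair_eq[of i k i' k'] code_pair_eq[of j k j' k'] c c' unfolding conf_index by blast+
  have m: "\<not> s + t < 1 \<Longrightarrow> max 0 (1 - s - t) = 0" "\<not> 1 < s + t \<Longrightarrow> max 0 (s + t - 1) = 0"
    "\<not> (0 < s \<and> t < 1) \<Longrightarrow> min s (1 - t) = 0" "\<not> (0 < t \<and> s < 1) \<Longrightarrow> min t (1 - s) = 0"
    using st by linarith+
  have 1: "max 0 (1 - s - t) = 0 \<or> k = k'" using R m(1) by blast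
  have 2: "max 0 (s + t - 1) = 0 \<or> i + j + k = i' + j' + k'" using R m(2) code_triple_eq[OF c c'] by blast
  have 3: "min s (1 - t) = 0 \<or> i + k = i' + k'" using R m(3) p(1) by blast
  have 4: "min t (1 - s) = 0 \<or> j + k = j' + k'" using R m(4) p(2) by blast
  have "max 0 (1 - s - t) * of_bool (v = 3 + k) = max 0 (1 - s - t) * of_bool (v = 3 + k')" for v
    using 1 by (elim disjE) simp_all
  moreover have "max 0 (s + t - 1) * of_bool (v = i + j + k) = max 0 (s + t - 1) * of_bool (v = i' + j' + k')" for v
    using 2 by (elim disjE) simp_all
  moreover have "min s (1 - t) * of_bool (v = 2 + i + k) = min s (1 - t) * of_bool (v = 2 + i' + k')" for v
    unfolding add.assoc using 3 by (elim disjE) simp_all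
  moreover have "min t (1 - s) * of_bool (v = 1 + j + k) = min t (1 - s) * of_bool (v = 1 + j' + k')" for v
    unfolding add.assoc using 4 by (elim disjE) simp_all
  moreover have "s' = s" "t' = t" using R by blast+
  ultimately show ?L
    by (intro ext) (simp only: square_weights_def prod.case)
qed

section \<open>Squares with the same configurations\<close>

lemma theta_vertices: "v \<in> {A1, A2} \<or> (\<exists>i\<in>b_codes. v = b_vertex i)"
  by (cases v) (auto simp: b_codes_def b_vertex_def)

lemma edge_point_cell:
  assumes "0 \<le> s" "s \<le> 1"
  shows "edge_point a b s \<in> closed_cell {a, b}"
  using assms by (cases "a = b") (auto simp: closed_cell_def edge_point_def)

lemma edge_point_1: "edge_point a b 1 = edge_point b b 0"
  by (rule ext) (simp add: edge_point_def)

lemma edge_point_0: "edge_point a b 0 = edge_point a a 0"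
  by (rule ext) (simp add: edge_point_def)

lemma edge_pointE:
  assumes x: "x \<in> closed_cell {a, b}" and "a \<noteq> b"
  obtains s where "0 \<le> s" "s \<le> 1" "x = edge_point a b s"
proof (rule that)
  have sum: "x a + x b = 1" using assms by (simp add: closed_cell_def)
  show "0 \<le> x b" "x b \<le> 1" using closed_cell_nonneg[OF x, of a] closed_cell_nonneg[OF x, of b] sum by linarith+
  show "x = edge_point a b (x b)"
  proof
    fix v
    show "x v = edge_point a b (x b) v"
      using closed_cell_zero[OF x, of v] sum \<open>a \<noteq> b\<close>
      by (cases "v = a"; cases "v = b") (auto simp: edge_point_def)
  qed
qed

lemma closed_cell_singleton: "x \<in> closed_cell {b} \<Longrightarrow> x = edge_point b b 0"
proof
  fix v assume x: "x \<in> closed_cell {b}"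
  then have "x b = 1" by (simp add: closed_cell_def)
  then show "x v = edge_point b b 0 v"
    using closed_cell_zero[OF x, of v] by (cases "v = b") (auto simp: edge_point_def)
qed

lemma closed_cell_disjoint:
  assumes "s \<inter> t = {}"
  shows "closed_cell s \<inter> closed_cell t = {}"
proof -
  have False if "x \<in> closed_cell s" "x \<in> closed_cell t" for x
  proof -
    have "x v = 0" if "v \<in> s" for v
      using that assms closed_cell_zero[OF \<open>x \<in> closed_cell t\<close>, of v] by blast
    then have "sum x s = 0" by simp
    then show False using \<open>x \<in> closed_cell s\<close> by (simp add: closed_cell_def)
  qed
  then show ?thesis by blast
qed

lemma vertex_in_cell: "finite s \<Longrightarrow> v \<in> s \<Longrightarrow> edge_point v v 0 \<in> closed_cell s"
  by (auto simp: closed_cell_def edge_point_def)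

lemma square_conf_simps:
  "square_conf (i, j, k) (s, t) 0 = edge_point A1 (b_vertex i) s"
  "square_conf (i, j, k) (s, t) (Suc 0) = edge_point A2 (b_vertex j) t"
  "square_conf (i, j, k) (s, t) 2 = edge_point (b_vertex k) (b_vertex k) 0"
  by (simp_all add: square_conf_def)

lemma lessThan_3: "{..<3} = {0, Suc 0, 2 :: nat}"
  by auto

text \<open>The vertices \<open>b\<^sub>l\<close> that are occupied; points inside an edge do not count.\<close>

definition at_b :: "int \<times> int \<times> int \<Rightarrow> real \<times> real \<Rightarrow> int set" where
  "at_b = (\<lambda>(i, j, k) (s, t). {k} \<union> (if s = 1 then {i} else {}) \<union> (if t = 1 then {j} else {}))"

text \<open>A configuration consists of its points inside edges and of the vertices that it occupies; the
parameters are found from the positions at \<open>a\<^sub>1\<close> and \<open>a\<^sub>2\<close>.\<close>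

lemma square_conf_eq_iff:
  assumes c: "(i, j, k) \<in> set conf_index" and c': "(i', j', k') \<in> set conf_index"
    and st: "0 \<le> s" "s \<le> 1" "0 \<le> t" "t \<le> 1" and st': "0 \<le> s'" "s' \<le> 1" "0 \<le> t'" "t' \<le> 1"
  shows "square_conf (i, j, k) (s, t) ` {..<3} = square_conf (i', j', k') (s', t') ` {..<3} \<longleftrightarrow>
    s = s' \<and> t = t' \<and> (0 < s \<and> s < 1 \<longrightarrow> i = i') \<and> (0 < t \<and> t < 1 \<longrightarrow> j = j') \<and>
    at_b (i, j, k) (s, t) = at_b (i', j', k') (s', t')" (is "?C = ?C' \<longleftrightarrow> ?R")
proof -
  note D = conf_index[THEN iffD1, OF c] and D' = conf_index[THEN iffD1, OF c']
  let ?x = "edge_point A1 (b_vertex i) s" and ?y = "edge_point A2 (b_vertex j) t"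
    and ?x' = "edge_point A1 (b_vertex i') s'" and ?y' = "edge_point A2 (b_vertex j') t'"
  let ?v = "\<lambda>l. edge_point (b_vertex l) (b_vertex l) 0"
  have C: "?C = {?x, ?y, ?v k}" and C': "?C' = {?x', ?y', ?v k'}"
    unfolding lessThan_3 by (simp_all add: square_conf_simps)
  have vb: "edge_point a (b_vertex l) u (b_vertex m) = u * of_bool (l = m)" if "a \<in> {A1, A2}" "l \<in> b_codes" "m \<in> b_codes" for a l m u
    using that by (auto simp: edge_point_def b_vertex_eq_iff)
  have vv: "?v l (b_vertex m) = of_bool (l = m)" if "l \<in> b_codes" "m \<in> b_codes" for l m
    using that by (auto simp: edge_point_def b_vertex_eq_iff)
  have inj: "?v l = ?v m \<longleftrightarrow> l = m" if "l \<in> b_codes" "m \<in> b_codes" for l m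
  proof
    assume "?v l = ?v m"
    then have "?v l (b_vertex l) = ?v m (b_vertex l)" by (rule fun_cong)
    then have "of_bool (l = l) = (of_bool (m = l) :: real)"
      unfolding vv[OF that(1) that(1)] vv[OF that(2) that(1)] .
    then show "l = m" by (cases "m = l") simp_all
  qed simp
  \<comment> \<open>At most one of the points has a nonzero coordinate at \<open>A1\<close>, so the maximum over the points finds it.\<close>
  have maxC: "Max ((\<lambda>p. p A1) ` {edge_point A1 (b_vertex i) s, edge_point A2 (b_vertex j) t, ?v k}) = 1 - s"
    "Max ((\<lambda>p. p A2) ` {edge_point A1 (b_vertex i) s, edge_point A2 (b_vertex j) t, ?v k}) = 1 - t"
    if "s \<le> 1" "t \<le> 1" for i j k s t
    using that unfolding image_insert image_empty by (simp_all add: edge_point_def)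
  have mem: "?v l \<in> {edge_point A1 (b_vertex i) s, edge_point A2 (b_vertex j) t, ?v k} \<longleftrightarrow> l \<in> at_b (i, j, k) (s, t)"
    if "l \<in> b_codes" "i \<in> b_codes" "j \<in> b_codes" "k \<in> b_codes" for l i j k s t
  proof -
    have *: "?v l = edge_point a (b_vertex m) u \<longleftrightarrow> u = 1 \<and> l = m"
      if a: "a \<in> {A1, A2}" and lm: "l \<in> b_codes" "m \<in> b_codes" for a l m u
    proof
      assume eq: "?v l = edge_point a (b_vertex m) u"
      have "?v l a = 0" "edge_point a (b_vertex m) u a = 1 - u" using a by (auto simp: edge_point_def)
      then have u: "u = 1" using fun_cong[OF eq, of a] by linarith
      then show "u = 1 \<and> l = m" using eq inj[OF lm] unfolding u edge_point_1 by blast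
    next
      assume "u = 1 \<and> l = m"
      then show "?v l = edge_point a (b_vertex m) u" by (simp only: edge_point_1)
    qed
    have "?v l = edge_point A1 (b_vertex i) s \<longleftrightarrow> s = 1 \<and> l = i" "?v l = edge_point A2 (b_vertex j) t \<longleftrightarrow> t = 1 \<and> l = j"
      using *[OF _ that(1,2)] *[OF _ that(1,3)] by blast+
    then show ?thesis using inj[OF that(1,4)] by (auto simp: at_b_def)
  qed
  have codes: "i \<in> b_codes" "j \<in> b_codes" "k \<in> b_codes" "i' \<in> b_codes" "j' \<in> b_codes" "k' \<in> b_codes"
    using D D' by blast+
  have sub: "at_b (i, j, k) (s, t) \<subseteq> b_codes" "at_b (i', j', k') (s', t') \<subseteq> b_codes"
    using codes by (auto simp: at_b_def)
  show ?thesis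
    unfolding C C'
  proof
    assume eq: "{?x, ?y, ?v k} = {?x', ?y', ?v k'}"
    have ss: "s = s'" and tt: "t = t'"
      using maxC[of s t i j k] maxC[of s' t' i' j' k'] st st' unfolding eq by linarith+
    have "i = i'" if "0 < s" "s < 1"
    proof -
      have "?x \<in> {?x', ?y', ?v k'}" using eq by blast
      moreover have "?x A1 \<noteq> ?y' A1" "?x A1 \<noteq> ?v k' A1" using that by (auto simp: edge_point_def)
      ultimately have "?x = ?x'" by auto
      then have "?x (b_vertex i) = ?x' (b_vertex i)" by simp
      then have "s * of_bool (i = i) = s' * of_bool (i' = i)"
        using vb[of A1 i i s] vb[of A1 i' i s'] D D' by simp
      then show ?thesis using that by (cases "i' = i") simp_all
    qed
    moreover have "j = j'" if "0 < t" "t < 1"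
    proof -
      have "?y \<in> {?x', ?y', ?v k'}" using eq by blast
      moreover have "?y A2 \<noteq> ?x' A2" "?y A2 \<noteq> ?v k' A2" using that by (auto simp: edge_point_def)
      ultimately have "?y = ?y'" by auto
      then have "?y (b_vertex j) = ?y' (b_vertex j)" by simp
      then have "t * of_bool (j = j) = t' * of_bool (j' = j)"
        using vb[of A2 j j t] vb[of A2 j' j t'] D D' by simp
      then show ?thesis using that by (cases "j' = j") simp_all
    qed
    moreover have "at_b (i, j, k) (s, t) = at_b (i', j', k') (s', t')"
    proof (rule set_eqI)
      fix l
      show "l \<in> at_b (i, j, k) (s, t) \<longleftrightarrow> l \<in> at_b (i', j', k') (s', t')"
      proof (cases "l \<in> b_codes")
        case True
        show ?thesis unfolding mem[OF True codes(1-3), symmetric] mem[OF True codes(4-6), symmetric] eq ..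
      next
        case False
        then show ?thesis using sub by blast
      qed
    qed
    ultimately show ?R using ss tt by blast
  next
    assume R: ?R
    then have ss: "s' = s" and tt: "t' = t" by auto
    have at_eq: "at_b (i, j, k) (s, t) = at_b (i', j', k') (s', t')" using R by blast
    have dec: "{edge_point A1 (b_vertex i) s, edge_point A2 (b_vertex j) t, ?v k} =
        ?v ` at_b (i, j, k) (s, t) \<union> (if s = 0 then {edge_point A1 A1 0} else {}) \<union>
        (if t = 0 then {edge_point A2 A2 0} else {}) \<union> (if 0 < s \<and> s < 1 then {edge_point A1 (b_vertex i) s} else {}) \<union>
        (if 0 < t \<and> t < 1 then {edge_point A2 (b_vertex j) t} else {})" (is "_ = ?rhs i j k")
      if "0 \<le> s" "s \<le> 1" "0 \<le> t" "t \<le> 1" for i j k s t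
    proof -
      have "s = 0 \<or> 0 < s \<and> s < 1 \<or> s = 1" "t = 0 \<or> 0 < t \<and> t < 1 \<or> t = 1" using that by linarith+
      then show ?thesis
        by (elim disjE conjE)
           (simp_all add: at_b_def edge_point_0[of A1 "b_vertex i"] edge_point_0[of A2 "b_vertex j"] edge_point_1
             insert_commute)
    qed
    have ij: "0 < s \<and> s < 1 \<longrightarrow> i = i'" "0 < t \<and> t < 1 \<longrightarrow> j = j'" using R by blast+
    have i: "(if 0 < s \<and> s < 1 then {?x} else {}) = (if 0 < s \<and> s < 1 then {edge_point A1 (b_vertex i') s} else {})"
      by (rule if_cong[OF refl]) (simp_all only: ij(1)[rule_format])
    have j: "(if 0 < t \<and> t < 1 then {?y} else {}) = (if 0 < t \<and> t < 1 then {edge_point A2 (b_vertex j') t} else {})"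
      by (rule if_cong[OF refl]) (simp_all only: ij(2)[rule_format])
    show "{?x, ?y, ?v k} = {?x', ?y', ?v k'}"
      unfolding dec[OF st] dec[OF st'] at_eq unfolding ss tt i j ..
  qed
qed

text \<open>Two squares share a point of the configuration space precisely if they share it in the
triangulation. The abbreviations \<open>S, T, U\<close> for the equality of vertices of the
triangulation reduce this to a propositional statement for each position of \<open>(s, t)\<close>
in the square.\<close>

lemma square_fibres:
  assumes c: "(i, j, k) \<in> set conf_index" and c': "(i', j', k') \<in> set conf_index"
    and st: "0 \<le> s" "s \<le> 1" "0 \<le> t" "t \<le> 1" and st': "0 \<le> s'" "s' \<le> 1" "0 \<le> t'" "t' \<le> 1"
  shows "square_conf (i, j, k) (s, t) ` {..<3} = square_conf (i', j', k') (s', t') ` {..<3} \<longleftrightarrow>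
    square_weights (i, j, k) (s, t) = square_weights (i', j', k') (s', t')"
proof -
  have ne: "i \<noteq> j" "i \<noteq> k" "j \<noteq> k" "i' \<noteq> j'" "i' \<noteq> k'" "j' \<noteq> k'"
    using c c' unfolding conf_index by blast+
  define S where "S \<longleftrightarrow> {i, k} = {i', k'}"
  define T where "T \<longleftrightarrow> {j, k} = {j', k'}"
  define U where "U \<longleftrightarrow> {i, j, k} = {i', j', k'}"
  have at: "at_b (i, j, k) (s, t) = at_b (i', j', k') (s, t) \<longleftrightarrow>
      (if s = 1 then if t = 1 then U else S else if t = 1 then T else k = k')"
    unfolding S_def T_def U_def by (cases "s = 1"; cases "t = 1") (simp_all add: at_b_def insert_commute)
  have S: "k = k' \<Longrightarrow> S \<longleftrightarrow> i = i'" and T: "k = k' \<Longrightarrow> T \<longleftrightarrow> j = j'"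
    and ST: "S \<and> T \<longleftrightarrow> i = i' \<and> j = j' \<and> k = k'"
    unfolding S_def T_def using ne by (auto simp: doubleton_eq_iff)
  have SU: "S \<and> U \<longleftrightarrow> S \<and> j = j'"
  proof -
    have "{i, j, k} = insert j {i, k}" "{i', j', k'} = insert j' {i', k'}" by auto
    moreover have "j \<notin> {i, k}" "j' \<notin> {i', k'}" using ne by auto
    ultimately show ?thesis unfolding S_def U_def by (metis insert_ident insertE insertI1)
  qed
  have TU: "T \<and> U \<longleftrightarrow> T \<and> i = i'"
  proof -
    have "i \<notin> {j, k}" "i' \<notin> {j', k'}" using ne by auto
    then show ?thesis unfolding T_def U_def by (metis insert_ident insertE insertI1)
  qed
  have U: "i = i' \<Longrightarrow> j = j' \<Longrightarrow> k = k' \<Longrightarrow> U" unfolding U_def by simp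
  have "(0 < s \<and> s < 1 \<longrightarrow> i = i') \<and> (0 < t \<and> t < 1 \<longrightarrow> j = j') \<and>
      (if s = 1 then if t = 1 then U else S else if t = 1 then T else k = k') \<longleftrightarrow>
    (s + t < 1 \<longrightarrow> k = k') \<and> (0 < s \<and> t < 1 \<longrightarrow> S) \<and> (0 < t \<and> s < 1 \<longrightarrow> T) \<and> (1 < s + t \<longrightarrow> U)"
    (is "?C \<longleftrightarrow> ?W")
  proof -
    have s: "s = 0 \<or> s = 1 \<or> 0 < s \<and> s < 1" and t: "t = 0 \<or> t = 1 \<or> 0 < t \<and> t < 1"
      using st by linarith+
    from s t show ?thesis
    proof (elim disjE)
      assume "0 < s \<and> s < 1" "0 < t \<and> t < 1"
      then show ?thesis using ST U by auto
    next
      assume "0 < s \<and> s < 1" "t = 0"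
      then show ?thesis using S by auto
    next
      assume "0 < s \<and> s < 1" "t = 1"
      then show ?thesis using TU by auto
    next
      assume "s = 0" "0 < t \<and> t < 1"
      then show ?thesis using T by auto
    next
      assume "s = 1" "0 < t \<and> t < 1"
      then show ?thesis using SU by auto
    qed simp_all
  qed
  note main = this
  show ?thesis
  proof (cases "s = s' \<and> t = t'")
    case True
    then have e: "s' = s" "t' = t" by simp_all
    have "?thesis \<longleftrightarrow> (s = s \<and> t = t \<and> (0 < s \<and> s < 1 \<longrightarrow> i = i') \<and> (0 < t \<and> t < 1 \<longrightarrow> j = j') \<and>
        (if s = 1 then if t = 1 then U else S else if t = 1 then T else k = k') \<longleftrightarrow>
      s = s \<and> t = t \<and> (s + t < 1 \<longrightarrow> k = k') \<and> (0 < s \<and> t < 1 \<longrightarrow> S) \<and> (0 < t \<and> s < 1 \<longrightarrow> T) \<and>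
        (1 < s + t \<longrightarrow> U))"
      unfolding square_conf_eq_iff[OF assms] square_weights_eq_iff[OF assms]
      unfolding e at S_def[symmetric] T_def[symmetric] U_def[symmetric] ..
    then show ?thesis using main by (simp only: simp_thms)
  next
    case False
    then show ?thesis
      unfolding square_conf_eq_iff[OF assms] square_weights_eq_iff[OF assms] by blast
  qed
qed

section \<open>Every configuration lies in one of the squares\<close>

abbreviation theta4_cells :: "(theta_vertex \<Rightarrow> real) set set" where
  "theta4_cells \<equiv> graph_cells UNIV theta4_edges"

lemma theta4_cellE:
  assumes "e \<in> theta4_cells"
  obtains c l where "e = closed_cell c" "finite c" "c \<noteq> {}" "\<not> (A1 \<in> c \<and> A2 \<in> c)"
    "c \<subseteq> {A1, A2, b_vertex l}"
proof -
  obtain c where c: "e = closed_cell c" "(\<exists>v. c = {v}) \<or> c \<in> theta4_edges"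
    using assms by (auto simp: graph_cells_def)
  from c(2) show ?thesis
  proof
    assume "\<exists>v. c = {v}"
    then obtain v where v: "c = {v}" by blast
    obtain l where "v \<in> {A1, A2, b_vertex l}" using theta_vertices[of v] by auto
    then show ?thesis using that[OF c(1), of l] v by auto
  next
    assume "c \<in> theta4_edges"
    then obtain a b where ab: "c = {a, b}" "a \<in> {A1, A2}" "b \<in> {B1, B2, B3, B4}"
      by (auto simp: theta4_edges_def)
    obtain l where "b = b_vertex l" using theta_vertices[of b] ab(3) by auto
    then show ?thesis using that[OF c(1), of l] ab by auto
  qed
qed

lemma another_b_code: "\<exists>l\<in>b_codes. l \<noteq> m \<and> l \<noteq> n"
proof -
  have "\<not> b_codes \<subseteq> {m, n}"
  proof
    assume "b_codes \<subseteq> {m, n}"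
    then have "card b_codes \<le> card {m, n}" by (intro card_mono) auto
    also have "\<dots> \<le> 2" by (simp add: card_insert_if)
    finally show False by (simp add: b_codes_def)
  qed
  then show ?thesis by blast
qed

text \<open>Every cell of the configuration space is contained in a square: at most one of the cells contains
\<open>a\<^sub>1\<close>, at most one \<open>a\<^sub>2\<close>, and there are enough vertices
\<open>b\<^sub>l\<close> to extend these cells to edges if necessary.\<close>

lemma three_cells:
  fixes c :: "nat \<Rightarrow> theta_vertex set"
  assumes ne: "\<And>n. n < 3 \<Longrightarrow> c n \<noteq> {}" and both: "\<And>n. n < 3 \<Longrightarrow> \<not> (A1 \<in> c n \<and> A2 \<in> c n)"
    and sub: "\<And>n. n < 3 \<Longrightarrow> \<exists>l. c n \<subseteq> {A1, A2, b_vertex l}"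
    and disj: "\<And>m n. m < 3 \<Longrightarrow> n < 3 \<Longrightarrow> m \<noteq> n \<Longrightarrow> c m \<inter> c n = {}"
  obtains p q r i j k where "{p, q, r} = {..<3}" "p \<noteq> q" "p \<noteq> r" "q \<noteq> r" "(i, j, k) \<in> set conf_index"
    "c p \<subseteq> {A1, b_vertex i}" "c q \<subseteq> {A2, b_vertex j}" "c r \<subseteq> {b_vertex k}"
proof -
  have d: "c 0 \<inter> c (Suc 0) = {}" "c 0 \<inter> c 2 = {}" "c (Suc 0) \<inter> c 2 = {}"
    using disj[of 0 "Suc 0"] disj[of 0 2] disj[of "Suc 0" 2] by auto
  have b: "\<not> (A1 \<in> c 0 \<and> A2 \<in> c 0)" "\<not> (A1 \<in> c (Suc 0) \<and> A2 \<in> c (Suc 0))" "\<not> (A1 \<in> c 2 \<and> A2 \<in> c 2)"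
    using both[of 0] both[of "Suc 0"] both[of 2] by auto
  have "\<exists>p q r. {p, q, r} = {0, Suc 0, 2} \<and> p \<noteq> q \<and> p \<noteq> r \<and> q \<noteq> r \<and>
      A1 \<notin> c q \<and> A1 \<notin> c r \<and> A2 \<notin> c p \<and> A2 \<notin> c r"
  proof -
    define ok where "ok p q r \<longleftrightarrow> A1 \<notin> c q \<and> A1 \<notin> c r \<and> A2 \<notin> c p \<and> A2 \<notin> c r" for p q r
    have "ok 0 (Suc 0) 2 \<or> ok 0 2 (Suc 0) \<or> ok (Suc 0) 0 2 \<or> ok (Suc 0) 2 0 \<or> ok 2 0 (Suc 0) \<or> ok 2 (Suc 0) 0"
      unfolding ok_def using d b by blast
    moreover have "{0, 2, Suc 0} = {0, Suc 0, 2}" "{Suc 0, 0, 2} = {0, Suc 0, 2}" "{Suc 0, 2, 0} = {0, Suc 0, 2}"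
      "{2, 0, Suc 0} = {0, Suc 0, 2}" "{2, Suc 0, 0} = {0, Suc 0, 2}" by auto
    ultimately show ?thesis unfolding ok_def by (metis n_not_Suc_n numeral_2_eq_2 zero_neq_numeral)
  qed
  then obtain p q r where pqr: "{p, q, r} = {..<3}" and dist: "p \<noteq> q" "p \<noteq> r" "q \<noteq> r"
    and A: "A1 \<notin> c q" "A1 \<notin> c r" "A2 \<notin> c p" "A2 \<notin> c r"
    unfolding lessThan_3 by blast
  have lt: "p < 3" "q < 3" "r < 3" using pqr by auto
  define \<beta> where "\<beta> n = {l \<in> b_codes. b_vertex l \<in> c n}" for n
  have single: "\<exists>l. \<beta> n \<subseteq> {l}" if n: "n < 3" for n
  proof -
    obtain l where l: "c n \<subseteq> {A1, A2, b_vertex l}" using sub[OF n] by blast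
    have "m = m'" if "m \<in> \<beta> n" "m' \<in> \<beta> n" for m m'
    proof -
      have "b_vertex m = b_vertex l" "b_vertex m' = b_vertex l"
        using subsetD[OF l, of "b_vertex m"] subsetD[OF l, of "b_vertex m'"] that by (simp_all add: \<beta>_def)
      then show ?thesis using that b_vertex_eq_iff[of m m'] by (simp add: \<beta>_def)
    qed
    then show ?thesis by blast
  qed
  have disj\<beta>: "\<beta> m \<inter> \<beta> n = {}" if "m < 3" "n < 3" "m \<noteq> n" for m n
    using disj[OF that] by (auto simp: \<beta>_def)
  have cover: "c n \<subseteq> {A1, A2} \<union> b_vertex ` \<beta> n" for n
    using theta_vertices by (fastforce simp: \<beta>_def)
  obtain k where k: "\<beta> r \<subseteq> {k}" using single[OF lt(3)] by blast
  have "\<beta> r \<noteq> {}" using cover[of r] A ne[OF lt(3)] by auto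
  then have k': "\<beta> r = {k}" "k \<in> b_codes" using k by (auto simp: \<beta>_def)
  obtain m where m: "\<beta> p \<subseteq> {m}" using single[OF lt(1)] by blast
  obtain j where j: "j \<in> b_codes" "\<beta> q \<subseteq> {j}" "j \<noteq> k" "j \<notin> \<beta> p"
  proof (cases "\<beta> q = {}")
    case True
    obtain j where "j \<in> b_codes" "j \<noteq> k" "j \<noteq> m" using another_b_code by blast
    then show ?thesis using that[of j] True m by auto
  next
    case False
    then obtain j where "\<beta> q = {j}" using single[OF lt(2)] by blast
    moreover have "j \<in> b_codes" using calculation by (auto simp: \<beta>_def)
    ultimately show ?thesis
      using that[of j] disj\<beta>[OF lt(2,3) dist(3)] disj\<beta>[OF lt(1,2) dist(1)] k' by auto
  qed
  obtain i where i: "i \<in> b_codes" "\<beta> p \<subseteq> {i}" "i \<noteq> k" "i \<noteq> j"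
  proof (cases "\<beta> p = {}")
    case True
    obtain i where "i \<in> b_codes" "i \<noteq> k" "i \<noteq> j" using another_b_code by blast
    then show ?thesis using that[of i] True by auto
  next
    case False
    then have "\<beta> p = {m}" using m by blast
    moreover have "m \<in> b_codes" using calculation by (auto simp: \<beta>_def)
    ultimately show ?thesis
      using that[of m] disj\<beta>[OF lt(1,3) dist(2)] j k' by auto
  qed
  show ?thesis
  proof (rule that[OF pqr dist])
    show "(i, j, k) \<in> set conf_index" unfolding conf_index using i j k' by auto
    show "c p \<subseteq> {A1, b_vertex i}" using cover[of p] A i by auto
    show "c q \<subseteq> {A2, b_vertex j}" using cover[of q] A j by auto
    show "c r \<subseteq> {b_vertex k}" using cover[of r] A k by auto
  qed
qed

lemma extensional_permute:
  assumes "inj_on x S" "inj_on y S" "x ` S = y ` S" "\<And>n. n \<notin> S \<Longrightarrow> x n = y n"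
  obtains \<pi> where "\<pi> permutes S" "y = x \<circ> \<pi>"
proof -
  define \<pi> where "\<pi> n = (if n \<in> S then inv_into S x (y n) else n)" for n
  have "bij_betw (inv_into S x \<circ> y) S S"
    using assms(1-3) by (intro bij_betw_trans[of y S "y ` S"]) (auto simp: bij_betw_inv_into bij_betw_def[of y] intro: bij_betw_inv_into[of x S "y ` S", unfolded bij_betw_def[of x]])
  then have "bij_betw \<pi> S S"
    by (rule bij_betw_cong[THEN iffD1, rotated]) (simp add: \<pi>_def)
  then have "\<pi> permutes S" by (rule bij_imp_permutes) (simp add: \<pi>_def)
  moreover have "y n = (x \<circ> \<pi>) n" for n
    using assms(3,4) by (cases "n \<in> S") (auto simp: \<pi>_def f_inv_into_f)
  ultimately show ?thesis using that by blast
qed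

definition square_cell :: "int \<times> int \<times> int \<Rightarrow> nat \<Rightarrow> theta_vertex set" where
  "square_cell = (\<lambda>(i, j, k) n. if n = 0 then {A1, b_vertex i} else if n = 1 then {A2, b_vertex j} else {b_vertex k})"

lemma square_conf_cell:
  assumes "st \<in> {0..1} \<times> {0..1}" "n < 3"
  shows "square_conf c st n \<in> closed_cell (square_cell c n)"
proof -
  obtain i j k s t where c: "c = (i, j, k)" and st: "st = (s, t)" by (cases c; cases st)
  have "n \<in> {0, Suc 0, 2}" using assms by (simp flip: lessThan_3)
  then show ?thesis
    using assms edge_point_cell[of s A1 "b_vertex i"] edge_point_cell[of t A2 "b_vertex j"]
      edge_point_cell[of 0 "b_vertex k" "b_vertex k"]
    by (auto simp: c st square_conf_simps square_cell_def)
qed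

lemma square_cell_disjoint:
  assumes "c \<in> set conf_index" "m < 3" "n < 3" "m \<noteq> n"
  shows "square_cell c m \<inter> square_cell c n = {}"
proof -
  obtain i j k where c: "c = (i, j, k)" by (cases c)
  note D = conf_index[THEN iffD1, OF assms(1)[unfolded c]]
  have "b_vertex i \<noteq> b_vertex j" "b_vertex i \<noteq> b_vertex k" "b_vertex j \<noteq> b_vertex k"
    using D b_vertex_eq_iff by blast+
  moreover have "m \<in> {0, Suc 0, 2}" "n \<in> {0, Suc 0, 2}" using assms by (simp_all flip: lessThan_3)
  ultimately show ?thesis using assms(4) by (auto simp: c square_cell_def)
qed

lemma square_cell_theta4: "closed_cell (square_cell c n) \<in> theta4_cells"
proof -
  obtain i j k where c: "c = (i, j, k)" by (cases c)
  have "b_vertex l \<in> {B1, B2, B3, B4}" for l by (simp add: b_vertex_def)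
  then have "square_cell c n \<in> (\<lambda>v. {v}) ` UNIV \<union> theta4_edges"
    unfolding c square_cell_def theta4_edges_def by auto
  then show ?thesis unfolding graph_cells_def by blast
qed

lemma square_conf_ordered:
  assumes c: "c \<in> set conf_index" and st: "st \<in> {0..1} \<times> {0..1}" and \<pi>: "\<pi> permutes {..<3}"
  shows "square_conf c st \<circ> \<pi> \<in> ordered_dconf theta4_cells 3"
proof -
  let ?e = "\<lambda>n. closed_cell (square_cell c (\<pi> n))"
  have lt: "\<pi> n < 3" if "n < 3" for n using permutes_in_image[OF \<pi>, of n] that by simp
  have mem: "square_conf c st \<circ> \<pi> \<in> (\<Pi>\<^sub>E n\<in>{..<3}. ?e n)"
  proof (rule PiE_I)
    show "(square_conf c st \<circ> \<pi>) n \<in> ?e n" if "n \<in> {..<3}" for n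
      using square_conf_cell[OF st lt] that by simp
    show "(square_conf c st \<circ> \<pi>) n = undefined" if "n \<notin> {..<3}" for n
      using permutes_not_in[OF \<pi> that] that by (cases c; cases st) (simp add: square_conf_def)
  qed
  have disj: "?e m \<inter> ?e n = {}" if "m < 3" "n < 3" "m \<noteq> n" for m n
    using closed_cell_disjoint[OF square_cell_disjoint[OF c lt lt]] that permutes_inj[OF \<pi>]
    by (auto dest: injD)
  show ?thesis
    unfolding ordered_dconf_def
  proof (rule UnionI[OF _ mem])
    have "(\<forall>i<3. ?e i \<in> theta4_cells) \<and> (\<forall>i<3. \<forall>j<3. i \<noteq> j \<longrightarrow> ?e i \<inter> ?e j = {})"
      using square_cell_theta4 disj by simp
    then show "(\<Pi>\<^sub>E n\<in>{..<3}. ?e n) \<in> {(\<Pi>\<^sub>E i\<in>{..<3}. e i) | e.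
        (\<forall>i<3. e i \<in> theta4_cells) \<and> (\<forall>i<3. \<forall>j<3. i \<noteq> j \<longrightarrow> e i \<inter> e j = {})}"
      by (intro CollectI exI[of _ ?e] conjI[OF refl])
  qed
qed

lemma ordered_square_conf:
  assumes "x \<in> ordered_dconf theta4_cells 3"
  obtains c st \<pi> where "c \<in> set conf_index" "st \<in> {0..1} \<times> {0..1}" "\<pi> permutes {..<3}" "x = square_conf c st \<circ> \<pi>"
proof -
  obtain e where x: "x \<in> (\<Pi>\<^sub>E n\<in>{..<3}. e n)" and e: "\<And>n. n < 3 \<Longrightarrow> e n \<in> theta4_cells"
    and disj: "\<And>m n. m < 3 \<Longrightarrow> n < 3 \<Longrightarrow> m \<noteq> n \<Longrightarrow> e m \<inter> e n = {}"
    using assms unfolding ordered_dconf_def by blast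
  have "\<exists>c. e n = closed_cell c \<and> finite c \<and> c \<noteq> {} \<and> \<not> (A1 \<in> c \<and> A2 \<in> c) \<and> (\<exists>l. c \<subseteq> {A1, A2, b_vertex l})"
    if "n < 3" for n
    using e[OF that] by (rule theta4_cellE) blast
  then obtain c where c: "\<And>n. n < 3 \<Longrightarrow> e n = closed_cell (c n) \<and> finite (c n) \<and> c n \<noteq> {} \<and>
      \<not> (A1 \<in> c n \<and> A2 \<in> c n) \<and> (\<exists>l. c n \<subseteq> {A1, A2, b_vertex l})"
    by metis
  have c1: "c n \<noteq> {}" and c2: "\<not> (A1 \<in> c n \<and> A2 \<in> c n)" and c3: "\<exists>l. c n \<subseteq> {A1, A2, b_vertex l}"
    if "n < 3" for n
    using c[OF that] by blast+
  have c4: "c m \<inter> c n = {}" if "m < 3" "n < 3" "m \<noteq> n" for m n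
  proof (rule ccontr)
    assume "c m \<inter> c n \<noteq> {}"
    then obtain v where "v \<in> c m" "v \<in> c n" by blast
    then have "edge_point v v 0 \<in> e m \<inter> e n"
      using c[OF that(1)] c[OF that(2)] vertex_in_cell by simp
    then show False using disj[OF that] by simp
  qed
  obtain p q r i j k where pqr: "{p, q, r} = {..<3}" and dist: "p \<noteq> q" "p \<noteq> r" "q \<noteq> r"
    and idx: "(i, j, k) \<in> set conf_index"
    and sub: "c p \<subseteq> {A1, b_vertex i}" "c q \<subseteq> {A2, b_vertex j}" "c r \<subseteq> {b_vertex k}"
    by (rule three_cells[OF c1 c2 c3 c4])
  have lt: "p < 3" "q < 3" "r < 3" using pqr by auto
  have mem: "x n \<in> closed_cell (c n)" if "n < 3" for n
    using x c[OF that] that by (auto simp: PiE_iff)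
  obtain s where s: "0 \<le> s" "s \<le> 1" "x p = edge_point A1 (b_vertex i) s"
    using closed_cell_mono[OF _ sub(1)] mem[OF lt(1)] edge_pointE[of "x p" A1 "b_vertex i"] by auto
  obtain t where t: "0 \<le> t" "t \<le> 1" "x q = edge_point A2 (b_vertex j) t"
    using closed_cell_mono[OF _ sub(2)] mem[OF lt(2)] edge_pointE[of "x q" A2 "b_vertex j"] by auto
  have xr: "x r = edge_point (b_vertex k) (b_vertex k) 0"
    using closed_cell_mono[OF _ sub(3)] mem[OF lt(3)] closed_cell_singleton[of "x r" "b_vertex k"] by auto
  define \<pi> where "\<pi> n = (if n = p then 0 else if n = q then Suc 0 else if n = r then 2 else n)" for n
  have "inj_on \<pi> {p, q, r}" "\<pi> ` {p, q, r} = {0, Suc 0, 2}"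
    using dist by (auto simp: \<pi>_def inj_on_def)
  then have "bij_betw \<pi> {..<3} {..<3}" unfolding pqr lessThan_3[symmetric] by (simp add: bij_betw_def)
  then have perm: "\<pi> permutes {..<3}"
    by (rule bij_imp_permutes) (use pqr in \<open>auto simp: \<pi>_def\<close>)
  have "x n = (square_conf (i, j, k) (s, t) \<circ> \<pi>) n" for n
  proof (cases "n \<in> {p, q, r}")
    case True
    then show ?thesis using dist s t xr by (auto simp: \<pi>_def square_conf_simps)
  next
    case False
    then have "n \<notin> {..<3}" unfolding pqr .
    moreover from this have "x n = undefined" using x by (auto simp: PiE_iff extensional_def)
    ultimately show ?thesis using False by (auto simp: \<pi>_def square_conf_def)
  qed
  then have eq: "x = square_conf (i, j, k) (s, t) \<circ> \<pi>" by (rule ext)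
  show ?thesis by (rule that[OF idx _ perm eq]) (use s t in auto)
qed

section \<open>The configuration space is the triangulated surface\<close>

lemma perm_class_eq_iff:
  assumes "inj_on x {..<n}" "inj_on y {..<n}" "\<And>m. m \<notin> {..<n} \<Longrightarrow> x m = y m"
  shows "perm_rel n `` {x} = perm_rel n `` {y} \<longleftrightarrow> x ` {..<n} = y ` {..<n}"
proof
  assume "perm_rel n `` {x} = perm_rel n `` {y}"
  moreover have "y \<in> perm_rel n `` {y}"
    using permutes_id by (auto simp: perm_rel_def intro!: exI[of _ id])
  ultimately obtain \<pi> where \<pi>: "\<pi> permutes {..<n}" "y = x \<circ> \<pi>"
    by (auto simp: perm_rel_def)
  show "x ` {..<n} = y ` {..<n}"
    unfolding \<pi>(2) image_comp[symmetric] permutes_image[OF \<pi>(1)] ..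
next
  assume "x ` {..<n} = y ` {..<n}"
  then obtain \<pi> where \<pi>: "\<pi> permutes {..<n}" "y = x \<circ> \<pi>"
    using extensional_permute[OF assms(1,2) _ assms(3)] by blast
  show "perm_rel n `` {x} = perm_rel n `` {y}"
  proof -
    have "(\<exists>\<rho>. \<rho> permutes {..<n} \<and> z = x \<circ> \<rho>) \<longleftrightarrow> (\<exists>\<rho>. \<rho> permutes {..<n} \<and> z = y \<circ> \<rho>)" for z
    proof
      assume "\<exists>\<rho>. \<rho> permutes {..<n} \<and> z = x \<circ> \<rho>"
      then obtain \<rho> where \<rho>: "\<rho> permutes {..<n}" "z = x \<circ> \<rho>" by blast
      have "y \<circ> (inv \<pi> \<circ> \<rho>) = x \<circ> ((\<pi> \<circ> inv \<pi>) \<circ> \<rho>)" by (simp add: \<pi>(2) comp_assoc)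
      also have "\<dots> = z" by (simp add: permutes_inv_o(1)[OF \<pi>(1)] \<rho>(2))
      finally show "\<exists>\<rho>. \<rho> permutes {..<n} \<and> z = y \<circ> \<rho>"
        using permutes_compose[OF \<rho>(1) permutes_inv[OF \<pi>(1)]] by metis
    next
      assume "\<exists>\<rho>. \<rho> permutes {..<n} \<and> z = y \<circ> \<rho>"
      then obtain \<rho> where \<rho>: "\<rho> permutes {..<n}" "z = y \<circ> \<rho>" by blast
      then show "\<exists>\<rho>. \<rho> permutes {..<n} \<and> z = x \<circ> \<rho>"
        using permutes_compose[OF \<rho>(1) \<pi>(1)] by (auto simp: \<pi>(2) comp_assoc)
    qed
    then show ?thesis by (auto simp: perm_rel_def)
  qed
qed

lemma inj_on_square_conf:
  assumes c: "c \<in> set conf_index" and st: "st \<in> {0..1} \<times> {0..1}" and \<pi>: "\<pi> permutes {..<3}"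
  shows "inj_on (square_conf c st \<circ> \<pi>) {..<3}"
proof -
  have "inj_on (square_conf c st) {..<3}"
  proof (rule inj_onI, rule ccontr)
    fix m n assume mn: "m \<in> {..<3}" "n \<in> {..<3}" "square_conf c st m = square_conf c st n" "m \<noteq> n"
    then show False
      using square_conf_cell[OF st, of m c] square_conf_cell[OF st, of n c]
        closed_cell_disjoint[OF square_cell_disjoint[OF c, of m n]] by auto
  qed
  then show ?thesis
    using permutes_inj_on[OF \<pi>] permutes_image[OF \<pi>] by (intro comp_inj_on) auto
qed

lemma continuous_on_square_conf: "continuous_on X (\<lambda>st. square_conf c st n)" if "n < 3"
proof -
  obtain i j k where c: "c = (i, j, k)" by (cases c)
  have "n \<in> {0, Suc 0, 2}" using that by (simp flip: lessThan_3)
  moreover have "continuous_on X (\<lambda>st. square_conf c st 0)" "continuous_on X (\<lambda>st. square_conf c st (Suc 0))"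
    "continuous_on X (\<lambda>st. square_conf c st 2)"
    unfolding c square_conf_def split_beta prod.case fst_conv snd_conv edge_point_def
    by (simp_all add: edge_point_def[abs_def])
       (intro continuous_on_coordinatewise_then_product continuous_intros)+
  ultimately show ?thesis by auto
qed

text \<open>The disjoint union of the squares, one copy for each square and each numbering of the three
points, is compact and maps onto both spaces. The numberings make the map to the ordered
configurations surjective. It is then a quotient map because these form a Hausdorff space, and so
is its composition with the quotient by the symmetric group.\<close>

lemma dconf_homeomorphic_surface:
  "dconf (UNIV :: theta_vertex set) theta4_edges 3 homeomorphic_space top_of_set (realization surface)"
proof -
  define I where "I = set conf_index \<times> {\<pi>. \<pi> permutes {..<3::nat}}"
  define Q :: "(real \<times> real) set" where "Q = {0..1} \<times> {0..1}"
  define T where "T = sum_topology (\<lambda>_. top_of_set Q) I"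
  define P where "P = subtopology (product_topology (\<lambda>_. graph_space UNIV theta4_edges) {..<3})
    (ordered_dconf theta4_cells 3)"
  define f where "f = (\<lambda>((c, \<pi> :: nat \<Rightarrow> nat), st). square_conf c st \<circ> \<pi>)"
  define g where "g = (\<lambda>((c, \<pi>::nat \<Rightarrow> nat), st). exchanges conf_moves (square_weights c st))"
  have "finite I" unfolding I_def by (intro finite_cartesian_product finite_permutations) auto
  moreover have "compact_space (top_of_set Q)"
    unfolding Q_def by (intro compact_space_subtopology) (simp add: compact_Times)
  ultimately have compact: "compact_space T"
    unfolding T_def by (intro compact_space_sum_topology) auto
  have topT: "topspace T = I \<times> Q" by (auto simp: T_def)
  have space: "ordered_dconf theta4_cells 3 \<subseteq> topspace (product_topology (\<lambda>_. graph_space UNIV theta4_edges) {..<3})"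
    unfolding ordered_dconf_def by (auto simp: graph_space_def PiE_iff)
  have topP: "topspace P = ordered_dconf theta4_cells 3"
    using space unfolding P_def topspace_subtopology by blast
  have f: "f ` topspace T = topspace P"
  proof (intro equalityI subsetI)
    fix x assume "x \<in> f ` topspace T"
    then show "x \<in> topspace P"
      unfolding topT topP I_def Q_def f_def using square_conf_ordered by auto
  next
    fix x assume "x \<in> topspace P"
    then obtain c st \<pi> where "c \<in> set conf_index" "st \<in> Q" "\<pi> permutes {..<3}" "x = square_conf c st \<circ> \<pi>"
      unfolding topP Q_def by (rule ordered_square_conf)
    then show "x \<in> f ` topspace T"
      unfolding topT I_def f_def by (intro rev_image_eqI[of "((c, \<pi>), st)"]) auto
  qed
  have f_cont: "continuous_map T P f"
  proof -
    have "continuous_map (top_of_set Q) P (\<lambda>st. square_conf c st \<circ> \<pi>)"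
      if c: "c \<in> set conf_index" and \<pi>: "\<pi> permutes {..<3}" for c \<pi>
      unfolding P_def continuous_map_in_subtopology continuous_map_componentwise
    proof (intro conjI ballI)
      show "(\<lambda>st. square_conf c st \<circ> \<pi>) ` topspace (top_of_set Q) \<subseteq> extensional {..<3}"
        using square_conf_ordered[OF c _ \<pi>] space unfolding Q_def by (fastforce simp: PiE_iff)
      show "(\<lambda>st. square_conf c st \<circ> \<pi>) \<in> topspace (top_of_set Q) \<rightarrow> ordered_dconf theta4_cells 3"
        using square_conf_ordered[OF c _ \<pi>] unfolding Q_def by auto
      fix n :: nat assume n: "n \<in> {..<3}"
      then have "\<pi> n < 3" using permutes_in_image[OF \<pi>, of n] by simp
      moreover have "square_conf c st (\<pi> n) \<in> \<Union> theta4_cells" if "st \<in> Q" for st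
        using square_conf_cell[of st "\<pi> n" c] \<open>\<pi> n < 3\<close> square_cell_theta4 that unfolding Q_def by blast
      ultimately show "continuous_map (top_of_set Q) (graph_space UNIV theta4_edges) (\<lambda>st. (square_conf c st \<circ> \<pi>) n)"
        unfolding graph_space_def using continuous_on_square_conf by (auto simp: continuous_map_in_subtopology)
    qed
    then have "continuous_map T P (\<lambda>(i, st). (case i of (c, \<pi>) \<Rightarrow> square_conf c st \<circ> \<pi>))"
      unfolding T_def by (intro continuous_map_from_sum_topology) (auto simp: I_def)
    moreover have "f = (\<lambda>(i, st). (case i of (c, \<pi>) \<Rightarrow> square_conf c st \<circ> \<pi>))"
      by (simp add: f_def fun_eq_iff)
    ultimately show ?thesis by (simp only:)
  qed
  have "Hausdorff_space P"
    unfolding P_def graph_space_def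
    by (intro Hausdorff_space_subtopology) (simp add: Hausdorff_space_product_topology Hausdorff_space_functions)
  then have "quotient_map T P f"
    by (intro quotient_map_compact_Hausdorff compact f_cont f)
  then have q1: "quotient_map T (dconf UNIV theta4_edges 3) ((\<lambda>x. perm_rel 3 `` {x}) \<circ> f)"
    unfolding dconf_def P_def by (rule quotient_map_compose) (rule quotient_map_quotient_topology)
  have g: "g ` topspace T = topspace (top_of_set (realization surface))"
  proof -
    have "(\<Union>c\<in>set conf_index. square_weights c ` Q) = realization conf_facets"
      unfolding Q_def by (rule square_weights_image)
    then have "exchanges conf_moves ` (\<Union>c\<in>set conf_index. square_weights c ` Q) = realization surface"
      using bij_betw_imp_surj_on[OF bij_betw_exchanges[OF conf_surface]] by simp
    moreover have "g ` topspace T = exchanges conf_moves ` (\<Union>c\<in>set conf_index. square_weights c ` Q)"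
    proof (intro equalityI subsetI)
      fix y assume "y \<in> exchanges conf_moves ` (\<Union>c\<in>set conf_index. square_weights c ` Q)"
      then obtain c st where "c \<in> set conf_index" "st \<in> Q" "y = exchanges conf_moves (square_weights c st)"
        by blast
      then show "y \<in> g ` topspace T"
        unfolding topT I_def g_def using permutes_id by (intro rev_image_eqI[of "((c, id), st)"]) auto
    qed (auto simp: topT I_def g_def)
    ultimately show ?thesis by simp
  qed
  have g_cont: "continuous_map T (top_of_set (realization surface)) g"
  proof -
    have "continuous_map (top_of_set Q) euclidean (exchanges conf_moves \<circ> square_weights c)" for c
      unfolding continuous_map_iff_continuous
      by (intro continuous_on_compose continuous_on_exchanges continuous_on_square_weights)
    then have "continuous_map T euclidean (\<lambda>(i, st). (case i of (c, \<pi>) \<Rightarrow> exchanges conf_moves (square_weights c st)))"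
      unfolding T_def by (intro continuous_map_from_sum_topology) (auto simp: o_def)
    moreover have "g = (\<lambda>(i, st). (case i of (c, \<pi>) \<Rightarrow> exchanges conf_moves (square_weights c st)))"
      by (simp add: g_def fun_eq_iff)
    ultimately have "continuous_map T euclidean g" by (simp only:)
    then show ?thesis using g by (auto simp: continuous_map_in_subtopology)
  qed
  have q2: "quotient_map T (top_of_set (realization surface)) g"
    by (intro quotient_map_compact_Hausdorff compact Hausdorff_space_functions g_cont g)
  show ?thesis
  proof (rule quotient_maps_same_fibres[OF q1 q2])
    fix x y assume "x \<in> topspace T" "y \<in> topspace T"
    then obtain c \<pi> st c' \<pi>' st' where x: "x = ((c, \<pi>), st)" and y: "y = ((c', \<pi>'), st')"
      and c: "c \<in> set conf_index" "\<pi> permutes {..<3}" "st \<in> Q" and c': "c' \<in> set conf_index" "\<pi>' permutes {..<3}" "st' \<in> Q"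
      unfolding topT I_def by blast
    have out: "(square_conf c st \<circ> \<pi>) m = (square_conf c' st' \<circ> \<pi>') m" if "m \<notin> {..<3}" for m
      using that permutes_not_in[OF c(2) that] permutes_not_in[OF c'(2) that]
      by (cases c; cases c'; cases st; cases st') (simp add: square_conf_def)
    have "perm_rel 3 `` {f x} = perm_rel 3 `` {f y} \<longleftrightarrow> (square_conf c st \<circ> \<pi>) ` {..<3} = (square_conf c' st' \<circ> \<pi>') ` {..<3}"
      unfolding x y f_def prod.case
      by (intro perm_class_eq_iff out inj_on_square_conf c c'[unfolded Q_def] c[unfolded Q_def])
    also have "\<dots> \<longleftrightarrow> square_conf c st ` {..<3} = square_conf c' st' ` {..<3}"
      by (simp only: image_comp[symmetric] permutes_image[OF c(2)] permutes_image[OF c'(2)])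
    also have "\<dots> \<longleftrightarrow> square_weights c st = square_weights c' st'"
      using square_fibres c c' unfolding Q_def by (cases c; cases c'; cases st; cases st') auto
    also have "\<dots> \<longleftrightarrow> exchanges conf_moves (square_weights c st) = exchanges conf_moves (square_weights c' st')"
    proof -
      have "square_weights c st \<in> realization conf_facets" "square_weights c' st' \<in> realization conf_facets"
        using square_weights_image c c' unfolding Q_def by blast+
      then show ?thesis
        using bij_betw_imp_inj_on[OF bij_betw_exchanges[OF conf_surface]] by (auto dest: inj_onD)
    qed
    finally show "((\<lambda>x. perm_rel 3 `` {x}) \<circ> f) x = ((\<lambda>x. perm_rel 3 `` {x}) \<circ> f) y \<longleftrightarrow> g x = g y"
      by (simp add: x y g_def)
  qed
qed

theorem mainTheorem4:
  shows "dconf (UNIV :: theta_vertex set) theta4_edges 3 homeomorphic_space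
           closed_orientable_surface 3"
  using dconf_homeomorphic_surface surface_homeomorphic_polygon by (rule homeomorphic_space_trans)

end
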